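(* Let $H\in(0,1)$, $\sigma>0$, $X_t=\sigma B_t^H$ for $t\ge 0$, where $B^H$ is a standard fractional Brownian motion with Hurst parameter $H$, let $x\in\mathbb{R}$, and let $L_t(x)$ denote the local time of $X$ at level $x$ up to time $t$. Let $f:\mathbb{R}^2\to\mathbb{R}$ be a measurable function such that $|f(y,z)|\le h_1(y)h_2(z)$ for all $y,z\in\mathbb{R}$, where $h_1,h_2:\mathbb{R}\to[0,\infty)$ are continuous, $h_1$ tends to zero at infinity, $\int_{\mathbb{R}}|y|^2h_1(y)\,dy<\infty$, and $h_2$ has polynomial growth. Let $(u_n)_{n\ge1}$ be a sequence of positive real numbers with $u_n\to\infty$ and $u_n/n\to0$ as $n\to\infty$, and set $$V(f)^n_t:=\frac{u_n}{n}\sum_{i=0}^{[nt]}f\big(u_n(X_{i/n}-x),\,n^H\Delta_i^nX\big),\qquad \Delta_i^nX=X_{(i+1)/n}-X_{i/n}.$$ Then, as $n\to\infty$, $$V(f)^n_t\ \xrightarrow{\ \text{u.c.p.}\ }\ V(f)_t:=L_t(x)\int_{\mathbb{R}^2}f(y,z)\,\phi_{\sigma^2}(z)\,dy\,dz,$$ where $\phi_{\sigma^2}$ is the density of the normal distribution $\mathcal{N}(0,\sigma^2)$.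
   Context: A standard fractional Brownian motion with Hurst parameter $H\in(0,1)$ is a continuous zero-mean Gaussian process $(B^H_t)_{t\ge0}$ with covariance $\mathbb{E}[B^H_tB^H_s]=\frac12(t^{2H}+s^{2H}-|t-s|^{2H})$. The occupation measure of $X$ is $\nu_t(A)=\int_0^t1_A(X_s)\,ds$ for Borel $A\subset\mathbb{R}$; the local time $L_t(x)=\frac{d\nu_t}{dx}(x)$ is its Lebesgue density. For $X=\sigma B^H$ the local time exists and is taken in its version continuous in $(t,x)$. $[\cdot]$ denotes the integer part. A function has polynomial growth if it is bounded in absolute value by $C(1+|z|^p)$ for some $C,p>0$. $Y^n\xrightarrow{\text{u.c.p.}}Y$ (uniform convergence in probability) means $\sup_{t\in[0,T]}|Y^n_t-Y_t|\to0$ in probability for every $T>0$. *)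

theory Defs
  imports "HOL-Probability.Probability"
begin

text \<open>
  Processes are functions \<open>real \<Rightarrow> 'a \<Rightarrow> real\<close>; only their values at times \<open>t \<ge> 0\<close> matter.
\<close>

text \<open>Point masses count as (degenerate) normal laws. The second parameter of
  \<^const>\<open>normal_density\<close> is the standard deviation.\<close>

definition gaussian_rv :: "'a measure \<Rightarrow> ('a \<Rightarrow> real) \<Rightarrow> bool" where
  "gaussian_rv M Y \<longleftrightarrow> Y \<in> borel_measurable M \<and>
     (\<exists>\<mu> s. s > 0 \<and> distr M borel Y = density lborel (normal_density \<mu> s) \<or>
            distr M borel Y = return borel \<mu>)"

definition gaussian_process :: "'a measure \<Rightarrow> (real \<Rightarrow> 'a \<Rightarrow> real) \<Rightarrow> bool" where
  "gaussian_process M X \<longleftrightarrow>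
     (\<forall>I c. finite I \<and> I \<subseteq> {0..} \<longrightarrow> gaussian_rv M (\<lambda>\<omega>. \<Sum>t\<in>I. c t * X t \<omega>))"

definition fractional_brownian_motion ::
    "'a measure \<Rightarrow> real \<Rightarrow> (real \<Rightarrow> 'a \<Rightarrow> real) \<Rightarrow> bool" where
  "fractional_brownian_motion M H B \<longleftrightarrow>
     gaussian_process M B \<and>
     (AE \<omega> in M. continuous_on {0..} (\<lambda>t. B t \<omega>)) \<and>
     (\<forall>t\<ge>0. integral\<^sup>L M (B t) = 0) \<and>
     (\<forall>t\<ge>0. \<forall>s\<ge>0. (\<integral>\<omega>. B t \<omega> * B s \<omega> \<partial>M) =
        (t powr (2 * H) + s powr (2 * H) - \<bar>t - s\<bar> powr (2 * H)) / 2)"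

definition occupation_measure :: "(real \<Rightarrow> real) \<Rightarrow> real \<Rightarrow> real measure" where
  "occupation_measure w t = distr (restrict_space lborel {0..t}) borel w"

lemma emeasure_occupation_measure:
  assumes "continuous_on {0..} w" "A \<in> sets borel"
  shows "emeasure (occupation_measure w t) A = (\<integral>\<^sup>+s\<in>{0..t}. indicator A (w s) \<partial>lborel)"
proof -
  have c: "continuous_on {0..t} w"
    using assms(1) by (rule continuous_on_subset) auto
  have m: "w \<in> measurable (restrict_space lborel {0..t}) borel"
    using borel_measurable_continuous_on_restrict[OF c]
    by (simp add: measurable_def sets_restrict_space space_restrict_space)
  have "emeasure (occupation_measure w t) A =
      (\<integral>\<^sup>+y. indicator A y \<partial>occupation_measure w t)"
    using assms(2) by (simp add: occupation_measure_def)
  also have "\<dots> = (\<integral>\<^sup>+s. indicator A (w s) \<partial>restrict_space lborel {0..t})"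
    unfolding occupation_measure_def using assms(2) m by (intro nn_integral_distr) auto
  also have "\<dots> = (\<integral>\<^sup>+s\<in>{0..t}. indicator A (w s) \<partial>lborel)"
    by (intro nn_integral_restrict_space) auto
  finally show ?thesis .
qed

text \<open>
  \<open>L t y \<omega>\<close> is a version, jointly continuous in \<open>(t, y)\<close>, of the local time of \<open>X\<close>.
  Nonnegativity has to be required separately: \<^const>\<open>ennreal\<close> cuts off negative values, so
  the density condition alone would leave \<open>L\<close> undetermined off the range of the path.
\<close>

definition continuous_local_time ::
    "'a measure \<Rightarrow> (real \<Rightarrow> 'a \<Rightarrow> real) \<Rightarrow> (real \<Rightarrow> real \<Rightarrow> 'a \<Rightarrow> real) \<Rightarrow> bool" where
  "continuous_local_time M X L \<longleftrightarrow>
     (AE \<omega> in M.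
        continuous_on ({0..} \<times> UNIV) (\<lambda>(t, y). L t y \<omega>) \<and>
        (\<forall>t\<ge>0. \<forall>y. L t y \<omega> \<ge> 0) \<and>
        (\<forall>t\<ge>0. occupation_measure (\<lambda>s. X s \<omega>) t = density lborel (\<lambda>y. ennreal (L t y \<omega>))))"

definition polynomial_growth :: "(real \<Rightarrow> real) \<Rightarrow> bool" where
  "polynomial_growth g \<longleftrightarrow> (\<exists>C>0. \<exists>p>0. \<forall>z. \<bar>g z\<bar> \<le> C * (1 + \<bar>z\<bar> powr p))"

text \<open>
  Convergence to zero in probability of nonnegative, possibly infinite variables. Measurability
  is part of the definition, since \<^const>\<open>measure\<close> is zero on non-measurable sets. It refers to
  the completion because paths and local times are only regular almost surely.
\<close>

definition tendsto_0_in_probability :: "'a measure \<Rightarrow> (nat \<Rightarrow> 'a \<Rightarrow> ennreal) \<Rightarrow> bool" where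
  "tendsto_0_in_probability M Z \<longleftrightarrow>
     (\<forall>n. Z n \<in> borel_measurable (completion M)) \<and>
     (\<forall>\<epsilon>::real. \<epsilon> > 0 \<longrightarrow>
        (\<lambda>n. measure (completion M) {\<omega> \<in> space M. Z n \<omega> > ennreal \<epsilon>}) \<longlonglongrightarrow> 0)"

text \<open>The supremum is taken in \<^typ>\<open>ennreal\<close>, so that it is infinite for unbounded paths.\<close>

definition ucp ::
    "'a measure \<Rightarrow> (nat \<Rightarrow> real \<Rightarrow> 'a \<Rightarrow> real) \<Rightarrow> (real \<Rightarrow> 'a \<Rightarrow> real) \<Rightarrow> bool" where
  "ucp M Y Y' \<longleftrightarrow>
     (\<forall>T>0. tendsto_0_in_probability M (\<lambda>n \<omega>. SUP t\<in>{0..T}. ennreal \<bar>Y n t \<omega> - Y' t \<omega>\<bar>))"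

definition V_stat ::
    "(real \<Rightarrow> 'a \<Rightarrow> real) \<Rightarrow> real \<Rightarrow> real \<Rightarrow> (nat \<Rightarrow> real) \<Rightarrow> (real \<times> real \<Rightarrow> real) \<Rightarrow>
     nat \<Rightarrow> real \<Rightarrow> 'a \<Rightarrow> real" where
  "V_stat X H x u f n t \<omega> =
     u n / real n *
       (\<Sum>i = 0..nat \<lfloor>real n * t\<rfloor>.
          f (u n * (X (real i / real n) \<omega> - x),
             real n powr H * (X (real (i + 1) / real n) \<omega> - X (real i / real n) \<omega>)))"

end

theory Submission
  imports Defs
begin

text \<open>
  The proof is a second moment argument in which the limit is never computed. By linearity assume
  \<open>f \<ge> 0\<close>. Apart from the term \<open>i = 0\<close>, which is negligible, the statistic \<open>V\<close> at time \<open>t\<close> is the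
  integral over \<open>s\<close>, up to edge effects from \<open>0\<close> to \<open>t\<close>, of
  \<open>u\<^sub>n f(u\<^sub>n (X\<^sub>\<tau> - x), n powr H * \<Delta>)\<close>, where \<open>\<tau>\<close> is the grid point below \<open>s\<close> and \<open>\<Delta>\<close> the increment
  that starts there. It is compared with \<open>c W\<close>, where \<open>c\<close> is the integral of
  \<open>f(y, z) \<phi>(z)\<close> and \<open>W\<close> is the integral of \<open>u\<^sub>n\<close> times the indicator of
  \<open>0 \<le> u\<^sub>n (X\<^sub>s - x) \<le> 1\<close>. By the occupation formula \<open>W\<close> is an average of the local time over levels
  close to \<open>x\<close>, so that \<open>W\<close> converges to \<open>L\<^sub>t(x)\<close> for every path, the local time being continuous in
  the level. It remains to see that \<open>E (V - c W)\<^sup>2\<close> vanishes in the limit.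

  The integrands of \<open>V\<close> and \<open>W\<close> are kernels of the same shape, of masses \<open>c\<close> and \<open>1\<close>. For \<open>s \<noteq> r\<close> the
  normalised increments at \<open>s\<close> and \<open>r\<close> become independent of each other and of the pair of values
  \<open>(X\<^sub>s, X\<^sub>r)\<close>, while the factors \<open>u\<^sub>n\<close> turn the dependence on these values into evaluation of their
  joint density at \<open>(x, x)\<close>. Hence the expectation of the product of a kernel of mass \<open>a\<close> at \<open>s\<close> and one of
  mass \<open>b\<close> at \<open>r\<close> tends to \<open>a b p\<close> with a common factor \<open>p = p(s, r)\<close> (\<open>kernel_pair_tendsto\<close>).
  Integrated over \<open>s\<close> and \<open>r\<close>, this gives the limits \<open>c\<^sup>2 K\<close>, \<open>c K\<close> and \<open>K\<close> for \<open>E V\<^sup>2\<close>, \<open>E V W\<close> and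
  \<open>E W\<^sup>2\<close> with the same finite \<open>K\<close>, and these cancel (\<open>second_moment_cancellation\<close>).

  Limit and integral are interchanged in \<open>kernel_integral_moment_tendsto\<close>. Where \<open>s\<close> and \<open>r\<close> are at least
  two grid steps apart, the expectation is at most a constant times
  \<open>(min s r) powr (-H) * \<bar>s - r\<bar> powr (-H)\<close> (\<open>kernel_pair_bound\<close>), because the determinant of the covariance
  matrix of \<open>(X\<^sub>s, X\<^sub>r)\<close> has the lower bound \<open>fbm_determinant_bound\<close>; this is integrable since
  \<open>H < 1\<close>. The remaining strip has width of order \<open>1 / n\<close>, and there the crude bound of order \<open>u\<^sub>n\<close> from
  \<open>kernel_square_bound\<close> contributes \<open>O(u\<^sub>n / n)\<close>.

  For \<open>f \<ge> 0\<close> the statistic and the local time are nondecreasing in \<open>t\<close>, and the limit is continuous, so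
  convergence in probability at fixed times is locally uniform, as in Dini's theorem
  (\<open>uniform_deviation_null_nonneg\<close>).
\<close>

section \<open>Joint laws from characteristic functions\<close>

text \<open>
  After division by \<open>m\<close> the function \<open>w\<close> is a probability density, and the hypothesis says
  that under the reweighted measure \<open>Z\<close> has the characteristic function of \<open>\<nu>\<close>. Uniqueness of
  characteristic functions does the rest; if \<open>m = 0\<close>, then \<open>w\<close> vanishes almost surely.
\<close>

lemma (in prob_space) weighted_law_from_char:
  fixes w Z :: "'a \<Rightarrow> real"
  assumes [measurable]: "w \<in> borel_measurable M" "Z \<in> borel_measurable M" "A \<in> sets borel"
    and w: "\<And>\<omega>. 0 \<le> w \<omega>" "\<And>\<omega>. w \<omega> \<le> b"
    and \<nu>: "real_distribution \<nu>"
    and ch: "\<And>a. (\<integral>\<omega>. of_real (w \<omega>) * iexp (a * Z \<omega>) \<partial>M) = of_real m * char \<nu> a"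
  shows "(\<integral>\<omega>. w \<omega> * indicator A (Z \<omega>) \<partial>M) = m * measure \<nu> A"
proof -
  interpret \<nu>: real_distribution \<nu> by fact
  have iw: "integrable M w"
    by (rule integrable_const_bound[where B=b]) (use w in auto)
  have "(\<integral>\<omega>. complex_of_real (w \<omega>) \<partial>M) = of_real m"
    using ch[of 0] by (simp add: \<nu>.char_zero)
  then have m: "m = (\<integral>\<omega>. w \<omega> \<partial>M)"
    by (metis integral_complex_of_real of_real_eq_iff)
  show ?thesis
  proof (cases "m = 0")
    case True
    then have "AE \<omega> in M. w \<omega> = 0"
      using m w iw by (subst integral_nonneg_eq_0_iff_AE[symmetric]) auto
    then have "(\<integral>\<omega>. w \<omega> * indicator A (Z \<omega>) \<partial>M) = (\<integral>\<omega>. 0 \<partial>M)"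
      by (intro integral_cong_AE) auto
    then show ?thesis using True by simp
  next
    case False
    then have mpos: "m > 0"
      using m w Bochner_Integration.integral_nonneg[where M=M and f=w] by fastforce
    define P where "P = density M (\<lambda>\<omega>. ennreal (w \<omega> / m))"
    have "prob_space P"
    proof
      have "emeasure P (space P) = (\<integral>\<^sup>+\<omega>. ennreal (w \<omega> / m) \<partial>M)"
        unfolding P_def by (subst emeasure_density) (auto intro!: nn_integral_cong)
      also have "\<dots> = ennreal (\<integral>\<omega>. w \<omega> / m \<partial>M)"
        using iw w mpos by (intro nn_integral_eq_integral) auto
      also have "\<dots> = 1" using m mpos by simp
      finally show "emeasure P (space P) = 1" .
    qed
    then interpret P: prob_space P .
    have [measurable]: "Z \<in> borel_measurable P" by (simp add: P_def)
    have rd: "real_distribution (distr P borel Z)"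
      by (rule P.real_distribution_distr) measurable
    have "char (distr P borel Z) = char \<nu>"
    proof
      fix a
      have "char (distr P borel Z) a = (\<integral>\<omega>. iexp (a * Z \<omega>) \<partial>P)"
        unfolding char_def by (subst integral_distr) auto
      also have "\<dots> = (\<integral>\<omega>. (w \<omega> / m) *\<^sub>R iexp (a * Z \<omega>) \<partial>M)"
        unfolding P_def by (subst integral_density) (use w mpos in auto)
      also have "\<dots> = (\<integral>\<omega>. (of_real (w \<omega>) * iexp (a * Z \<omega>)) / of_real m \<partial>M)"
        by (simp add: scaleR_conv_of_real)
      also have "\<dots> = (\<integral>\<omega>. (of_real (w \<omega>) * iexp (a * Z \<omega>)) \<partial>M) / of_real m"
        by (rule integral_divide_zero)
      also have "\<dots> = char \<nu> a" using ch[of a] mpos by simp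
      finally show "char (distr P borel Z) a = char \<nu> a" .
    qed
    then have eq: "distr P borel Z = \<nu>" by (rule Levy_uniqueness[OF rd \<nu>])
    have "measure \<nu> A = (\<integral>x. indicator A x \<partial>distr P borel Z)"
      by (subst eq) simp
    also have "\<dots> = (\<integral>\<omega>. indicator A (Z \<omega>) \<partial>P)"
      by (subst integral_distr) auto
    also have "\<dots> = (\<integral>\<omega>. (w \<omega> / m) *\<^sub>R indicator A (Z \<omega>) \<partial>M)"
      unfolding P_def by (subst integral_density) (use w mpos in auto)
    also have "\<dots> = (\<integral>\<omega>. (w \<omega> * indicator A (Z \<omega>)) / m \<partial>M)"
      by simp
    also have "\<dots> = (\<integral>\<omega>. w \<omega> * indicator A (Z \<omega>) \<partial>M) / m"
      by (rule integral_divide_zero)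
    finally show ?thesis using mpos by (simp add: field_simps)
  qed
qed

lemma integral_add_average:
  fixes f g h :: "'a \<Rightarrow> complex"
  assumes "integrable M f" "integrable M g" "integrable M h"
  shows "(\<integral>\<omega>. f \<omega> + (g \<omega> + h \<omega>) / d \<partial>M) = (\<integral>\<omega>. f \<omega> \<partial>M) + ((\<integral>\<omega>. g \<omega> \<partial>M) + (\<integral>\<omega>. h \<omega> \<partial>M)) / d"
    and "(\<integral>\<omega>. f \<omega> + (g \<omega> - h \<omega>) / d \<partial>M) = (\<integral>\<omega>. f \<omega> \<partial>M) + ((\<integral>\<omega>. g \<omega> \<partial>M) - (\<integral>\<omega>. h \<omega> \<partial>M)) / d"
  using assms by simp_all

text \<open>
  The weight \<open>w\<close> makes an induction on \<open>k\<close> possible. To pass from \<open>k\<close> to \<open>k + 1\<close> variables, the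
  hypothesis for \<open>k\<close> is used with the weights \<open>w\<close>, \<open>w (1 + cos (c Z\<^sub>k))\<close> and
  \<open>w (1 + sin (c Z\<^sub>k))\<close>, all of them bounded and nonnegative. Together they determine the characteristic
  function of \<open>Z\<^sub>k\<close> under \<open>w\<close> times the indicator of the rectangle in the first \<open>k\<close> variables, and
  \<open>weighted_law_from_char\<close> applies to this function as the weight.
\<close>

lemma (in prob_space) weighted_rectangle_from_char:
  fixes Z :: "nat \<Rightarrow> 'a \<Rightarrow> real"
  assumes Z[measurable]: "\<And>i. i < k \<Longrightarrow> Z i \<in> borel_measurable M"
    and A: "\<And>i. i < k \<Longrightarrow> A i \<in> sets borel"
    and \<nu>: "\<And>i. i < k \<Longrightarrow> real_distribution (\<nu> i)"
    and [measurable]: "w \<in> borel_measurable M"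
    and w: "\<And>\<omega>. 0 \<le> w \<omega>" "\<And>\<omega>. w \<omega> \<le> b"
    and ch: "\<And>a. (\<integral>\<omega>. of_real (w \<omega>) * iexp (\<Sum>i<k. a i * Z i \<omega>) \<partial>M)
        = of_real m * (\<Prod>i<k. char (\<nu> i) (a i))"
  shows "(\<integral>\<omega>. w \<omega> * (\<Prod>i<k. indicator (A i) (Z i \<omega>)) \<partial>M) = m * (\<Prod>i<k. measure (\<nu> i) (A i))"
  using assms
proof (induction k arbitrary: w b m)
  case 0
  have "(\<integral>\<omega>. complex_of_real (w \<omega>) \<partial>M) = of_real m"
    using 0(7) by simp
  then have "m = (\<integral>\<omega>. w \<omega> \<partial>M)"
    by (metis integral_complex_of_real of_real_eq_iff)
  then show ?case by simp
next
  case (Suc k)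
  note [measurable] = Suc.prems(1,2,4)
  interpret \<nu>k: real_distribution "\<nu> k" using Suc.prems by auto
  let ?R = "\<lambda>\<omega>. \<Prod>i<k. indicator (A i) (Z i \<omega>) :: real"
  let ?P = "\<Prod>i<k. measure (\<nu> i) (A i)"
  have R_meas[measurable]: "?R \<in> borel_measurable M"
  proof (rule borel_measurable_prod)
    fix i assume i: "i \<in> {..<k}"
    have [measurable]: "Z i \<in> borel_measurable M" "A i \<in> sets borel" using i Suc.prems by auto
    show "(\<lambda>\<omega>. indicator (A i) (Z i \<omega>) :: real) \<in> borel_measurable M" by measurable
  qed
  have Zk[measurable]: "Z k \<in> borel_measurable M" using Suc.prems by auto
  have R01: "0 \<le> ?R \<omega>" "?R \<omega> \<le> 1" for \<omega>
    by (auto intro!: prod_nonneg prod_le_1 simp: indicator_def)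
  have b0: "0 \<le> b" using Suc.prems(5,6) order_trans by blast
  have S_meas[measurable]: "(\<lambda>\<omega>. \<Sum>i<k. a i * Z i \<omega>) \<in> borel_measurable M" for a
    by (intro borel_measurable_sum borel_measurable_times) (use Suc.prems in auto)
  have int: "integrable M (\<lambda>\<omega>. of_real (w \<omega>) * iexp (g \<omega>))" if [measurable]: "g \<in> borel_measurable M" for g
    by (rule integrable_const_bound[where B=b]) (use Suc.prems(5,6) in \<open>auto simp: norm_mult\<close>)
  have full: "(\<integral>\<omega>. of_real (w \<omega>) * iexp ((\<Sum>i<k. a i * Z i \<omega>) + c * Z k \<omega>) \<partial>M)
      = of_real m * (\<Prod>i<k. char (\<nu> i) (a i)) * char (\<nu> k) c" for a c
  proof -
    have "(\<integral>\<omega>. of_real (w \<omega>) * iexp (\<Sum>i<Suc k. (a(k:=c)) i * Z i \<omega>) \<partial>M)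
      = of_real m * (\<Prod>i<Suc k. char (\<nu> i) ((a(k:=c)) i))"
      by (rule Suc.prems(7))
    moreover have "(\<Sum>i<Suc k. (a(k:=c)) i * Z i \<omega>) = (\<Sum>i<k. a i * Z i \<omega>) + c * Z k \<omega>" for \<omega>
      by simp
    moreover have "(\<Prod>i<Suc k. char (\<nu> i) ((a(k:=c)) i)) = (\<Prod>i<k. char (\<nu> i) (a i)) * char (\<nu> k) c"
      by simp
    ultimately show ?thesis by (simp add: mult.assoc)
  qed
  have full0: "(\<integral>\<omega>. of_real (w \<omega>) * iexp (\<Sum>i<k. a i * Z i \<omega>) \<partial>M)
      = of_real m * (\<Prod>i<k. char (\<nu> i) (a i))" for a
    using full[of a 0] by (simp add: \<nu>k.char_zero)
  have step: "(\<integral>\<omega>. w' \<omega> * ?R \<omega> \<partial>M) = m' * ?P"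
    if [measurable]: "w' \<in> borel_measurable M" and "\<And>\<omega>. 0 \<le> w' \<omega>" "\<And>\<omega>. w' \<omega> \<le> b'"
      and "\<And>a. (\<integral>\<omega>. of_real (w' \<omega>) * iexp (\<Sum>i<k. a i * Z i \<omega>) \<partial>M) = of_real m' * (\<Prod>i<k. char (\<nu> i) (a i))"
    for w' b' m'
    by (rule Suc.IH[of w' b' m']) (use Suc.prems(1-3) that in auto)
  have char_neg: "char (\<nu> k) (-c) = cnj (char (\<nu> k) c)" for c
  proof -
    have "iexp (- c * x) = cnj (iexp (c * x))" for x
      by (simp add: exp_cnj)
    then have "char (\<nu> k) (-c) = (\<integral>x. cnj (iexp (c * x)) \<partial>\<nu> k)"
      unfolding char_def by (intro Bochner_Integration.integral_cong) auto
    also have "\<dots> = cnj (char (\<nu> k) c)"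
      unfolding char_def by (rule Bochner_Integration.integral_cnj)
    finally show ?thesis .
  qed
  have e1: "(\<integral>\<omega>. w \<omega> * ?R \<omega> \<partial>M) = m * ?P"
    by (rule step[of _ b]) (use Suc.prems full[of _ 0] \<nu>k.char_zero in auto)
  have trig: "complex_of_real (w \<omega> * (1 + cos (c * Z k \<omega>))) * iexp s =
      of_real (w \<omega>) * iexp s + (of_real (w \<omega>) * iexp (s + c * Z k \<omega>)
        + of_real (w \<omega>) * iexp (s + (-c) * Z k \<omega>)) / 2"
     "complex_of_real (w \<omega> * (1 + sin (c * Z k \<omega>))) * iexp s =
      of_real (w \<omega>) * iexp s + (of_real (w \<omega>) * iexp (s + c * Z k \<omega>)
        - of_real (w \<omega>) * iexp (s + (-c) * Z k \<omega>)) / (2 * \<i>)" for c s \<omega>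
  proof -
    let ?t = "c * Z k \<omega>"
    have 1: "iexp (s + ?t) = iexp s * iexp ?t" "iexp (s + (-c) * Z k \<omega>) = iexp s * exp (- (\<i> * ?t))"
      by (simp_all add: exp_add[symmetric] algebra_simps)
    have 2: "complex_of_real (cos ?t) = (iexp ?t + exp (- (\<i> * ?t))) / 2"
      "complex_of_real (sin ?t) = (iexp ?t - exp (- (\<i> * ?t))) / (2 * \<i>)"
      by (simp_all only: cos_of_real[symmetric] sin_of_real[symmetric] cos_exp_eq sin_exp_eq)
    show "complex_of_real (w \<omega> * (1 + cos ?t)) * iexp s =
      of_real (w \<omega>) * iexp s + (of_real (w \<omega>) * iexp (s + ?t)
        + of_real (w \<omega>) * iexp (s + (-c) * Z k \<omega>)) / 2"
     "complex_of_real (w \<omega> * (1 + sin ?t)) * iexp s =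
      of_real (w \<omega>) * iexp s + (of_real (w \<omega>) * iexp (s + ?t)
        - of_real (w \<omega>) * iexp (s + (-c) * Z k \<omega>)) / (2 * \<i>)"
      unfolding 1
      unfolding of_real_mult[of "w \<omega>"] of_real_add of_real_1 2
      by (simp_all only: distrib_left distrib_right right_diff_distrib left_diff_distrib
        add_divide_distrib diff_divide_distrib times_divide_eq_left times_divide_eq_right mult_1_right mult.assoc)
        (simp_all only: mult.commute mult.left_commute)
  qed
  (* The exponential is recovered from cosine and sine as Euler's formula prescribes; the added 1
     keeps the weights nonnegative and is removed again by subtracting e1. *)
  have e2: "(\<integral>\<omega>. (w \<omega> * (1 + cos (c * Z k \<omega>))) * ?R \<omega> \<partial>M) = (m * (1 + Re (char (\<nu> k) c))) * ?P" for c
  proof (rule step[of _ "b * 2"])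
    fix a
    let ?s = "\<lambda>\<omega>. \<Sum>i<k. a i * Z i \<omega>"
    have "(\<integral>\<omega>. complex_of_real (w \<omega> * (1 + cos (c * Z k \<omega>))) * iexp (?s \<omega>) \<partial>M)
      = (\<integral>\<omega>. of_real (w \<omega>) * iexp (?s \<omega>) \<partial>M) +
        ((\<integral>\<omega>. of_real (w \<omega>) * iexp (?s \<omega> + c * Z k \<omega>) \<partial>M)
        + (\<integral>\<omega>. of_real (w \<omega>) * iexp (?s \<omega> + (-c) * Z k \<omega>) \<partial>M)) / 2"
      unfolding trig
      by (rule integral_add_average(1); intro int; measurable)
    also have "\<dots> = of_real (m * (1 + Re (char (\<nu> k) c))) * (\<Prod>i<k. char (\<nu> i) (a i))"
    proof -
      have "(char (\<nu> k) c + cnj (char (\<nu> k) c)) / 2 = of_real (Re (char (\<nu> k) c))"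
        by (simp add: complex_add_cnj)
      then have "((of_real m * p) * char (\<nu> k) c + (of_real m * p) * cnj (char (\<nu> k) c)) / 2
          = (of_real m * p) * of_real (Re (char (\<nu> k) c))" for p
        by (simp only: distrib_left[symmetric] times_divide_eq_right[symmetric])
      note key = this
      show ?thesis
        unfolding full full0 char_neg key by (simp add: algebra_simps)
    qed
    finally show "(\<integral>\<omega>. complex_of_real (w \<omega> * (1 + cos (c * Z k \<omega>))) * iexp (?s \<omega>) \<partial>M)
      = of_real (m * (1 + Re (char (\<nu> k) c))) * (\<Prod>i<k. char (\<nu> i) (a i))" .
  next
    fix \<omega>
    have 1: "0 \<le> 1 + cos (c * Z k \<omega>)" "1 + cos (c * Z k \<omega>) \<le> 2"
      using cos_ge_minus_one[of "c * Z k \<omega>"] cos_le_one[of "c * Z k \<omega>"] by linarith+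
    show "0 \<le> w \<omega> * (1 + cos (c * Z k \<omega>))"
      by (rule mult_nonneg_nonneg[OF Suc.prems(5) 1(1)])
    show "w \<omega> * (1 + cos (c * Z k \<omega>)) \<le> b * 2"
      by (rule mult_mono[OF Suc.prems(6) 1(2) b0 1(1)])
  next
    show "(\<lambda>\<omega>. w \<omega> * (1 + cos (c * Z k \<omega>))) \<in> borel_measurable M"
      using Zk by measurable
  qed
  have e3: "(\<integral>\<omega>. (w \<omega> * (1 + sin (c * Z k \<omega>))) * ?R \<omega> \<partial>M) = (m * (1 + Im (char (\<nu> k) c))) * ?P" for c
  proof (rule step[of _ "b * 2"])
    fix a
    let ?s = "\<lambda>\<omega>. \<Sum>i<k. a i * Z i \<omega>"
    have "(\<integral>\<omega>. complex_of_real (w \<omega> * (1 + sin (c * Z k \<omega>))) * iexp (?s \<omega>) \<partial>M)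
      = (\<integral>\<omega>. of_real (w \<omega>) * iexp (?s \<omega>) \<partial>M) +
        ((\<integral>\<omega>. of_real (w \<omega>) * iexp (?s \<omega> + c * Z k \<omega>) \<partial>M)
        - (\<integral>\<omega>. of_real (w \<omega>) * iexp (?s \<omega> + (-c) * Z k \<omega>) \<partial>M)) / (2 * \<i>)"
      unfolding trig
      by (rule integral_add_average(2); intro int; measurable)
    also have "\<dots> = of_real (m * (1 + Im (char (\<nu> k) c))) * (\<Prod>i<k. char (\<nu> i) (a i))"
    proof -
      have "(char (\<nu> k) c - cnj (char (\<nu> k) c)) / (2 * \<i>) = of_real (Im (char (\<nu> k) c))"
        by (simp add: complex_diff_cnj complex_eq_iff)
      then have "((of_real m * p) * char (\<nu> k) c - (of_real m * p) * cnj (char (\<nu> k) c)) / (2 * \<i>)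
          = (of_real m * p) * of_real (Im (char (\<nu> k) c))" for p
        by (simp only: right_diff_distrib[symmetric] times_divide_eq_right[symmetric])
      note key = this
      show ?thesis
        unfolding full full0 char_neg key by (simp add: algebra_simps)
    qed
    finally show "(\<integral>\<omega>. complex_of_real (w \<omega> * (1 + sin (c * Z k \<omega>))) * iexp (?s \<omega>) \<partial>M)
      = of_real (m * (1 + Im (char (\<nu> k) c))) * (\<Prod>i<k. char (\<nu> i) (a i))" .
  next
    fix \<omega>
    have 1: "0 \<le> 1 + sin (c * Z k \<omega>)" "1 + sin (c * Z k \<omega>) \<le> 2"
      using sin_ge_minus_one[of "c * Z k \<omega>"] sin_le_one[of "c * Z k \<omega>"] by linarith+
    show "0 \<le> w \<omega> * (1 + sin (c * Z k \<omega>))"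
      by (rule mult_nonneg_nonneg[OF Suc.prems(5) 1(1)])
    show "w \<omega> * (1 + sin (c * Z k \<omega>)) \<le> b * 2"
      by (rule mult_mono[OF Suc.prems(6) 1(2) b0 1(1)])
  next
    show "(\<lambda>\<omega>. w \<omega> * (1 + sin (c * Z k \<omega>))) \<in> borel_measurable M"
      using Zk by measurable
  qed
  have wR: "0 \<le> w \<omega> * ?R \<omega>" "w \<omega> * ?R \<omega> \<le> b" for \<omega>
    using mult_mono[of "w \<omega>" b "?R \<omega>" 1] R01[of \<omega>] Suc.prems(5,6) b0 by auto
  have wRm: "(\<lambda>\<omega>. w \<omega> * ?R \<omega>) \<in> borel_measurable M"
    using Suc.prems(4) R_meas by (rule borel_measurable_times)
  have intR: "integrable M (\<lambda>\<omega>. w \<omega> * ?R \<omega> * g \<omega>)"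
    if g: "g \<in> borel_measurable M" "\<And>\<omega>. \<bar>g \<omega>\<bar> \<le> 1" for g
  proof (rule integrable_const_bound[where B="b * 1"])
    have "\<bar>w \<omega> * ?R \<omega> * g \<omega>\<bar> \<le> b * 1" for \<omega>
      unfolding abs_mult[of _ "g \<omega>"] abs_of_nonneg[OF wR(1)]
      by (rule mult_mono[OF wR(2) g(2) b0]) simp
    then show "AE \<omega> in M. norm (w \<omega> * ?R \<omega> * g \<omega>) \<le> b * 1"
      by simp
    show "(\<lambda>\<omega>. w \<omega> * ?R \<omega> * g \<omega>) \<in> borel_measurable M"
      using wRm g(1) by (rule borel_measurable_times)
  qed
  have "(\<integral>\<omega>. (w \<omega> * ?R \<omega>) * indicator (A k) (Z k \<omega>) \<partial>M) = (m * ?P) * measure (\<nu> k) (A k)"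
  proof (rule weighted_law_from_char[where b=b])
    fix c
    have c: "(\<integral>\<omega>. w \<omega> * ?R \<omega> * cos (c * Z k \<omega>) \<partial>M) = m * Re (char (\<nu> k) c) * ?P"
    proof -
      have "(\<integral>\<omega>. (w \<omega> * (1 + cos (c * Z k \<omega>))) * ?R \<omega> \<partial>M)
        = (\<integral>\<omega>. w \<omega> * ?R \<omega> * 1 + w \<omega> * ?R \<omega> * cos (c * Z k \<omega>) \<partial>M)"
        by (simp add: algebra_simps)
      also have "\<dots> = (\<integral>\<omega>. w \<omega> * ?R \<omega> * 1 \<partial>M) + (\<integral>\<omega>. w \<omega> * ?R \<omega> * cos (c * Z k \<omega>) \<partial>M)"
        by (intro Bochner_Integration.integral_add intR) auto
      finally show ?thesis using e1 e2[of c] by (simp add: algebra_simps)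
    qed
    have s: "(\<integral>\<omega>. w \<omega> * ?R \<omega> * sin (c * Z k \<omega>) \<partial>M) = m * Im (char (\<nu> k) c) * ?P"
    proof -
      have "(\<integral>\<omega>. (w \<omega> * (1 + sin (c * Z k \<omega>))) * ?R \<omega> \<partial>M)
        = (\<integral>\<omega>. w \<omega> * ?R \<omega> * 1 + w \<omega> * ?R \<omega> * sin (c * Z k \<omega>) \<partial>M)"
        by (simp add: algebra_simps)
      also have "\<dots> = (\<integral>\<omega>. w \<omega> * ?R \<omega> * 1 \<partial>M) + (\<integral>\<omega>. w \<omega> * ?R \<omega> * sin (c * Z k \<omega>) \<partial>M)"
        by (intro Bochner_Integration.integral_add intR) auto
      finally show ?thesis using e1 e3[of c] by (simp add: algebra_simps)
    qed
    have i: "integrable M (\<lambda>\<omega>. complex_of_real (w \<omega> * ?R \<omega>) * iexp (c * Z k \<omega>))"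
      by (rule integrable_const_bound[where B=b]) (use wR in \<open>auto simp: norm_mult simp del: of_real_mult\<close>)
    have ri: "Re (iexp t) = cos t" "Im (iexp t) = sin t"
      "Re (complex_of_real r * z) = r * Re z" "Im (complex_of_real r * z) = r * Im z" for r t z
      by (simp_all add: Re_exp Im_exp)
    show "(\<integral>\<omega>. complex_of_real (w \<omega> * ?R \<omega>) * iexp (c * Z k \<omega>) \<partial>M) = of_real (m * ?P) * char (\<nu> k) c"
    proof (rule complex_eqI)
      show "Re (\<integral>\<omega>. complex_of_real (w \<omega> * ?R \<omega>) * iexp (c * Z k \<omega>) \<partial>M) = Re (of_real (m * ?P) * char (\<nu> k) c)"
        unfolding integral_Re[OF i, symmetric] ri using c by (simp only: mult_ac)
      show "Im (\<integral>\<omega>. complex_of_real (w \<omega> * ?R \<omega>) * iexp (c * Z k \<omega>) \<partial>M) = Im (of_real (m * ?P) * char (\<nu> k) c)"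
        unfolding integral_Im[OF i, symmetric] ri using s by (simp only: mult_ac)
    qed
  qed (use wR \<nu>k.real_distribution_axioms Suc.prems in auto)
  then show ?case by (simp add: algebra_simps)
qed

text \<open>
  This is Kac's theorem: variables are independent once their joint characteristic function
  factorises. The argument is one-dimensional throughout, through the induction above.
\<close>

lemma (in prob_space) product_law_from_char:
  fixes Z :: "nat \<Rightarrow> 'a \<Rightarrow> real"
  assumes Z[measurable]: "\<And>i. i < k \<Longrightarrow> Z i \<in> borel_measurable M"
    and \<nu>: "\<And>i. real_distribution (\<nu> i)"
    and ch: "\<And>a. (\<integral>\<omega>. iexp (\<Sum>i<k. a i * Z i \<omega>) \<partial>M) = (\<Prod>i<k. char (\<nu> i) (a i))"
  shows "distr M (PiM {..<k} (\<lambda>_. borel)) (\<lambda>\<omega>. \<lambda>i\<in>{..<k}. Z i \<omega>) = PiM {..<k} \<nu>"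
proof -
  interpret \<nu>: real_distribution "\<nu> i" for i by (rule \<nu>)
  interpret product_sigma_finite \<nu> ..
  have Zm: "(\<lambda>\<omega>. \<lambda>i\<in>{..<k}. Z i \<omega>) \<in> measurable M (PiM {..<k} (\<lambda>_. borel))"
    by (rule measurable_restrict) (use Z in auto)
  show ?thesis
  proof (rule PiM_eqI)
    show "sets (distr M (PiM {..<k} (\<lambda>_. borel)) (\<lambda>\<omega>. \<lambda>i\<in>{..<k}. Z i \<omega>)) = sets (PiM {..<k} \<nu>)"
      by (simp cong: sets_PiM_cong)
    fix A assume A: "\<And>i. i \<in> {..<k} \<Longrightarrow> A i \<in> sets (\<nu> i)"
    have "(\<integral>\<omega>. 1 * (\<Prod>i<k. indicator (A i) (Z i \<omega>)) \<partial>M) = 1 * (\<Prod>i<k. measure (\<nu> i) (A i))"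
      by (rule weighted_rectangle_from_char[where b=1]) (use A Z ch \<nu> in auto)
    then have *: "(\<integral>\<omega>. (\<Prod>i<k. indicator (A i) (Z i \<omega>)) \<partial>M) = (\<Prod>i<k. measure (\<nu> i) (A i))"
      by simp
    let ?S = "(\<lambda>\<omega>. \<lambda>i\<in>{..<k}. Z i \<omega>) -` (Pi\<^sub>E {..<k} A) \<inter> space M"
    have PA: "Pi\<^sub>E {..<k} A \<in> sets (PiM {..<k} (\<lambda>_. borel))"
      by (rule sets_PiM_I_finite) (use A in auto)
    then have S: "?S \<in> sets M" by (rule measurable_sets[OF Zm])
    have ind: "(\<Prod>i<k. indicator (A i) (Z i \<omega>)) = (indicator ?S \<omega> :: real)" if "\<omega> \<in> space M" for \<omega>
    proof (cases "\<forall>i<k. Z i \<omega> \<in> A i")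
      case True
      then show ?thesis using that by (auto simp: indicator_def PiE_iff)
    next
      case False
      then obtain i where "i < k" "Z i \<omega> \<notin> A i" by auto
      then show ?thesis using that
        by (subst prod_zero) (auto simp: indicator_def PiE_iff intro!: bexI[of _ i])
    qed
    have "measure M ?S = (\<integral>\<omega>. indicator ?S \<omega> \<partial>M)"
      using S by simp
    also have "\<dots> = (\<integral>\<omega>. (\<Prod>i<k. indicator (A i) (Z i \<omega>)) \<partial>M)"
      by (intro Bochner_Integration.integral_cong refl) (simp only: ind)
    finally have "measure M ?S = (\<Prod>i<k. measure (\<nu> i) (A i))" using * by simp
    then have "emeasure M ?S = (\<Prod>i<k. emeasure (\<nu> i) (A i))"
      by (simp add: emeasure_eq_measure \<nu>.emeasure_eq_measure prod_ennreal)
    then show "emeasure (distr M (PiM {..<k} (\<lambda>_. borel)) (\<lambda>\<omega>. \<lambda>i\<in>{..<k}. Z i \<omega>)) (Pi\<^sub>E {..<k} A)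
        = (\<Prod>i<k. emeasure (\<nu> i) (A i))"
      by (subst emeasure_distr[OF Zm PA])
  qed simp
qed

section \<open>Spaces of centred Gaussian variables\<close>

text \<open>
  The parameter is the variance. Variance \<open>0\<close> has to be included, since residuals of linear
  regression may vanish.
\<close>

definition centred_normal :: "real \<Rightarrow> real measure" where
  "centred_normal v =
     (if v = 0 then return borel 0 else density lborel (normal_density 0 (sqrt v)))"

lemma sets_centred_normal[measurable_cong, simp]: "sets (centred_normal v) = sets borel"
  by (simp add: centred_normal_def)

lemma real_distribution_centred_normal: "0 \<le> v \<Longrightarrow> real_distribution (centred_normal v)"
  unfolding real_distribution_def real_distribution_axioms_def centred_normal_def
  by (auto intro!: prob_space_return prob_space_normal_density)

lemma normal_law_scaling:
  assumes "s > 0"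
  shows "distr std_normal_distribution borel (\<lambda>x. \<mu> + s * x) = density lborel (normal_density \<mu> s)"
proof -
  interpret real_distribution std_normal_distribution by (rule real_dist_normal_dist)
  have "distributed std_normal_distribution lborel (\<lambda>x. x) std_normal_density"
    unfolding distributed_def by (auto simp: distr_id2)
  from normal_density_affine[OF this, of s \<mu>] assms
  have "distr std_normal_distribution lborel (\<lambda>x. \<mu> + s * x) = density lborel (normal_density \<mu> s)"
    unfolding distributed_def by simp
  then show ?thesis by (simp cong: distr_cong)
qed

lemma char_centred_normal:
  assumes "0 \<le> v"
  shows "char (centred_normal v) a = of_real (exp (- (a\<^sup>2 * v) / 2))"
proof (cases "v = 0")
  case True
  then show ?thesis
    unfolding char_def centred_normal_def by (simp add: integral_return)
next
  case False
  then have v: "v > 0" using assms by simp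
  have "char (centred_normal v) a = char (distr std_normal_distribution borel (\<lambda>x. 0 + sqrt v * x)) a"
    using v unfolding centred_normal_def by (subst normal_law_scaling) auto
  also have "\<dots> = (\<integral>x. iexp (a * (sqrt v * x)) \<partial>std_normal_distribution)"
    unfolding char_def by (subst integral_distr) auto
  also have "\<dots> = char std_normal_distribution (a * sqrt v)"
    unfolding char_def by (simp add: mult.assoc)
  also have "\<dots> = of_real (exp (- ((a * sqrt v)\<^sup>2) / 2))"
    by (simp add: char_std_normal_distribution)
  finally show ?thesis using v by (simp add: power_mult_distrib)
qed

lemma normal_moments:
  assumes "s > 0"
  shows "integrable (density lborel (normal_density \<mu> s)) (\<lambda>x. x)"
    "(\<integral>x. x \<partial>density lborel (normal_density \<mu> s)) = \<mu>"
    "integrable (density lborel (normal_density 0 s)) (\<lambda>x. x\<^sup>2)"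
    "(\<integral>x. x\<^sup>2 \<partial>density lborel (normal_density 0 s)) = s\<^sup>2"
proof -
  show "integrable (density lborel (normal_density \<mu> s)) (\<lambda>x. x)"
    using integrable_normal_moment_nz_1[OF assms] by (subst integrable_density) auto
  show "(\<integral>x. x \<partial>density lborel (normal_density \<mu> s)) = \<mu>"
    using integral_normal_moment_nz_1[OF assms] by (subst integral_density) auto
  show "integrable (density lborel (normal_density 0 s)) (\<lambda>x. x\<^sup>2)"
    using integrable_normal_moment[OF assms, of 0 2] by (subst integrable_density) auto
  show "(\<integral>x. x\<^sup>2 \<partial>density lborel (normal_density 0 s)) = s\<^sup>2"
    using integral_normal_moment_even[OF assms, of 0 1] assms
    by (subst integral_density) (auto simp: fact_numeral power_divide)
qed

text \<open>
  The definition of a Gaussian variable leaves the parameters open; the first two moments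
  identify them, also in the degenerate case.
\<close>

lemma (in prob_space) centred_gaussian_rv:
  assumes "gaussian_rv M Y" "expectation Y = 0"
  shows "integrable M (\<lambda>\<omega>. (Y \<omega>)\<^sup>2)"
    and "distr M borel Y = centred_normal (expectation (\<lambda>\<omega>. (Y \<omega>)\<^sup>2))"
proof -
  have Y[measurable]: "Y \<in> borel_measurable M" using assms by (auto simp: gaussian_rv_def)
  obtain \<mu> s where "s > 0 \<and> distr M borel Y = density lborel (normal_density \<mu> s) \<or>
            distr M borel Y = return borel \<mu>"
    using assms by (auto simp: gaussian_rv_def)
  moreover have E: "expectation Y = (\<integral>x. x \<partial>distr M borel Y)"
    by (subst integral_distr) auto
  moreover have E2: "expectation (\<lambda>\<omega>. (Y \<omega>)\<^sup>2) = (\<integral>x. x\<^sup>2 \<partial>distr M borel Y)"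
    by (subst integral_distr) auto
  moreover have I2: "integrable M (\<lambda>\<omega>. (Y \<omega>)\<^sup>2) \<longleftrightarrow> integrable (distr M borel Y) (\<lambda>x. x\<^sup>2)"
    by (subst integrable_distr_eq) auto
  ultimately consider "s > 0" "distr M borel Y = density lborel (normal_density 0 s)"
    | "distr M borel Y = return borel 0"
    using assms(2) normal_moments(2)[of s \<mu>] by (auto simp: integral_return)
  then have "integrable M (\<lambda>\<omega>. (Y \<omega>)\<^sup>2) \<and>
      distr M borel Y = centred_normal (expectation (\<lambda>\<omega>. (Y \<omega>)\<^sup>2))"
  proof cases
    case 1
    then show ?thesis unfolding I2 E2 using normal_moments(3,4)[of s] by (simp add: centred_normal_def)
  next
    case 2
    have "integrable (return borel (0::real)) (\<lambda>x. x\<^sup>2)"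
      by (subst integrable_iff_bounded) (auto simp: nn_integral_return)
    then show ?thesis unfolding I2 E2 2 by (simp add: centred_normal_def integral_return)
  qed
  then show "integrable M (\<lambda>\<omega>. (Y \<omega>)\<^sup>2)"
    "distr M borel Y = centred_normal (expectation (\<lambda>\<omega>. (Y \<omega>)\<^sup>2))" by auto
qed

text \<open>
  A linear space of centred Gaussian variables: here laws are determined by covariances, and
  orthogonal elements are independent.
\<close>

locale gaussian_space = prob_space M for M :: "'a measure" +
  fixes G :: "('a \<Rightarrow> real) set"
  assumes gaussian: "Y \<in> G \<Longrightarrow> gaussian_rv M Y"
    and centred: "Y \<in> G \<Longrightarrow> expectation Y = 0"
    and zero: "(\<lambda>_. 0) \<in> G"
    and lincomb: "Y \<in> G \<Longrightarrow> Z \<in> G \<Longrightarrow> (\<lambda>\<omega>. a * Y \<omega> + b * Z \<omega>) \<in> G"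
begin

definition cov :: "('a \<Rightarrow> real) \<Rightarrow> ('a \<Rightarrow> real) \<Rightarrow> real" where
  "cov Y Z = expectation (\<lambda>\<omega>. Y \<omega> * Z \<omega>)"

lemma meas: "Y \<in> G \<Longrightarrow> Y \<in> borel_measurable M"
  using gaussian by (auto simp: gaussian_rv_def)

lemma integrable_mult:
  assumes "Y \<in> G" "Z \<in> G" shows "integrable M (\<lambda>\<omega>. Y \<omega> * Z \<omega>)"
proof (rule Bochner_Integration.integrable_bound)
  show "integrable M (\<lambda>\<omega>. (Y \<omega>)\<^sup>2 + (Z \<omega>)\<^sup>2)"
    using assms by (intro Bochner_Integration.integrable_add centred_gaussian_rv(1) gaussian centred)
  have "\<bar>y * z\<bar> \<le> y\<^sup>2 + z\<^sup>2" for y z :: real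
  proof -
    have "2 * \<bar>y\<bar> * \<bar>z\<bar> \<le> \<bar>y\<bar>\<^sup>2 + \<bar>z\<bar>\<^sup>2" by (rule sum_squares_bound)
    moreover have "0 \<le> \<bar>y\<bar> * \<bar>z\<bar>" by (intro mult_nonneg_nonneg) auto
    ultimately show ?thesis unfolding abs_mult power2_abs by linarith
  qed
  then show "AE \<omega> in M. norm (Y \<omega> * Z \<omega>) \<le> norm ((Y \<omega>)\<^sup>2 + (Z \<omega>)\<^sup>2)"
    by (auto intro!: AE_I2)
qed (use assms[THEN meas] in measurable)

lemma cov_sym: "cov Y Z = cov Z Y"
  by (simp add: cov_def mult.commute)

lemma cov_lincomb:
  assumes "Y \<in> G" "Z \<in> G" "W \<in> G"
  shows "cov (\<lambda>\<omega>. a * Y \<omega> + b * Z \<omega>) W = a * cov Y W + b * cov Z W"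
proof -
  have "cov (\<lambda>\<omega>. a * Y \<omega> + b * Z \<omega>) W = expectation (\<lambda>\<omega>. a * (Y \<omega> * W \<omega>) + b * (Z \<omega> * W \<omega>))"
    unfolding cov_def by (simp add: algebra_simps)
  also have "\<dots> = a * cov Y W + b * cov Z W"
    unfolding cov_def using assms integrable_mult by (subst Bochner_Integration.integral_add) auto
  finally show ?thesis .
qed

lemma cov_zero[simp]: "cov (\<lambda>_. 0) Z = 0" "cov Z (\<lambda>_. 0) = 0"
  by (simp_all add: cov_def)

lemma cov_nonneg: "0 \<le> cov Y Y"
  unfolding cov_def by (intro Bochner_Integration.integral_nonneg) auto

lemma law: "Y \<in> G \<Longrightarrow> distr M borel Y = centred_normal (cov Y Y)"
  using centred_gaussian_rv(2)[OF gaussian centred] by (simp add: cov_def power2_eq_square)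

lemma char_law:
  assumes "Y \<in> G"
  shows "(\<integral>\<omega>. iexp (Y \<omega>) \<partial>M) = of_real (exp (- cov Y Y / 2))"
proof -
  have [measurable]: "Y \<in> borel_measurable M" using assms by (rule meas)
  have "(\<integral>\<omega>. iexp (Y \<omega>) \<partial>M) = char (distr M borel Y) 1"
    unfolding char_def by (subst integral_distr) auto
  then show ?thesis using assms by (simp add: law char_centred_normal cov_nonneg)
qed

lemma scale_add: "Y \<in> G \<Longrightarrow> Z \<in> G \<Longrightarrow> (\<lambda>\<omega>. Y \<omega> + b * Z \<omega>) \<in> G"
  using lincomb[of Y Z 1 b] by simp

lemma sum_in: "(\<And>i. i < k \<Longrightarrow> e i \<in> G) \<Longrightarrow> (\<lambda>\<omega>. \<Sum>i<(k::nat). a i * e i \<omega>) \<in> G"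
  by (induction k) (auto simp: zero intro!: scale_add)

lemma cov_sum:
  assumes "\<And>i. i < k \<Longrightarrow> e i \<in> G" "W \<in> G"
  shows "cov (\<lambda>\<omega>. \<Sum>i<(k::nat). a i * e i \<omega>) W = (\<Sum>i<k. a i * cov (e i) W)"
  using assms(1)
proof (induction k)
  case (Suc k)
  then show ?case using cov_lincomb[OF sum_in[of k e a] _ assms(2), of "e k" 1 "a k"] by simp
qed simp

text \<open>
  By linearity a combination of the \<open>e i\<close> is again Gaussian, and its variance is
  \<open>\<Sum>i<k. (a i)\<^sup>2 * cov (e i) (e i)\<close> by orthogonality. The joint characteristic function is therefore the
  product of those of the single variables.
\<close>

lemma orthogonal_law:
  fixes e :: "nat \<Rightarrow> 'a \<Rightarrow> real"
  assumes e: "\<And>i. i < k \<Longrightarrow> e i \<in> G"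
    and orth: "\<And>i j. i < j \<Longrightarrow> j < k \<Longrightarrow> cov (e i) (e j) = 0"
  shows "distr M (PiM {..<k} (\<lambda>_. borel)) (\<lambda>\<omega>. \<lambda>i\<in>{..<k}. e i \<omega>)
    = PiM {..<k} (\<lambda>i. centred_normal (cov (e i) (e i)))"
proof (rule product_law_from_char)
  fix a :: "nat \<Rightarrow> real"
  let ?S = "\<lambda>\<omega>. \<Sum>i<k. a i * e i \<omega>"
  have S: "?S \<in> G" using e by (rule sum_in)
  have orth': "cov (e i) (e j) = 0" if "i \<noteq> j" "i < k" "j < k" for i j
    using orth[of i j] orth[of j i] that cov_sym[of "e i" "e j"] by (auto simp: neq_iff)
  have "cov ?S ?S = (\<Sum>i<k. a i * cov (e i) ?S)" using e S by (rule cov_sum)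
  also have "\<dots> = (\<Sum>i<k. a i * (\<Sum>j<k. a j * cov (e j) (e i)))"
  proof (rule sum.cong[OF refl])
    fix i assume "i \<in> {..<k}"
    then have "cov ?S (e i) = (\<Sum>j<k. a j * cov (e j) (e i))"
      by (intro cov_sum e) simp_all
    then show "a i * cov (e i) ?S = a i * (\<Sum>j<k. a j * cov (e j) (e i))"
      by (simp only: cov_sym[of "e i"])
  qed
  also have "\<dots> = (\<Sum>i<k. (a i)\<^sup>2 * cov (e i) (e i))"
  proof (intro sum.cong refl)
    fix i assume i: "i \<in> {..<k}"
    have "(\<Sum>j<k. a j * cov (e j) (e i)) = (\<Sum>j<k. if i = j then a i * cov (e i) (e i) else 0)"
      using i orth' by (intro sum.cong) auto
    then show "a i * (\<Sum>j<k. a j * cov (e j) (e i)) = (a i)\<^sup>2 * cov (e i) (e i)"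
      using i by (simp add: power2_eq_square)
  qed
  finally have cS: "cov ?S ?S = (\<Sum>i<k. (a i)\<^sup>2 * cov (e i) (e i))" .
  show "(\<integral>\<omega>. iexp (\<Sum>i<k. a i * e i \<omega>) \<partial>M) = (\<Prod>i<k. char (centred_normal (cov (e i) (e i))) (a i))"
  proof -
    have "exp (- cov ?S ?S / 2) = (\<Prod>i<k. exp (- ((a i)\<^sup>2 * cov (e i) (e i)) / 2))"
      unfolding cS by (simp only: sum_negf[symmetric] sum_divide_distrib exp_sum finite_lessThan)
    then show ?thesis
      unfolding char_law[OF S] by (simp only: of_real_prod char_centred_normal[OF cov_nonneg])
  qed
qed (intro real_distribution_centred_normal cov_nonneg meas e; assumption)+

lemma measurable_curried4:
  fixes \<Phi> :: "real \<Rightarrow> real \<Rightarrow> real \<Rightarrow> real \<Rightarrow> ennreal"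
  assumes "(\<lambda>(a, b, c, d). \<Phi> a b c d) \<in> borel_measurable (borel \<Otimes>\<^sub>M borel \<Otimes>\<^sub>M borel \<Otimes>\<^sub>M borel)"
    and [measurable]: "f1 \<in> borel_measurable N" "f2 \<in> borel_measurable N" "f3 \<in> borel_measurable N" "f4 \<in> borel_measurable N"
  shows "(\<lambda>x. \<Phi> (f1 x) (f2 x) (f3 x) (f4 x)) \<in> borel_measurable N"
proof -
  have "(\<lambda>x. (f1 x, f2 x, f3 x, f4 x)) \<in> measurable N (borel \<Otimes>\<^sub>M borel \<Otimes>\<^sub>M borel \<Otimes>\<^sub>M borel)"
    by measurable
  from measurable_compose[OF this assms(1)] show ?thesis by simp
qed

text \<open>
  Four variables suffice for everything below: two values of the process and two increments.
  Statements about fewer variables follow by padding with the zero variable.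
\<close>

lemma orthogonal_nn_integral:
  fixes \<Phi> :: "real \<Rightarrow> real \<Rightarrow> real \<Rightarrow> real \<Rightarrow> ennreal"
  assumes [measurable]: "(\<lambda>(a, b, c, d). \<Phi> a b c d) \<in> borel_measurable (borel \<Otimes>\<^sub>M borel \<Otimes>\<^sub>M borel \<Otimes>\<^sub>M borel)"
    and G: "e0 \<in> G" "e1 \<in> G" "e2 \<in> G" "e3 \<in> G"
    and orth: "cov e0 e1 = 0" "cov e0 e2 = 0" "cov e0 e3 = 0" "cov e1 e2 = 0" "cov e1 e3 = 0" "cov e2 e3 = 0"
  shows "(\<integral>\<^sup>+\<omega>. \<Phi> (e0 \<omega>) (e1 \<omega>) (e2 \<omega>) (e3 \<omega>) \<partial>M) =
    (\<integral>\<^sup>+a. \<integral>\<^sup>+b. \<integral>\<^sup>+c. \<integral>\<^sup>+d. \<Phi> a b c d \<partial>centred_normal (cov e3 e3) \<partial>centred_normal (cov e2 e2)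
       \<partial>centred_normal (cov e1 e1) \<partial>centred_normal (cov e0 e0))"
proof -
  define e where "e i = (if i = 0 then e0 else if i = 1 then e1 else if i = 2 then e2 else e3)" for i :: nat
  let ?N = "\<lambda>i. centred_normal (cov (e i) (e i))"
  interpret N: real_distribution "?N i" for i by (intro real_distribution_centred_normal cov_nonneg)
  interpret product_sigma_finite ?N ..
  have eG: "e i \<in> G" for i using G by (auto simp: e_def)
  have [measurable]: "e i \<in> borel_measurable M" for i using eG by (rule meas)
  have o: "cov (e i) (e j) = 0" if "i < j" "j < 4" for i j
  proof -
    have "j = 1 \<or> j = 2 \<or> j = 3" "i = 0 \<or> i = 1 \<or> i = 2" using that by auto
    then show ?thesis using that orth unfolding e_def by (elim disjE) simp_all
  qed
  have l: "distr M (PiM {..<4} (\<lambda>_. borel)) (\<lambda>\<omega>. \<lambda>i\<in>{..<4}. e i \<omega>) = PiM {..<4} ?N"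
    by (rule orthogonal_law; (rule eG | (rule o; assumption)))
  have eq4: "{..<4::nat} = insert 0 (insert 1 (insert 2 (insert 3 {})))" by auto
  have [measurable]: "(\<lambda>x. x i) \<in> borel_measurable (PiM J ?N)" if "i \<in> J" for i :: nat and J
    using measurable_component_singleton[OF that, of ?N]
    by (simp only: measurable_cong_sets[OF refl sets_centred_normal])
  note m = measurable_curried4[OF assms(1)]
  have mm: "(\<lambda>x. \<Phi> (x 0) (x 1) (x 2) (x 3)) \<in> borel_measurable (PiM {0::nat,1,2,3} ?N)"
    "(\<lambda>x. \<Phi> (x 0) (x (Suc 0)) (x 2) (x 3)) \<in> borel_measurable (PiM {0,Suc 0,2,3} ?N)"
    "(\<lambda>x. \<Phi> a (x 1) (x 2) (x 3)) \<in> borel_measurable (PiM {1,2,3} ?N)"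
    "(\<lambda>x. \<Phi> a (x (Suc 0)) (x 2) (x 3)) \<in> borel_measurable (PiM {Suc 0,2,3} ?N)"
    "(\<lambda>x. \<Phi> a b (x 2) (x 3)) \<in> borel_measurable (PiM {2,3} ?N)"
    "(\<lambda>x. \<Phi> a b c (x 3)) \<in> borel_measurable (PiM {3} ?N)"
    for a b c
    by ((rule m; measurable)+)
  have m3: "\<Phi> a b c \<in> borel_measurable (?N 3)" for a b c
    using m[of "\<lambda>_. a" "?N 3" "\<lambda>_. b" "\<lambda>_. c" "\<lambda>x. x"] by simp
  have mb: "(\<lambda>x. \<Phi> (x 0) (x 1) (x 2) (x 3)) \<in> borel_measurable (PiM {0::nat,1,2,3} (\<lambda>_. borel))"
    by (rule m; rule measurable_component_singleton; simp)
  have em: "(\<lambda>\<omega>. \<lambda>i\<in>{..<4}. e i \<omega>) \<in> measurable M (PiM {..<4} (\<lambda>_. borel))"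
    by (rule measurable_restrict) simp
  have "(\<integral>\<^sup>+\<omega>. \<Phi> (e0 \<omega>) (e1 \<omega>) (e2 \<omega>) (e3 \<omega>) \<partial>M)
     = (\<integral>\<^sup>+x. \<Phi> (x 0) (x 1) (x 2) (x 3) \<partial>distr M (PiM {..<4} (\<lambda>_. borel)) (\<lambda>\<omega>. \<lambda>i\<in>{..<4}. e i \<omega>))"
    using mb[folded eq4] by (subst nn_integral_distr[OF em]) (simp_all add: e_def)
  also have "\<dots> = (\<integral>\<^sup>+x. \<Phi> (x 0) (x 1) (x 2) (x 3) \<partial>PiM (insert 0 (insert 1 (insert 2 (insert 3 {})))) ?N)"
    unfolding l by (simp only: eq4)
  also have "\<dots> = (\<integral>\<^sup>+a. \<integral>\<^sup>+b. \<integral>\<^sup>+c. \<integral>\<^sup>+d. \<Phi> a b c d \<partial>?N 3 \<partial>?N 2 \<partial>?N 1 \<partial>?N 0)"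
  proof -
    have 3: "(\<integral>\<^sup>+x. \<Phi> a b c (x 3) \<partial>PiM {3} ?N) = (\<integral>\<^sup>+d. \<Phi> a b c d \<partial>?N 3)" for a b c
      by (subst product_nn_integral_singleton) (simp_all add: mm m3)
    have 2: "(\<integral>\<^sup>+x. \<Phi> a b (x 2) (x 3) \<partial>PiM {2,3} ?N) = (\<integral>\<^sup>+c. \<integral>\<^sup>+x. \<Phi> a b c (x 3) \<partial>PiM {3} ?N \<partial>?N 2)" for a b
      by (subst product_nn_integral_insert_rev) (simp_all add: mm m3)
    have 1: "(\<integral>\<^sup>+x. \<Phi> a (x 1) (x 2) (x 3) \<partial>PiM {1,2,3} ?N)
        = (\<integral>\<^sup>+b. \<integral>\<^sup>+x. \<Phi> a b (x 2) (x 3) \<partial>PiM {2,3} ?N \<partial>?N 1)" for a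
      by (subst product_nn_integral_insert_rev) (simp_all add: mm m3)
    have 0: "(\<integral>\<^sup>+x. \<Phi> (x 0) (x 1) (x 2) (x 3) \<partial>PiM {0,1,2,3} ?N)
        = (\<integral>\<^sup>+a. \<integral>\<^sup>+x. \<Phi> a (x 1) (x 2) (x 3) \<partial>PiM {1,2,3} ?N \<partial>?N 0)"
      by (subst product_nn_integral_insert_rev) (simp_all add: mm m3)
    show ?thesis unfolding 0 1 2 3 ..
  qed
  finally show ?thesis by (simp add: e_def)
qed

end

section \<open>Gaussian moment bounds\<close>

text \<open>Complete the square in the exponent.\<close>

lemma normal_density_exp_le:
  assumes "v > 0"
  shows "normal_density 0 (sqrt v) z * exp (c * z) \<le> exp (c\<^sup>2 * v / 2) / sqrt (2 * pi * v)"
proof -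
  have "0 \<le> (z - c * v)\<^sup>2 / (2 * v)" using assms by simp
  then have "- z\<^sup>2 / (2 * v) + c * z \<le> c\<^sup>2 * v / 2"
    using assms by (simp add: power2_eq_square field_simps)
  then have "exp (- z\<^sup>2 / (2 * v)) * exp (c * z) \<le> exp (c\<^sup>2 * v / 2)"
    by (simp add: exp_add[symmetric])
  then show ?thesis using assms
    unfolding normal_density_def by (simp add: divide_simps)
qed

lemma nn_integral_centred_normal:
  assumes "v > 0" "g \<in> borel_measurable borel"
  shows "(\<integral>\<^sup>+z. g z \<partial>centred_normal v) = (\<integral>\<^sup>+z. ennreal (normal_density 0 (sqrt v) z) * g z \<partial>lborel)"
  using assms unfolding centred_normal_def by (simp add: nn_integral_density)

lemma nn_integral_exp_mult_centred_normal:
  assumes "v \<ge> 0"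
  shows "(\<integral>\<^sup>+z. ennreal (exp (c * z)) \<partial>centred_normal v) = ennreal (exp (c\<^sup>2 * v / 2))"
proof (cases "v = 0")
  case True
  then show ?thesis by (simp add: centred_normal_def nn_integral_return)
next
  case False
  then have v: "v > 0" using assms by simp
  have eq: "normal_density 0 (sqrt v) z * exp (c * z) = exp (c\<^sup>2 * v / 2) * normal_density (c * v) (sqrt v) z" for z
  proof -
    have "- (z\<^sup>2 / (2 * v)) + c * z = c\<^sup>2 * v / 2 + - ((z - c * v)\<^sup>2 / (2 * v))"
      using v by (simp add: power2_eq_square field_simps)
    then show ?thesis
      using v unfolding normal_density_def by (simp add: exp_add[symmetric])
  qed
  have "(\<integral>\<^sup>+z. ennreal (exp (c * z)) \<partial>centred_normal v)
      = (\<integral>\<^sup>+z. ennreal (exp (c\<^sup>2 * v / 2)) * ennreal (normal_density (c * v) (sqrt v) z) \<partial>lborel)"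
    using v by (subst nn_integral_centred_normal)
      (auto intro!: nn_integral_cong simp: ennreal_mult[symmetric] eq)
  also have "\<dots> = ennreal (exp (c\<^sup>2 * v / 2)) * (\<integral>\<^sup>+z. ennreal (normal_density (c * v) (sqrt v) z) \<partial>lborel)"
    by (rule nn_integral_cmult) simp
  also have "(\<integral>\<^sup>+z. ennreal (normal_density (c * v) (sqrt v) z) \<partial>lborel) = 1"
    using v by (subst nn_integral_eq_integral) auto
  finally show ?thesis by simp
qed

lemma nn_integral_exp_centred_normal:
  "v \<ge> 0 \<Longrightarrow> (\<integral>\<^sup>+z. ennreal (exp z) \<partial>centred_normal v) = ennreal (exp (v / 2))"
  using nn_integral_exp_mult_centred_normal[of v 1] by simp

lemma nn_integral_translate:
  fixes f :: "real \<Rightarrow> ennreal"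
  assumes "f \<in> borel_measurable borel"
  shows "(\<integral>\<^sup>+y. f (y + a) \<partial>lborel) = (\<integral>\<^sup>+y. f y \<partial>lborel)"
  using nn_integral_real_affine[OF assms, of 1 a] by (simp add: add.commute)

lemma nn_integral_centred_normal_exp_le:
  assumes v: "v > 0" and h[measurable]: "h \<in> borel_measurable borel"
  shows "(\<integral>\<^sup>+z. h (z + a) * ennreal (exp (c * z)) \<partial>centred_normal v)
    \<le> ennreal (exp (c\<^sup>2 * v / 2) / sqrt (2 * pi * v)) * (\<integral>\<^sup>+z. h z \<partial>lborel)"
proof -
  let ?K = "exp (c\<^sup>2 * v / 2) / sqrt (2 * pi * v)"
  have "(\<integral>\<^sup>+z. h (z + a) * ennreal (exp (c * z)) \<partial>centred_normal v)
    = (\<integral>\<^sup>+z. h (z + a) * ennreal (normal_density 0 (sqrt v) z * exp (c * z)) \<partial>lborel)"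
    using v by (subst nn_integral_centred_normal) (auto intro!: nn_integral_cong simp: ennreal_mult mult_ac)
  also have "\<dots> \<le> (\<integral>\<^sup>+z. h (z + a) * ennreal ?K \<partial>lborel)"
    by (intro nn_integral_mono mult_left_mono ennreal_leI normal_density_exp_le[OF v]) simp
  also have "\<dots> = (\<integral>\<^sup>+z. h (z + a) \<partial>lborel) * ennreal ?K"
    by (rule nn_integral_multc) simp
  also have "(\<integral>\<^sup>+z. h (z + a) \<partial>lborel) = (\<integral>\<^sup>+z. h z \<partial>lborel)"
    by (rule nn_integral_translate) simp
  finally show ?thesis by (simp add: mult.commute)
qed

context gaussian_space
begin

text \<open>
  The residual of \<open>Y\<close> after linear regression on \<open>e\<close>, one step of the Gram-Schmidt
  procedure.
\<close>

definition regress :: "('a \<Rightarrow> real) \<Rightarrow> ('a \<Rightarrow> real) \<Rightarrow> 'a \<Rightarrow> real" where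
  "regress Y e = (\<lambda>\<omega>. 1 * Y \<omega> + (- (cov Y e / cov e e)) * e \<omega>)"

lemma regress_in: "Y \<in> G \<Longrightarrow> e \<in> G \<Longrightarrow> regress Y e \<in> G"
  unfolding regress_def by (rule lincomb)

lemma regress_eq: "Y \<omega> = regress Y e \<omega> + cov Y e / cov e e * e \<omega>"
  unfolding regress_def by simp

lemma cov_regress: "Y \<in> G \<Longrightarrow> e \<in> G \<Longrightarrow> Z \<in> G \<Longrightarrow>
    cov (regress Y e) Z = cov Y Z - cov Y e / cov e e * cov e Z"
  unfolding regress_def by (subst cov_lincomb) simp_all

lemma cov_regress_orth: "Y \<in> G \<Longrightarrow> e \<in> G \<Longrightarrow> cov e e \<noteq> 0 \<Longrightarrow> cov (regress Y e) e = 0"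
  by (simp add: cov_regress)

lemma cov_regress_self: "Y \<in> G \<Longrightarrow> e \<in> G \<Longrightarrow> cov e e \<noteq> 0 \<Longrightarrow>
    cov (regress Y e) (regress Y e) = cov Y Y - (cov Y e)\<^sup>2 / cov e e"
proof -
  assume Y: "Y \<in> G" and e: "e \<in> G" and ne: "cov e e \<noteq> 0"
  have "cov (regress Y e) (regress Y e) = cov (regress Y e) Y - cov Y e / cov e e * cov (regress Y e) e"
    unfolding cov_sym[of "regress Y e" Y] cov_sym[of "regress Y e" e]
    by (rule cov_regress[OF Y e regress_in[OF Y e]])
  also have "\<dots> = cov Y Y - (cov Y e)\<^sup>2 / cov e e"
    using Y e ne by (simp add: cov_regress cov_sym[of e Y] power2_eq_square)
  finally show ?thesis .
qed

lemma exp_moment: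
  assumes D: "D \<in> G"
  shows "(\<integral>\<^sup>+\<omega>. ennreal (exp (D \<omega>)) \<partial>M) = ennreal (exp (cov D D / 2))"
proof -
  have "(\<integral>\<^sup>+\<omega>. ennreal (exp (D \<omega>)) \<partial>M) = (\<integral>\<^sup>+z. ennreal (exp z) \<partial>distr M borel D)"
    using meas[OF D] by (subst nn_integral_distr) auto
  then show ?thesis unfolding law[OF D] by (simp add: nn_integral_exp_centred_normal cov_nonneg)
qed

text \<open>
  Increments of the process grow into the bounds through exponential weights, not through
  powers, because these behave exactly under regression: with \<open>D = e + c * X\<close> and \<open>e\<close>
  orthogonal to \<open>X\<close>, the factors \<open>exp e\<close> and \<open>exp (c * X)\<close> contribute half the variances of \<open>e\<close> and of
  \<open>c * X\<close> to the exponent of the bound, and these add up to half the variance of \<open>D\<close>. The bound is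
  uniform down to the case that \<open>D\<close> is a multiple of \<open>X\<close>.
\<close>

lemma density_exp_bound1:
  assumes G: "X \<in> G" "D \<in> G" and v: "cov X X > 0"
    and h[measurable]: "h \<in> borel_measurable borel"
  shows "(\<integral>\<^sup>+\<omega>. h (X \<omega>) * ennreal (exp (D \<omega>)) \<partial>M)
    \<le> ennreal (exp (cov D D / 2) / sqrt (2 * pi * cov X X)) * (\<integral>\<^sup>+x. h x \<partial>lborel)"
proof -
  define c where "c = cov D X / cov X X"
  define e where "e = regress D X"
  have e: "e \<in> G" unfolding e_def using G by (intro regress_in)
  have De: "D \<omega> = e \<omega> + c * X \<omega>" for \<omega> unfolding e_def c_def by (rule regress_eq)
  have o: "cov X e = 0" using G v unfolding e_def by (subst cov_sym) (simp add: cov_regress_orth)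
  have var: "cov D D = c\<^sup>2 * cov X X + cov e e"
    using G v unfolding e_def c_def by (simp add: cov_regress_self power2_eq_square)
  have v': "cov X X \<noteq> 0" using v by simp
  let ?K = "ennreal (exp (cov e e / 2))"
  have "(\<integral>\<^sup>+\<omega>. h (X \<omega>) * ennreal (exp (D \<omega>)) \<partial>M)
      = (\<integral>\<^sup>+\<omega>. (\<lambda>a b c' d. h a * ennreal (exp (b + c * a))) (X \<omega>) (e \<omega>) ((\<lambda>_. 0) \<omega>) ((\<lambda>_. 0) \<omega>) \<partial>M)"
    by (simp add: De)
  also have "\<dots> = (\<integral>\<^sup>+a. \<integral>\<^sup>+b. \<integral>\<^sup>+c'. \<integral>\<^sup>+d. h a * ennreal (exp (b + c * a)) \<partial>centred_normal (cov (\<lambda>_. 0) (\<lambda>_. 0))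
       \<partial>centred_normal (cov (\<lambda>_. 0) (\<lambda>_. 0)) \<partial>centred_normal (cov e e) \<partial>centred_normal (cov X X))"
    by (rule orthogonal_nn_integral[where \<Phi>="\<lambda>a b c' d. h a * ennreal (exp (b + c * a))"
        and ?e0.0=X and ?e1.0=e and ?e2.0="\<lambda>_. 0" and ?e3.0="\<lambda>_. 0"]) (use G e o zero in \<open>simp_all\<close>)
  also have "\<dots> = (\<integral>\<^sup>+a. \<integral>\<^sup>+b. (h a * ennreal (exp (c * a))) * ennreal (exp b) \<partial>centred_normal (cov e e) \<partial>centred_normal (cov X X))"
    unfolding cov_zero
    by (simp add: centred_normal_def[of 0] nn_integral_return exp_add ennreal_mult mult_ac)
  also have "\<dots> = (\<integral>\<^sup>+a. (h a * ennreal (exp (c * a))) * ?K \<partial>centred_normal (cov X X))"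
    by (simp add: nn_integral_cmult nn_integral_exp_centred_normal cov_nonneg)
  also have "\<dots> = (\<integral>\<^sup>+a. h a * ennreal (exp (c * a)) \<partial>centred_normal (cov X X)) * ?K"
    by (rule nn_integral_multc) simp
  also have "\<dots> \<le> (ennreal (exp (c\<^sup>2 * cov X X / 2) / sqrt (2 * pi * cov X X)) * (\<integral>\<^sup>+z. h z \<partial>lborel)) * ?K"
    using nn_integral_centred_normal_exp_le[OF v h, of 0 c] by (intro mult_right_mono) auto
  also have "\<dots> = (ennreal (exp (c\<^sup>2 * cov X X / 2) / sqrt (2 * pi * cov X X)) * ?K) * (\<integral>\<^sup>+z. h z \<partial>lborel)"
    by (simp only: mult_ac)
  also have "ennreal (exp (c\<^sup>2 * cov X X / 2) / sqrt (2 * pi * cov X X)) * ?K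
      = ennreal (exp (cov D D / 2) / sqrt (2 * pi * cov X X))"
  proof -
    have "exp (cov D D / 2) / sqrt (2 * pi * cov X X)
        = exp (c\<^sup>2 * cov X X / 2) / sqrt (2 * pi * cov X X) * exp (cov e e / 2)"
      unfolding var add_divide_distrib exp_add by simp
    then show ?thesis
      using v by (simp only:) (rule ennreal_mult[symmetric]; simp)
  qed
  finally show ?thesis .
qed

text \<open>
  The same computation after two regressions. The constant is a bound for the joint density of
  \<open>(X, Y)\<close>, in which the determinant of the covariance matrix appears; \<open>D\<close> may be a linear
  combination of \<open>X\<close> and \<open>Y\<close>.
\<close>

lemma density_exp_bound2:
  assumes G: "X \<in> G" "Y \<in> G" "D \<in> G"
    and v: "cov X X > 0" and det: "cov X X * cov Y Y - (cov X Y)\<^sup>2 > 0"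
    and h[measurable]: "h \<in> borel_measurable borel" "k \<in> borel_measurable borel"
  shows "(\<integral>\<^sup>+\<omega>. h (X \<omega>) * k (Y \<omega>) * ennreal (exp (D \<omega>)) \<partial>M)
    \<le> ennreal (exp (cov D D / 2) / (2 * pi * sqrt (cov X X * cov Y Y - (cov X Y)\<^sup>2)))
       * (\<integral>\<^sup>+x. h x \<partial>lborel) * (\<integral>\<^sup>+x. k x \<partial>lborel)"
proof -
  define \<alpha> where "\<alpha> = cov Y X / cov X X"
  define e1 where "e1 = regress Y X"
  define c0 where "c0 = cov D X / cov X X"
  define r where "r = regress D X"
  define c1 where "c1 = cov r e1 / cov e1 e1"
  define e2 where "e2 = regress r e1"
  have inG: "e1 \<in> G" "r \<in> G" "e2 \<in> G" unfolding e1_def r_def e2_def using G by (auto intro!: regress_in)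
  have v': "cov X X \<noteq> 0" using v by simp
  have Ye: "Y \<omega> = e1 \<omega> + \<alpha> * X \<omega>" for \<omega> unfolding e1_def \<alpha>_def by (rule regress_eq)
  have De: "D \<omega> = e2 \<omega> + c1 * e1 \<omega> + c0 * X \<omega>" for \<omega>
    using regress_eq[of D \<omega> X] regress_eq[of r \<omega> e1] unfolding r_def e2_def c0_def c1_def by simp
  have v1: "cov e1 e1 = (cov X X * cov Y Y - (cov X Y)\<^sup>2) / cov X X"
    unfolding e1_def using G v by (simp add: cov_regress_self field_simps cov_sym[of Y X])
  then have v1p: "cov e1 e1 > 0" using v det by simp
  then have v1': "cov e1 e1 \<noteq> 0" by simp
  have oX: "cov e1 X = 0" "cov r X = 0" unfolding e1_def r_def using G v' by (auto intro!: cov_regress_orth)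
  have o2: "cov e2 e1 = 0" unfolding e2_def using inG v1' by (intro cov_regress_orth)
  have o3: "cov e2 X = 0" unfolding e2_def using inG G by (simp add: cov_regress oX)
  have orth: "cov X e1 = 0" "cov X e2 = 0" "cov e1 e2 = 0"
    using oX o2 o3 by (simp_all add: cov_sym[of X] cov_sym[of e1 e2])
  have vr: "cov r r = cov e2 e2 + c1\<^sup>2 * cov e1 e1"
    unfolding e2_def c1_def using inG v1' by (simp add: cov_regress_self power2_eq_square)
  have var: "cov D D = c0\<^sup>2 * cov X X + c1\<^sup>2 * cov e1 e1 + cov e2 e2"
    using vr unfolding r_def c0_def using G v' by (simp add: cov_regress_self power2_eq_square)
  let ?Kc = "ennreal (exp (cov e2 e2 / 2))"
  let ?Kb = "ennreal (exp (c1\<^sup>2 * cov e1 e1 / 2) / sqrt (2 * pi * cov e1 e1))"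
  let ?Ka = "ennreal (exp (c0\<^sup>2 * cov X X / 2) / sqrt (2 * pi * cov X X))"
  have q: "(\<integral>\<^sup>+c. A * ennreal (exp c) \<partial>centred_normal (cov e2 e2)) = A * ?Kc" for A :: ennreal
    by (subst nn_integral_cmult) (simp_all add: nn_integral_exp_centred_normal cov_nonneg)
  let ?Ik = "\<integral>\<^sup>+x. k x \<partial>lborel" and ?Ih = "\<integral>\<^sup>+x. h x \<partial>lborel"
  have "(\<integral>\<^sup>+\<omega>. h (X \<omega>) * k (Y \<omega>) * ennreal (exp (D \<omega>)) \<partial>M)
      = (\<integral>\<^sup>+\<omega>. (\<lambda>a b c d. h a * k (b + \<alpha> * a) * ennreal (exp (c + c1 * b + c0 * a))) (X \<omega>) (e1 \<omega>) (e2 \<omega>) ((\<lambda>_. 0) \<omega>) \<partial>M)"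
    by (simp only: De Ye)
  also have "\<dots> = (\<integral>\<^sup>+a. \<integral>\<^sup>+b. \<integral>\<^sup>+c. \<integral>\<^sup>+d. h a * k (b + \<alpha> * a) * ennreal (exp (c + c1 * b + c0 * a))
      \<partial>centred_normal (cov (\<lambda>_. 0) (\<lambda>_. 0)) \<partial>centred_normal (cov e2 e2) \<partial>centred_normal (cov e1 e1) \<partial>centred_normal (cov X X))"
    by (rule orthogonal_nn_integral[where \<Phi>="\<lambda>a b c d. h a * k (b + \<alpha> * a) * ennreal (exp (c + c1 * b + c0 * a))"
        and ?e0.0=X and ?e1.0=e1 and ?e2.0=e2 and ?e3.0="\<lambda>_. 0"]) (use G inG orth zero in \<open>simp_all\<close>)
  also have "\<dots> = (\<integral>\<^sup>+a. \<integral>\<^sup>+b. \<integral>\<^sup>+c. (h a * ennreal (exp (c0 * a)) * (k (b + \<alpha> * a) * ennreal (exp (c1 * b)))) * ennreal (exp c)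
      \<partial>centred_normal (cov e2 e2) \<partial>centred_normal (cov e1 e1) \<partial>centred_normal (cov X X))"
    unfolding cov_zero
    by (simp add: centred_normal_def[of 0] nn_integral_return exp_add ennreal_mult mult_ac)
  also have "\<dots> = (\<integral>\<^sup>+a. \<integral>\<^sup>+b. (h a * ennreal (exp (c0 * a)) * ?Kc) * (k (b + \<alpha> * a) * ennreal (exp (c1 * b)))
      \<partial>centred_normal (cov e1 e1) \<partial>centred_normal (cov X X))"
    unfolding q by (simp only: mult_ac)
  also have "\<dots> = (\<integral>\<^sup>+a. (h a * ennreal (exp (c0 * a)) * ?Kc) * (\<integral>\<^sup>+b. k (b + \<alpha> * a) * ennreal (exp (c1 * b))
      \<partial>centred_normal (cov e1 e1)) \<partial>centred_normal (cov X X))"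
    by (intro nn_integral_cong nn_integral_cmult) simp
  also have "\<dots> \<le> (\<integral>\<^sup>+a. (h a * ennreal (exp (c0 * a)) * ?Kc) * (?Kb * ?Ik) \<partial>centred_normal (cov X X))"
    using nn_integral_centred_normal_exp_le[OF v1p h(2)] by (intro nn_integral_mono mult_left_mono) auto
  also have "\<dots> = (\<integral>\<^sup>+a. (h a * ennreal (exp (c0 * a))) * (?Kc * (?Kb * ?Ik)) \<partial>centred_normal (cov X X))"
    by (simp only: mult.assoc)
  also have "\<dots> = (\<integral>\<^sup>+a. h a * ennreal (exp (c0 * a)) \<partial>centred_normal (cov X X)) * (?Kc * (?Kb * ?Ik))"
    by (rule nn_integral_multc) simp
  also have "\<dots> \<le> (?Ka * ?Ih) * (?Kc * (?Kb * ?Ik))"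
    using nn_integral_centred_normal_exp_le[OF v h(1), of 0 c0] by (intro mult_right_mono) auto
  also have "\<dots> = (?Ka * ?Kc * ?Kb) * ?Ih * ?Ik"
    by (simp only: mult_ac)
  also have "?Ka * ?Kc * ?Kb = ennreal (exp (cov D D / 2) / (2 * pi * sqrt (cov X X * cov Y Y - (cov X Y)\<^sup>2)))"
  proof -
    have s: "sqrt (2 * pi * cov X X) * sqrt (2 * pi * cov e1 e1) = 2 * pi * sqrt (cov X X * cov Y Y - (cov X Y)\<^sup>2)"
    proof -
      have "sqrt (2 * pi * cov X X) * sqrt (2 * pi * cov e1 e1)
          = sqrt ((2 * pi)\<^sup>2 * (cov X X * cov Y Y - (cov X Y)\<^sup>2))"
        unfolding v1 using v' by (subst real_sqrt_mult[symmetric]) (simp add: power2_eq_square)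
      then show ?thesis by (simp add: real_sqrt_mult)
    qed
    have "?Ka * ?Kc * ?Kb = ennreal (exp (cov D D / 2) / (sqrt (2 * pi * cov X X) * sqrt (2 * pi * cov e1 e1)))"
    proof -
      have "exp (cov D D / 2) / (sqrt (2 * pi * cov X X) * sqrt (2 * pi * cov e1 e1))
        = exp (c0\<^sup>2 * cov X X / 2) / sqrt (2 * pi * cov X X) * exp (cov e2 e2 / 2) * (exp (c1\<^sup>2 * cov e1 e1 / 2) / sqrt (2 * pi * cov e1 e1))"
        unfolding var add_divide_distrib exp_add by simp
      then have "ennreal (exp (cov D D / 2) / (sqrt (2 * pi * cov X X) * sqrt (2 * pi * cov e1 e1)))
        = ennreal (exp (c0\<^sup>2 * cov X X / 2) / sqrt (2 * pi * cov X X) * exp (cov e2 e2 / 2) * (exp (c1\<^sup>2 * cov e1 e1 / 2) / sqrt (2 * pi * cov e1 e1)))"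
        by (rule arg_cong)
      note E = this
      have e3: "ennreal (a * b * c) = ennreal a * ennreal b * ennreal c"
        if "0 \<le> a" "0 \<le> b" "0 \<le> c" for a b c :: real
        using that by (simp add: ennreal_mult)
      show ?thesis
        unfolding E by (rule e3[symmetric]) (use v v1p in simp_all)
    qed
    then show ?thesis unfolding s .
  qed
  finally show ?thesis .
qed

end

section \<open>The limit of pairs of kernels\<close>

lemma nn_integral_lborel4:
  fixes f :: "real \<Rightarrow> real \<Rightarrow> real \<Rightarrow> real \<Rightarrow> ennreal"
  assumes f: "(\<lambda>(a, b, c, d). f a b c d) \<in> borel_measurable (lborel \<Otimes>\<^sub>M lborel \<Otimes>\<^sub>M lborel \<Otimes>\<^sub>M lborel)"
  shows "(\<integral>\<^sup>+a. \<integral>\<^sup>+b. \<integral>\<^sup>+c. \<integral>\<^sup>+d. f a b c d \<partial>lborel \<partial>lborel \<partial>lborel \<partial>lborel)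
    = (\<integral>\<^sup>+(a, b, c, d). f a b c d \<partial>(lborel \<Otimes>\<^sub>M lborel \<Otimes>\<^sub>M lborel \<Otimes>\<^sub>M lborel))"
proof -
  let ?g = "\<lambda>(a, b, c, d). f a b c d"
  have f': "?g \<in> borel_measurable ((lborel :: real measure) \<Otimes>\<^sub>M (lborel :: (real \<times> real \<times> real) measure))"
    using f by (simp add: lborel_prod)
  have m3: "(\<lambda>y. ?g (a, y)) \<in> borel_measurable ((lborel :: real measure) \<Otimes>\<^sub>M (lborel :: (real \<times> real) measure))" for a
    using f by (intro measurable_compose[OF _ f]) (simp add: lborel_prod)
  have m2: "(\<lambda>y. ?g (a, b, y)) \<in> borel_measurable (lborel \<Otimes>\<^sub>M lborel)" for a b
    by (rule measurable_compose[OF _ f]) simp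
  have "(\<integral>\<^sup>+p. ?g p \<partial>(lborel \<Otimes>\<^sub>M lborel \<Otimes>\<^sub>M lborel \<Otimes>\<^sub>M lborel))
      = (\<integral>\<^sup>+a. \<integral>\<^sup>+y. ?g (a, y) \<partial>(lborel \<Otimes>\<^sub>M lborel \<Otimes>\<^sub>M lborel) \<partial>lborel)"
    unfolding lborel_prod using lborel.nn_integral_fst[OF f'] by (simp only: lborel_prod)
  also have "\<dots> = (\<integral>\<^sup>+a. \<integral>\<^sup>+b. \<integral>\<^sup>+y. ?g (a, b, y) \<partial>(lborel \<Otimes>\<^sub>M lborel) \<partial>lborel \<partial>lborel)"
    unfolding lborel_prod using lborel.nn_integral_fst[OF m3] by (simp only: lborel_prod)
  also have "\<dots> = (\<integral>\<^sup>+a. \<integral>\<^sup>+b. \<integral>\<^sup>+c. \<integral>\<^sup>+d. ?g (a, b, c, d) \<partial>lborel \<partial>lborel \<partial>lborel \<partial>lborel)"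
    by (intro nn_integral_cong lborel.nn_integral_fst[symmetric, OF m2])
  finally show ?thesis by simp
qed

lemma nn_integral_shift:
  fixes f :: "real \<Rightarrow> ennreal"
  assumes "f \<in> borel_measurable borel"
  shows "(\<integral>\<^sup>+y. f y \<partial>lborel) = (\<integral>\<^sup>+y. f (y - a) \<partial>lborel)"
  using nn_integral_translate[OF assms, of "-a"] by simp

text \<open>
  The density at \<open>(z, w, x, y)\<close> of the image of four independent centred normal variables under
  a lower triangular matrix with unit diagonal, as it comes out of the Gram-Schmidt procedure. The
  \<open>v\<close> are the variances of the independent variables, the \<open>c\<close> are the matrix entries.
\<close>

definition triangular_density ::
    "real \<Rightarrow> real \<Rightarrow> real \<Rightarrow> real \<Rightarrow> real \<Rightarrow> real \<Rightarrow> real \<Rightarrow> real \<Rightarrow> real \<Rightarrow> real \<Rightarrow> real \<Rightarrow> real \<Rightarrow> real \<Rightarrow> real \<Rightarrow> real" where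
  "triangular_density v0 v1 v2 v3 c10 c20 c21 c30 c31 c32 z w x y =
     normal_density 0 (sqrt v0) z *
     normal_density 0 (sqrt v1) (w - c10 * z) *
     normal_density 0 (sqrt v2) (x - (c21 * (w - c10 * z) + c20 * z)) *
     normal_density 0 (sqrt v3) (y - (c32 * (x - (c21 * (w - c10 * z) + c20 * z)) + c31 * (w - c10 * z) + c30 * z))"

context gaussian_space
begin

text \<open>
  The substitution is made one coordinate at a time, innermost first, where each step is a mere
  translation of the line.
\<close>

lemma triangular_nn_integral:
  fixes \<Phi> :: "real \<Rightarrow> real \<Rightarrow> real \<Rightarrow> real \<Rightarrow> ennreal"
  assumes \<Phi>: "(\<lambda>(a, b, c, d). \<Phi> a b c d) \<in> borel_measurable (borel \<Otimes>\<^sub>M borel \<Otimes>\<^sub>M borel \<Otimes>\<^sub>M borel)"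
    and G: "e0 \<in> G" "e1 \<in> G" "e2 \<in> G" "e3 \<in> G"
    and orth: "cov e0 e1 = 0" "cov e0 e2 = 0" "cov e0 e3 = 0" "cov e1 e2 = 0" "cov e1 e3 = 0" "cov e2 e3 = 0"
    and v: "cov e0 e0 > 0" "cov e1 e1 > 0" "cov e2 e2 > 0" "cov e3 e3 > 0"
  shows "(\<integral>\<^sup>+\<omega>. \<Phi> (e0 \<omega>) (e1 \<omega> + c10 * e0 \<omega>) (e2 \<omega> + (c21 * e1 \<omega> + c20 * e0 \<omega>))
      (e3 \<omega> + (c32 * e2 \<omega> + c31 * e1 \<omega> + c30 * e0 \<omega>)) \<partial>M) =
    (\<integral>\<^sup>+z. \<integral>\<^sup>+w. \<integral>\<^sup>+x. \<integral>\<^sup>+y. \<Phi> z w x y * ennreal (triangular_density (cov e0 e0) (cov e1 e1) (cov e2 e2) (cov e3 e3)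
       c10 c20 c21 c30 c31 c32 z w x y) \<partial>lborel \<partial>lborel \<partial>lborel \<partial>lborel)"
proof -
  define n where "n i = normal_density 0 (sqrt (if i = 0 then cov e0 e0 else if i = 1 then cov e1 e1 else
    if i = 2 then cov e2 e2 else cov e3 e3))" for i :: nat
  have n[measurable]: "n i \<in> borel_measurable borel" for i unfolding n_def by simp
  have n_nonneg: "0 \<le> n i x" for i x unfolding n_def by simp
  note m = measurable_curried4[OF \<Phi>]
  have m': "(\<lambda>x. \<Phi> (f1 x) (f2 x) (f3 x) (f4 x)) \<in> borel_measurable N"
    if "f1 \<in> borel_measurable N" "f2 \<in> borel_measurable N" "f3 \<in> borel_measurable N" "f4 \<in> borel_measurable N"
    for f1 f2 f3 f4 and N :: "real measure"
    using that by (rule m)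
  let ?\<Psi> = "\<lambda>a b c d. \<Phi> a (b + c10 * a) (c + (c21 * b + c20 * a)) (d + (c32 * c + c31 * b + c30 * a))"
  have \<Psi>: "(\<lambda>(a, b, c, d). ?\<Psi> a b c d) \<in> borel_measurable (borel \<Otimes>\<^sub>M borel \<Otimes>\<^sub>M borel \<Otimes>\<^sub>M borel)"
    unfolding case_prod_beta by (rule m; measurable)
  have "(\<integral>\<^sup>+\<omega>. ?\<Psi> (e0 \<omega>) (e1 \<omega>) (e2 \<omega>) (e3 \<omega>) \<partial>M) =
    (\<integral>\<^sup>+a. \<integral>\<^sup>+b. \<integral>\<^sup>+c. \<integral>\<^sup>+d. ?\<Psi> a b c d \<partial>centred_normal (cov e3 e3) \<partial>centred_normal (cov e2 e2)
       \<partial>centred_normal (cov e1 e1) \<partial>centred_normal (cov e0 e0))"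
    by (rule orthogonal_nn_integral[OF \<Psi> G orth])
  also have "\<dots> = (\<integral>\<^sup>+a. \<integral>\<^sup>+b. \<integral>\<^sup>+c. \<integral>\<^sup>+d. ennreal (n 3 d) * ?\<Psi> a b c d \<partial>lborel \<partial>centred_normal (cov e2 e2)
       \<partial>centred_normal (cov e1 e1) \<partial>centred_normal (cov e0 e0))"
    unfolding n_def using v(4)
    by (intro nn_integral_cong, subst nn_integral_centred_normal) (auto intro!: m')
  also have "\<dots> = (\<integral>\<^sup>+a. \<integral>\<^sup>+b. \<integral>\<^sup>+c. \<integral>\<^sup>+y. ennreal (n 3 (y - (c32 * c + c31 * b + c30 * a))) *
       \<Phi> a (b + c10 * a) (c + (c21 * b + c20 * a)) y \<partial>lborel \<partial>centred_normal (cov e2 e2)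
       \<partial>centred_normal (cov e1 e1) \<partial>centred_normal (cov e0 e0))"
  proof (rule nn_integral_cong, rule nn_integral_cong, rule nn_integral_cong)
    fix a b c :: real
    have "(\<lambda>d. ennreal (n 3 d) * ?\<Psi> a b c d) \<in> borel_measurable borel"
      by (intro borel_measurable_times_ennreal m') measurable
    from nn_integral_shift[OF this, of "c32 * c + c31 * b + c30 * a"]
    show "(\<integral>\<^sup>+d. ennreal (n 3 d) * ?\<Psi> a b c d \<partial>lborel) = (\<integral>\<^sup>+y. ennreal (n 3 (y - (c32 * c + c31 * b + c30 * a))) *
       \<Phi> a (b + c10 * a) (c + (c21 * b + c20 * a)) y \<partial>lborel)"
      by (simp only: diff_add_cancel)
  qed
  also have "\<dots> = (\<integral>\<^sup>+a. \<integral>\<^sup>+b. \<integral>\<^sup>+x. \<integral>\<^sup>+y. ennreal (n 2 (x - (c21 * b + c20 * a))) *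
       (ennreal (n 3 (y - (c32 * (x - (c21 * b + c20 * a)) + c31 * b + c30 * a))) *
       \<Phi> a (b + c10 * a) x y) \<partial>lborel \<partial>lborel
       \<partial>centred_normal (cov e1 e1) \<partial>centred_normal (cov e0 e0))"
  proof (rule nn_integral_cong, rule nn_integral_cong)
    fix a b :: real
    let ?H = "\<lambda>c. \<integral>\<^sup>+y. ennreal (n 3 (y - (c32 * c + c31 * b + c30 * a))) *
       \<Phi> a (b + c10 * a) (c + (c21 * b + c20 * a)) y \<partial>lborel"
    have mp: "(\<lambda>(c, y). ennreal (n 3 (y - (c32 * c + c31 * b + c30 * a))) *
       \<Phi> a (b + c10 * a) (c + (c21 * b + c20 * a)) y) \<in> borel_measurable (borel \<Otimes>\<^sub>M lborel)"
      unfolding case_prod_beta by (intro borel_measurable_times_ennreal m) measurable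
    have H[measurable]: "?H \<in> borel_measurable borel"
      using lborel.borel_measurable_nn_integral[OF mp] by simp
    have in1: "(\<lambda>y. ennreal (n 3 (y - (c32 * (x - (c21 * b + c20 * a)) + c31 * b + c30 * a))) *
       \<Phi> a (b + c10 * a) x y) \<in> borel_measurable lborel" for x
      by (intro borel_measurable_times_ennreal m') measurable
    have "(\<integral>\<^sup>+c. ?H c \<partial>centred_normal (cov e2 e2)) = (\<integral>\<^sup>+c. ennreal (n 2 c) * ?H c \<partial>lborel)"
      unfolding n_def using v(3) by (subst nn_integral_centred_normal[OF _ H[unfolded n_def]]) auto
    also have "\<dots> = (\<integral>\<^sup>+x. ennreal (n 2 (x - (c21 * b + c20 * a))) * ?H (x - (c21 * b + c20 * a)) \<partial>lborel)"
      by (rule nn_integral_shift) (intro borel_measurable_times_ennreal H, measurable)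
    also have "\<dots> = (\<integral>\<^sup>+x. \<integral>\<^sup>+y. ennreal (n 2 (x - (c21 * b + c20 * a))) *
       (ennreal (n 3 (y - (c32 * (x - (c21 * b + c20 * a)) + c31 * b + c30 * a))) *
       \<Phi> a (b + c10 * a) x y) \<partial>lborel \<partial>lborel)"
      by (simp only: nn_integral_cmult[OF in1] diff_add_cancel)
    finally show "(\<integral>\<^sup>+c. ?H c \<partial>centred_normal (cov e2 e2)) = (\<integral>\<^sup>+x. \<integral>\<^sup>+y. ennreal (n 2 (x - (c21 * b + c20 * a))) *
       (ennreal (n 3 (y - (c32 * (x - (c21 * b + c20 * a)) + c31 * b + c30 * a))) *
       \<Phi> a (b + c10 * a) x y) \<partial>lborel \<partial>lborel)" .
  qed
  also have "\<dots> = (\<integral>\<^sup>+a. \<integral>\<^sup>+w. \<integral>\<^sup>+x. \<integral>\<^sup>+y. ennreal (n 1 (w - c10 * a)) * (ennreal (n 2 (x - (c21 * (w - c10 * a) + c20 * a))) *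
       (ennreal (n 3 (y - (c32 * (x - (c21 * (w - c10 * a) + c20 * a)) + c31 * (w - c10 * a) + c30 * a))) *
       \<Phi> a w x y)) \<partial>lborel \<partial>lborel \<partial>lborel \<partial>centred_normal (cov e0 e0))"
  proof (rule nn_integral_cong)
    fix a :: real
    let ?h = "\<lambda>b x y. ennreal (n 2 (x - (c21 * b + c20 * a))) *
       (ennreal (n 3 (y - (c32 * (x - (c21 * b + c20 * a)) + c31 * b + c30 * a))) *
       \<Phi> a (b + c10 * a) x y)"
    let ?H = "\<lambda>b. \<integral>\<^sup>+x. \<integral>\<^sup>+y. ?h b x y \<partial>lborel \<partial>lborel"
    have m3: "(\<lambda>(p, y). ?h (fst p) (snd p) y) \<in> borel_measurable ((borel \<Otimes>\<^sub>M lborel) \<Otimes>\<^sub>M lborel)"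
      unfolding case_prod_beta by (intro borel_measurable_times_ennreal m) measurable
    have m2: "(\<lambda>(b, x). \<integral>\<^sup>+y. ?h b x y \<partial>lborel) \<in> borel_measurable (borel \<Otimes>\<^sub>M lborel)"
      using lborel.borel_measurable_nn_integral[OF m3] unfolding case_prod_beta by simp
    have H: "?H \<in> borel_measurable borel"
      using lborel.borel_measurable_nn_integral[OF m2] by simp
    have in2: "(\<lambda>y. ?h b x y) \<in> borel_measurable lborel" for b x
      by (intro borel_measurable_times_ennreal m') measurable
    have in1: "(\<lambda>x. \<integral>\<^sup>+y. ?h b x y \<partial>lborel) \<in> borel_measurable lborel" for b
      by (rule measurable_Pair2[OF m2, of b, unfolded space_borel, OF UNIV_I, unfolded prod.case])
    have "(\<integral>\<^sup>+c. ?H c \<partial>centred_normal (cov e1 e1)) = (\<integral>\<^sup>+c. ennreal (n 1 c) * ?H c \<partial>lborel)"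
      unfolding n_def using v(2) by (subst nn_integral_centred_normal[OF _ H[unfolded n_def]]) auto
    also have "\<dots> = (\<integral>\<^sup>+w. ennreal (n 1 (w - c10 * a)) * ?H (w - c10 * a) \<partial>lborel)"
      by (rule nn_integral_shift) (intro borel_measurable_times_ennreal H, measurable)
    also have "\<dots> = (\<integral>\<^sup>+w. \<integral>\<^sup>+x. \<integral>\<^sup>+y. ennreal (n 1 (w - c10 * a)) * ?h (w - c10 * a) x y \<partial>lborel \<partial>lborel \<partial>lborel)"
      by (simp only: nn_integral_cmult[OF in1] nn_integral_cmult[OF in2])
    finally show "(\<integral>\<^sup>+c. ?H c \<partial>centred_normal (cov e1 e1)) = (\<integral>\<^sup>+w. \<integral>\<^sup>+x. \<integral>\<^sup>+y. ennreal (n 1 (w - c10 * a)) * (ennreal (n 2 (x - (c21 * (w - c10 * a) + c20 * a))) *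
       (ennreal (n 3 (y - (c32 * (x - (c21 * (w - c10 * a) + c20 * a)) + c31 * (w - c10 * a) + c30 * a))) *
       \<Phi> a w x y)) \<partial>lborel \<partial>lborel \<partial>lborel)"
      by (simp only: diff_add_cancel)
  qed
  also have "\<dots> = (\<integral>\<^sup>+z. \<integral>\<^sup>+w. \<integral>\<^sup>+x. \<integral>\<^sup>+y. ennreal (n 0 z) * (ennreal (n 1 (w - c10 * z)) * (ennreal (n 2 (x - (c21 * (w - c10 * z) + c20 * z))) *
       (ennreal (n 3 (y - (c32 * (x - (c21 * (w - c10 * z) + c20 * z)) + c31 * (w - c10 * z) + c30 * z))) *
       \<Phi> z w x y))) \<partial>lborel \<partial>lborel \<partial>lborel \<partial>lborel)"
  proof -
    let ?h = "\<lambda>z w x y. ennreal (n 1 (w - c10 * z)) * (ennreal (n 2 (x - (c21 * (w - c10 * z) + c20 * z))) *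
       (ennreal (n 3 (y - (c32 * (x - (c21 * (w - c10 * z) + c20 * z)) + c31 * (w - c10 * z) + c30 * z))) *
       \<Phi> z w x y))"
    have m4: "(\<lambda>(p, y). ?h (fst (fst p)) (snd (fst p)) (snd p) y) \<in> borel_measurable (((borel \<Otimes>\<^sub>M lborel) \<Otimes>\<^sub>M lborel) \<Otimes>\<^sub>M lborel)"
      unfolding case_prod_beta by (intro borel_measurable_times_ennreal m) measurable
    have m3: "(\<lambda>(p, x). \<integral>\<^sup>+y. ?h (fst p) (snd p) x y \<partial>lborel) \<in> borel_measurable ((borel \<Otimes>\<^sub>M lborel) \<Otimes>\<^sub>M lborel)"
      using lborel.borel_measurable_nn_integral[OF m4] unfolding case_prod_beta by simp
    have m2: "(\<lambda>(z, w). \<integral>\<^sup>+x. \<integral>\<^sup>+y. ?h z w x y \<partial>lborel \<partial>lborel) \<in> borel_measurable (borel \<Otimes>\<^sub>M lborel)"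
      using lborel.borel_measurable_nn_integral[OF m3] unfolding case_prod_beta by simp
    have H: "(\<lambda>z. \<integral>\<^sup>+w. \<integral>\<^sup>+x. \<integral>\<^sup>+y. ?h z w x y \<partial>lborel \<partial>lborel \<partial>lborel) \<in> borel_measurable borel"
      using lborel.borel_measurable_nn_integral[OF m2] by simp
    have in3: "(\<lambda>y. ?h z w x y) \<in> borel_measurable lborel" for z w x
      by (intro borel_measurable_times_ennreal m') measurable
    have in2: "(\<lambda>x. \<integral>\<^sup>+y. ?h z w x y \<partial>lborel) \<in> borel_measurable lborel" for z w
      by (rule measurable_Pair2[OF m3, of "(z, w)", unfolded space_pair_measure space_borel space_lborel UNIV_Times_UNIV, OF UNIV_I, unfolded prod.case fst_conv snd_conv])
    have in1: "(\<lambda>w. \<integral>\<^sup>+x. \<integral>\<^sup>+y. ?h z w x y \<partial>lborel \<partial>lborel) \<in> borel_measurable lborel" for z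
      by (rule measurable_Pair2[OF m2, of z, unfolded space_borel, OF UNIV_I, unfolded prod.case])
    show ?thesis
      by (subst nn_integral_centred_normal[OF v(1) H])
        (simp only: nn_integral_cmult[OF in1] nn_integral_cmult[OF in2] nn_integral_cmult[OF in3],
          simp add: n_def)
  qed
  also have "\<dots> = (\<integral>\<^sup>+z. \<integral>\<^sup>+w. \<integral>\<^sup>+x. \<integral>\<^sup>+y. \<Phi> z w x y * ennreal (triangular_density (cov e0 e0) (cov e1 e1) (cov e2 e2) (cov e3 e3)
       c10 c20 c21 c30 c31 c32 z w x y) \<partial>lborel \<partial>lborel \<partial>lborel \<partial>lborel)"
  proof -
    have t: "ennreal (triangular_density (cov e0 e0) (cov e1 e1) (cov e2 e2) (cov e3 e3)
       c10 c20 c21 c30 c31 c32 z w x y) = ennreal (n 0 z) * ennreal (n 1 (w - c10 * z)) *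
       ennreal (n 2 (x - (c21 * (w - c10 * z) + c20 * z))) *
       ennreal (n 3 (y - (c32 * (x - (c21 * (w - c10 * z) + c20 * z)) + c31 * (w - c10 * z) + c30 * z)))" for z w x y
      unfolding triangular_density_def n_def by (simp add: ennreal_mult)
    show ?thesis unfolding t by (simp only: mult_ac)
  qed
  finally show ?thesis .
qed

end

lemma normal_density_tendsto:
  assumes "v \<longlonglongrightarrow> v'" "v' > 0" "x \<longlonglongrightarrow> x'"
  shows "(\<lambda>n. normal_density 0 (sqrt (v n)) (x n)) \<longlonglongrightarrow> normal_density 0 (sqrt v') x'"
  unfolding normal_density_def using assms
  by (intro tendsto_intros) (auto simp: power2_eq_square)

lemma normal_density_le:
  assumes "m > 0" "m / 2 \<le> v"
  shows "normal_density 0 (sqrt v) x \<le> 1 / sqrt (pi * m)"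
proof -
  have v: "v > 0" using assms by simp
  have "normal_density 0 (sqrt v) x \<le> 1 / sqrt (2 * pi * v)"
    unfolding normal_density_def using v by (simp add: divide_simps)
  also have "\<dots> \<le> 1 / sqrt (pi * m)"
    using assms v by (intro divide_left_mono real_sqrt_le_mono) auto
  finally show ?thesis .
qed

text \<open>
  The variance is only known up to a factor two; the Gaussian tail survives with the variance
  doubled.
\<close>

lemma normal_density_le_exp:
  assumes "s > 0" "s / 2 \<le> v" "v \<le> 2 * s"
  shows "normal_density 0 (sqrt v) x \<le> 1 / sqrt (pi * s) * exp (- x\<^sup>2 / (4 * s))"
proof -
  have v: "v > 0" using assms by simp
  have 1: "1 / sqrt (2 * pi * v) \<le> 1 / sqrt (pi * s)"
    using assms v by (intro divide_left_mono real_sqrt_le_mono) auto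
  have "x\<^sup>2 / (4 * s) \<le> x\<^sup>2 / (2 * v)"
    using assms v by (intro divide_left_mono) auto
  then have 2: "exp (- x\<^sup>2 / (2 * v)) \<le> exp (- x\<^sup>2 / (4 * s))" by simp
  have "normal_density 0 (sqrt v) x = 1 / sqrt (2 * pi * v) * exp (- x\<^sup>2 / (2 * v))"
    unfolding normal_density_def using v by simp
  also have "\<dots> \<le> 1 / sqrt (pi * s) * exp (- x\<^sup>2 / (4 * s))"
    by (rule mult_mono[OF 1 2]) (use assms in auto)
  finally show ?thesis .
qed

text \<open>
  The bound must be integrable against \<open>h y * k z * h y' * k w\<close>: decay is needed in the two
  increment variables \<open>z\<close> and \<open>w\<close>, whereas the two values of the process only need their densities
  bounded. The factors in \<open>z\<close> and \<open>w - c10 * z\<close> are decoupled by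
  \<open>w\<^sup>2 \<le> 2 * (w - c10 * z)\<^sup>2 + 2 * (c10 * z)\<^sup>2\<close>, at the price of a larger variance and the factor
  \<open>8\<close>.
\<close>

lemma triangular_density_le:
  assumes s: "s > 0" "s / 2 \<le> v0" "v0 \<le> 2 * s" "s / 2 \<le> v1" "v1 \<le> 2 * s"
    and a: "a > 0" "a / 2 \<le> v2" and b: "b > 0" "b / 2 \<le> v3" and c: "c10\<^sup>2 \<le> 1 / 2"
  shows "triangular_density v0 v1 v2 v3 c10 c20 c21 c30 c31 c32 z w x y
    \<le> 8 / (sqrt (pi * a) * sqrt (pi * b)) * (normal_density 0 (sqrt (4 * s)) z * normal_density 0 (sqrt (4 * s)) w)"
proof -
  let ?e = "\<lambda>x. exp (- x\<^sup>2 / (4 * s))"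
  (* c10^2 <= 1/2 lets the cross term be absorbed by z^2. *)
  have "w\<^sup>2 \<le> 2 * (w - c10 * z)\<^sup>2 + 2 * (c10 * z)\<^sup>2"
    using zero_le_power2[of "w - 2 * (c10 * z)"] by (simp add: power2_eq_square algebra_simps)
  moreover have "2 * (c10 * z)\<^sup>2 \<le> z\<^sup>2"
    using mult_right_mono[OF c zero_le_power2[of z]] by (simp add: power_mult_distrib)
  ultimately have "z\<^sup>2 + w\<^sup>2 \<le> 2 * z\<^sup>2 + 2 * (w - c10 * z)\<^sup>2" by simp
  then have "(z\<^sup>2 + w\<^sup>2) / (8 * s) \<le> (2 * z\<^sup>2 + 2 * (w - c10 * z)\<^sup>2) / (8 * s)"
    using s by (intro divide_right_mono) auto
  also have "\<dots> = z\<^sup>2 / (4 * s) + (w - c10 * z)\<^sup>2 / (4 * s)"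
    using s by (simp add: field_simps)
  finally have "(z\<^sup>2 + w\<^sup>2) / (8 * s) \<le> z\<^sup>2 / (4 * s) + (w - c10 * z)\<^sup>2 / (4 * s)" .
  then have ee: "?e z * ?e (w - c10 * z) \<le> exp (- (z\<^sup>2 + w\<^sup>2) / (8 * s))"
    unfolding exp_add[symmetric] exp_le_cancel_iff minus_divide_left[symmetric] by linarith
  have "normal_density 0 (sqrt v0) z * normal_density 0 (sqrt v1) (w - c10 * z)
      \<le> (1 / sqrt (pi * s) * ?e z) * (1 / sqrt (pi * s) * ?e (w - c10 * z))"
    using s by (intro mult_mono normal_density_le_exp) auto
  also have "\<dots> = 1 / (pi * s) * (?e z * ?e (w - c10 * z))"
    using s by (simp add: real_sqrt_mult[symmetric])
  also have "\<dots> \<le> 1 / (pi * s) * exp (- (z\<^sup>2 + w\<^sup>2) / (8 * s))"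
    using ee s by (intro mult_left_mono) auto
  also have "\<dots> = 8 * (normal_density 0 (sqrt (4 * s)) z * normal_density 0 (sqrt (4 * s)) w)"
  proof -
    have n: "normal_density 0 (sqrt (4 * s)) x = 1 / sqrt (8 * pi * s) * exp (- x\<^sup>2 / (8 * s))" for x
      unfolding normal_density_def using s by (simp add: mult.assoc mult.left_commute)
    have "exp (- (z\<^sup>2 + w\<^sup>2) / (8 * s)) = exp (- z\<^sup>2 / (8 * s)) * exp (- w\<^sup>2 / (8 * s))"
      unfolding exp_add[symmetric] by (simp add: add_divide_distrib diff_divide_distrib)
    moreover have "1 / sqrt (8 * pi * s) * (1 / sqrt (8 * pi * s)) = 1 / (8 * pi * s)"
      using s by (simp add: real_sqrt_mult[symmetric])
    moreover have "8 * ((1 / sqrt (8 * pi * s) * e1) * (1 / sqrt (8 * pi * s) * e2))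
        = 8 * (1 / sqrt (8 * pi * s) * (1 / sqrt (8 * pi * s))) * (e1 * e2)" for e1 e2
      by (simp only: mult_ac)
    ultimately show ?thesis unfolding n by simp
  qed
  finally have zw: "normal_density 0 (sqrt v0) z * normal_density 0 (sqrt v1) (w - c10 * z)
    \<le> 8 * (normal_density 0 (sqrt (4 * s)) z * normal_density 0 (sqrt (4 * s)) w)" .
  have "triangular_density v0 v1 v2 v3 c10 c20 c21 c30 c31 c32 z w x y
    \<le> (8 * (normal_density 0 (sqrt (4 * s)) z * normal_density 0 (sqrt (4 * s)) w)) *
      (1 / sqrt (pi * a)) * (1 / sqrt (pi * b))"
    unfolding triangular_density_def using a b
    by (intro mult_mono normal_density_le zw) auto
  then show ?thesis by (simp add: mult_ac)
qed

text \<open>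
  Zooming in on \<open>(x, x)\<close> at scale \<open>1 / u\<close> absorbs the two normalising factors \<open>u\<close>.
\<close>

lemma nn_integral_affine2:
  fixes g :: "real \<Rightarrow> real \<Rightarrow> ennreal"
  assumes g: "(\<lambda>(a, b). g a b) \<in> borel_measurable (borel \<Otimes>\<^sub>M borel)" and u: "u > 0"
  shows "(\<integral>\<^sup>+a. \<integral>\<^sup>+b. ennreal (u\<^sup>2) * g a b \<partial>lborel \<partial>lborel) = (\<integral>\<^sup>+a. \<integral>\<^sup>+b. g (x + a / u) (x + b / u) \<partial>lborel \<partial>lborel)"
proof -
  have aff: "(\<integral>\<^sup>+b. ennreal u * f b \<partial>lborel) = (\<integral>\<^sup>+b. f (x + b / u) \<partial>lborel)"
    if f[measurable]: "f \<in> borel_measurable borel" for f :: "real \<Rightarrow> ennreal"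
  proof -
    have "(\<integral>\<^sup>+b. ennreal u * f b \<partial>lborel) = ennreal u * (ennreal (1 / u) * (\<integral>\<^sup>+b. f (x + (1 / u) * b) \<partial>lborel))"
      using u by (subst nn_integral_cmult) (simp_all add: nn_integral_real_affine[OF f, of "1/u" x])
    also have "\<dots> = (ennreal u * ennreal (1 / u)) * (\<integral>\<^sup>+b. f (x + b / u) \<partial>lborel)"
      by (simp add: mult.assoc)
    also have "ennreal u * ennreal (1 / u) = 1"
      using u by (simp add: ennreal_mult[symmetric])
    finally show ?thesis by simp
  qed
  have ga: "(\<lambda>b. g a b) \<in> borel_measurable borel" for a
    by (rule measurable_Pair2[OF g, of a, unfolded space_borel, OF UNIV_I, unfolded prod.case])
  have g': "(\<lambda>(a, b). g a (x + b / u)) \<in> borel_measurable (borel \<Otimes>\<^sub>M lborel)"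
    using measurable_compose[OF _ g, of "\<lambda>(a, b). (a, x + b / u)" "borel \<Otimes>\<^sub>M lborel"] by (simp add: case_prod_beta)
  have H: "(\<lambda>a. \<integral>\<^sup>+b. g a (x + b / u) \<partial>lborel) \<in> borel_measurable borel"
    using lborel.borel_measurable_nn_integral[OF g'] by simp
  have gu: "(\<lambda>b. g a (x + b / u)) \<in> borel_measurable lborel" for a
    using measurable_compose[OF _ ga[of a], of "\<lambda>b. x + b / u" lborel] by simp
  have "(\<integral>\<^sup>+a. \<integral>\<^sup>+b. ennreal (u\<^sup>2) * g a b \<partial>lborel \<partial>lborel)
      = (\<integral>\<^sup>+a. \<integral>\<^sup>+b. ennreal u * (ennreal u * g a b) \<partial>lborel \<partial>lborel)"
    using u by (simp add: power2_eq_square ennreal_mult mult.assoc)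
  also have "\<dots> = (\<integral>\<^sup>+a. \<integral>\<^sup>+b. ennreal u * g a (x + b / u) \<partial>lborel \<partial>lborel)"
    by (subst aff) (auto intro!: borel_measurable_times_ennreal ga)
  also have "\<dots> = (\<integral>\<^sup>+a. ennreal u * (\<integral>\<^sup>+b. g a (x + b / u) \<partial>lborel) \<partial>lborel)"
    by (simp only: nn_integral_cmult[OF gu])
  also have "\<dots> = (\<integral>\<^sup>+a. \<integral>\<^sup>+b. g (x + a / u) (x + b / u) \<partial>lborel \<partial>lborel)"
    by (rule aff[OF H])
  finally show ?thesis .
qed

text \<open>
  The integral of \<open>F(y, z)\<close> against Lebesgue measure in \<open>y\<close> and the centred normal law of variance
  \<open>s\<close> in \<open>z\<close>. It is the only feature of a kernel that survives in the limit.
\<close>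

definition kernel_mass :: "real \<Rightarrow> (real \<times> real \<Rightarrow> ennreal) \<Rightarrow> ennreal" where
  "kernel_mass s F = (\<integral>\<^sup>+z. \<integral>\<^sup>+y. F (y, z) * ennreal (normal_density 0 (sqrt s) z) \<partial>lborel \<partial>lborel)"

lemma nn_integral_normal_exp_growth:
  assumes "v > 0" and k: "k \<in> borel_measurable borel" "\<And>z. k z \<le> C * (exp z + exp (- z))"
  shows "(\<integral>\<^sup>+z. ennreal (k z) * ennreal (normal_density 0 (sqrt v) z) \<partial>lborel) < \<infinity>"
proof -
  have "(\<integral>\<^sup>+z. ennreal (k z) * ennreal (normal_density 0 (sqrt v) z) \<partial>lborel) = (\<integral>\<^sup>+z. ennreal (k z) \<partial>centred_normal v)"
    using k(1) by (subst nn_integral_centred_normal[OF assms(1)]) (auto simp: mult.commute)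
  also have "\<dots> \<le> (\<integral>\<^sup>+z. ennreal \<bar>C\<bar> * ennreal (exp (1 * z)) + ennreal \<bar>C\<bar> * ennreal (exp ((-1) * z)) \<partial>centred_normal v)"
  proof (rule nn_integral_mono)
    fix z
    have "k z \<le> \<bar>C\<bar> * (exp z + exp (- z))"
      by (rule order_trans[OF k(2)]) (intro mult_right_mono, auto intro: add_nonneg_nonneg)
    then show "ennreal (k z) \<le> ennreal \<bar>C\<bar> * ennreal (exp (1 * z)) + ennreal \<bar>C\<bar> * ennreal (exp ((-1) * z))"
      by (simp add: ennreal_mult[symmetric] distrib_left ennreal_leI flip: ennreal_plus)
  qed
  also have "\<dots> = ennreal \<bar>C\<bar> * ennreal (exp (1\<^sup>2 * v / 2)) + ennreal \<bar>C\<bar> * ennreal (exp ((-1)\<^sup>2 * v / 2))"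
  proof -
    have "(\<integral>\<^sup>+z. ennreal \<bar>C\<bar> * ennreal (exp (c * z)) \<partial>centred_normal v) = ennreal \<bar>C\<bar> * ennreal (exp (c\<^sup>2 * v / 2))" for c
      using assms(1) nn_integral_exp_mult_centred_normal[of v c] by (subst nn_integral_cmult) simp_all
    note E = this
    show ?thesis unfolding E[symmetric] by (rule nn_integral_add) simp_all
  qed
  also have "\<dots> < \<infinity>" by (simp add: ennreal_mult_less_top)
  finally show ?thesis .
qed

context gaussian_space
begin

lemma tendsto_cov_regress:
  assumes G: "\<And>n. Y n \<in> G" "\<And>n. e n \<in> G" "\<And>n. Z n \<in> G"
    and lim: "(\<lambda>n. cov (Y n) (e n) / cov (e n) (e n)) \<longlonglongrightarrow> c"
      "(\<lambda>n. cov (Y n) (Z n)) \<longlonglongrightarrow> p" "(\<lambda>n. cov (e n) (Z n)) \<longlonglongrightarrow> q"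
  shows "(\<lambda>n. cov (regress (Y n) (e n)) (Z n)) \<longlonglongrightarrow> p - c * q"
  unfolding cov_regress[OF G] by (intro tendsto_diff tendsto_mult lim)

text \<open>
  The core of the local limit theorem. \<open>X\<close> and \<open>Y\<close> stand for the values of the process at two
  times, \<open>D\<close> and \<open>D'\<close> for the two normalised increments. Gram-Schmidt is carried out in the order
  \<open>D, D', X, Y\<close>, so that all coefficients that involve increments tend to zero while the joint law of the
  values keeps its covariance. After the substitution of \<open>x + y / u\<close> for the values, the joint density
  converges to the product of the two normal densities of the increments and the density of the limiting
  pair at \<open>(x, x)\<close>, written as a marginal times a conditional density.
\<close>

lemma kernel_pair_limit:
  fixes X Y D D' :: "nat \<Rightarrow> 'a \<Rightarrow> real" and h k :: "real \<Rightarrow> real" and F F' :: "real \<times> real \<Rightarrow> ennreal"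
  assumes G: "\<And>n. X n \<in> G" "\<And>n. Y n \<in> G" "\<And>n. D n \<in> G" "\<And>n. D' n \<in> G"
    and XX: "(\<lambda>n. cov (X n) (X n)) \<longlonglongrightarrow> a" and YY: "(\<lambda>n. cov (Y n) (Y n)) \<longlonglongrightarrow> b"
    and YX: "(\<lambda>n. cov (Y n) (X n)) \<longlonglongrightarrow> \<rho>"
    and DD: "(\<lambda>n. cov (D n) (D n)) \<longlonglongrightarrow> s" and D'D': "(\<lambda>n. cov (D' n) (D' n)) \<longlonglongrightarrow> s"
    and D'D: "(\<lambda>n. cov (D' n) (D n)) \<longlonglongrightarrow> 0"
    and XD: "(\<lambda>n. cov (X n) (D n)) \<longlonglongrightarrow> 0" and XD': "(\<lambda>n. cov (X n) (D' n)) \<longlonglongrightarrow> 0"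
    and YD: "(\<lambda>n. cov (Y n) (D n)) \<longlonglongrightarrow> 0" and YD': "(\<lambda>n. cov (Y n) (D' n)) \<longlonglongrightarrow> 0"
    and pos: "s > 0" "a > 0" "a * b - \<rho>\<^sup>2 > 0"
    and u: "filterlim u at_top sequentially"
    and F[measurable]: "F \<in> borel_measurable (borel \<Otimes>\<^sub>M borel)" "F' \<in> borel_measurable (borel \<Otimes>\<^sub>M borel)"
    and hk[measurable]: "h \<in> borel_measurable borel" "k \<in> borel_measurable borel"
    and nonneg: "\<And>y. 0 \<le> h y" "\<And>z. 0 \<le> k z"
    and le: "\<And>y z. F (y, z) \<le> ennreal (h y * k z)" "\<And>y z. F' (y, z) \<le> ennreal (h y * k z)"
    and h: "(\<integral>\<^sup>+y. ennreal (h y) \<partial>lborel) < \<infinity>"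
    and k: "\<And>z. k z \<le> C * (exp z + exp (- z))"
  shows "(\<lambda>n. \<integral>\<^sup>+\<omega>. ennreal ((u n)\<^sup>2) * (F (u n * (X n \<omega> - x), D n \<omega>) * F' (u n * (Y n \<omega> - x), D' n \<omega>)) \<partial>M)
    \<longlonglongrightarrow> ennreal (normal_density 0 (sqrt a) x * normal_density 0 (sqrt (b - \<rho>\<^sup>2 / a)) (x - \<rho> / a * x))
      * kernel_mass s F * kernel_mass s F'"
proof -
  (* Gram-Schmidt: e1, e2, e3 are the successive residuals, the c are the regression coefficients. *)
  define e1 where "e1 n = regress (D' n) (D n)" for n
  define r2 where "r2 n = regress (X n) (D n)" for n
  define e2 where "e2 n = regress (r2 n) (e1 n)" for n
  define r3 where "r3 n = regress (Y n) (D n)" for n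
  define q3 where "q3 n = regress (r3 n) (e1 n)" for n
  define e3 where "e3 n = regress (q3 n) (e2 n)" for n
  define c10 where "c10 n = cov (D' n) (D n) / cov (D n) (D n)" for n
  define c20 where "c20 n = cov (X n) (D n) / cov (D n) (D n)" for n
  define c21 where "c21 n = cov (r2 n) (e1 n) / cov (e1 n) (e1 n)" for n
  define c30 where "c30 n = cov (Y n) (D n) / cov (D n) (D n)" for n
  define c31 where "c31 n = cov (r3 n) (e1 n) / cov (e1 n) (e1 n)" for n
  define c32 where "c32 n = cov (q3 n) (e2 n) / cov (e2 n) (e2 n)" for n
  note defs = c10_def c20_def c21_def c30_def c31_def c32_def
  define b' where "b' = b - \<rho>\<^sup>2 / a"
  have b': "b' > 0" using pos unfolding b'_def by (simp add: field_simps)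
  have inG: "e1 n \<in> G" "r2 n \<in> G" "e2 n \<in> G" "r3 n \<in> G" "q3 n \<in> G" "e3 n \<in> G" for n
    unfolding e1_def r2_def e2_def r3_def q3_def e3_def using G by (auto intro!: regress_in)
  have sw: "(\<lambda>n. cov (P n) (Q n)) \<longlonglongrightarrow> l \<Longrightarrow> (\<lambda>n. cov (Q n) (P n)) \<longlonglongrightarrow> l" for P Q l
    by (simp add: cov_sym)
  have s0: "s \<noteq> 0" and a0: "a \<noteq> 0" using pos by auto
  have d0: "c \<longlonglongrightarrow> 0 \<Longrightarrow> d \<longlonglongrightarrow> l \<Longrightarrow> l \<noteq> 0 \<Longrightarrow> (\<lambda>n. c n / d n) \<longlonglongrightarrow> 0" for c d :: "nat \<Rightarrow> real" and l
    using tendsto_divide[of c 0 sequentially d l] by simp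
  have c10: "c10 \<longlonglongrightarrow> 0" and c20: "c20 \<longlonglongrightarrow> 0" and c30: "c30 \<longlonglongrightarrow> 0"
    unfolding defs using d0[OF D'D DD s0] d0[OF XD DD s0] d0[OF YD DD s0] by auto
  (* Since its coefficient tends to zero, regression on an increment changes no limit of a covariance. *)
  have re1: "(\<lambda>n. cov (e1 n) (Z n)) \<longlonglongrightarrow> p" if "\<And>n. Z n \<in> G" "(\<lambda>n. cov (D' n) (Z n)) \<longlonglongrightarrow> p" "(\<lambda>n. cov (D n) (Z n)) \<longlonglongrightarrow> q" for Z p q
    using tendsto_cov_regress[OF G(4) G(3) that(1) c10[unfolded c10_def] that(2,3)] unfolding e1_def by simp
  have rr2: "(\<lambda>n. cov (r2 n) (Z n)) \<longlonglongrightarrow> p" if "\<And>n. Z n \<in> G" "(\<lambda>n. cov (X n) (Z n)) \<longlonglongrightarrow> p" "(\<lambda>n. cov (D n) (Z n)) \<longlonglongrightarrow> q" for Z p q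
    using tendsto_cov_regress[OF G(1) G(3) that(1) c20[unfolded c20_def] that(2,3)] unfolding r2_def by simp
  have rr3: "(\<lambda>n. cov (r3 n) (Z n)) \<longlonglongrightarrow> p" if "\<And>n. Z n \<in> G" "(\<lambda>n. cov (Y n) (Z n)) \<longlonglongrightarrow> p" "(\<lambda>n. cov (D n) (Z n)) \<longlonglongrightarrow> q" for Z p q
    using tendsto_cov_regress[OF G(2) G(3) that(1) c30[unfolded c30_def] that(2,3)] unfolding r3_def by simp
  have e1D: "(\<lambda>n. cov (e1 n) (D n)) \<longlonglongrightarrow> 0" by (rule re1[OF G(3) D'D DD])
  have e1D': "(\<lambda>n. cov (e1 n) (D' n)) \<longlonglongrightarrow> s" by (rule re1[OF G(4) D'D' sw[OF D'D]])
  have e1X: "(\<lambda>n. cov (e1 n) (X n)) \<longlonglongrightarrow> 0" by (rule re1[OF G(1) sw[OF XD'] sw[OF XD]])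
  have e1Y: "(\<lambda>n. cov (e1 n) (Y n)) \<longlonglongrightarrow> 0" by (rule re1[OF G(2) sw[OF YD'] sw[OF YD]])
  have v1: "(\<lambda>n. cov (e1 n) (e1 n)) \<longlonglongrightarrow> s" by (rule re1[OF inG(1) sw[OF e1D'] sw[OF e1D]])
  have r2e1: "(\<lambda>n. cov (r2 n) (e1 n)) \<longlonglongrightarrow> 0" by (rule rr2[OF inG(1) sw[OF e1X] sw[OF e1D]])
  have r3e1: "(\<lambda>n. cov (r3 n) (e1 n)) \<longlonglongrightarrow> 0" by (rule rr3[OF inG(1) sw[OF e1Y] sw[OF e1D]])
  have c21: "c21 \<longlonglongrightarrow> 0" and c31: "c31 \<longlonglongrightarrow> 0"
    unfolding defs using d0[OF r2e1 v1 s0] d0[OF r3e1 v1 s0] by auto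
  have re2: "(\<lambda>n. cov (e2 n) (Z n)) \<longlonglongrightarrow> p" if "\<And>n. Z n \<in> G" "(\<lambda>n. cov (r2 n) (Z n)) \<longlonglongrightarrow> p" "(\<lambda>n. cov (e1 n) (Z n)) \<longlonglongrightarrow> q" for Z p q
    using tendsto_cov_regress[OF inG(2) inG(1) that(1) c21[unfolded c21_def] that(2,3)] unfolding e2_def by simp
  have rq3: "(\<lambda>n. cov (q3 n) (Z n)) \<longlonglongrightarrow> p" if "\<And>n. Z n \<in> G" "(\<lambda>n. cov (r3 n) (Z n)) \<longlonglongrightarrow> p" "(\<lambda>n. cov (e1 n) (Z n)) \<longlonglongrightarrow> q" for Z p q
    using tendsto_cov_regress[OF inG(4) inG(1) that(1) c31[unfolded c31_def] that(2,3)] unfolding q3_def by simp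
  have r2D: "(\<lambda>n. cov (r2 n) (D n)) \<longlonglongrightarrow> 0" by (rule rr2[OF G(3) XD DD])
  have r2X: "(\<lambda>n. cov (r2 n) (X n)) \<longlonglongrightarrow> a" by (rule rr2[OF G(1) XX sw[OF XD]])
  have r2Y: "(\<lambda>n. cov (r2 n) (Y n)) \<longlonglongrightarrow> \<rho>" by (rule rr2[OF G(2) sw[OF YX] sw[OF YD]])
  have e2D: "(\<lambda>n. cov (e2 n) (D n)) \<longlonglongrightarrow> 0" by (rule re2[OF G(3) r2D e1D])
  have e2X: "(\<lambda>n. cov (e2 n) (X n)) \<longlonglongrightarrow> a" by (rule re2[OF G(1) r2X e1X])
  have e2Y: "(\<lambda>n. cov (e2 n) (Y n)) \<longlonglongrightarrow> \<rho>" by (rule re2[OF G(2) r2Y e1Y])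
  have e2e1: "(\<lambda>n. cov (e2 n) (e1 n)) \<longlonglongrightarrow> 0" by (rule re2[OF inG(1) r2e1 v1])
  have r2e2: "(\<lambda>n. cov (r2 n) (e2 n)) \<longlonglongrightarrow> a" by (rule rr2[OF inG(3) sw[OF e2X] sw[OF e2D]])
  have v2: "(\<lambda>n. cov (e2 n) (e2 n)) \<longlonglongrightarrow> a" by (rule re2[OF inG(3) r2e2 sw[OF e2e1]])
  have r3D: "(\<lambda>n. cov (r3 n) (D n)) \<longlonglongrightarrow> 0" by (rule rr3[OF G(3) YD DD])
  have r3Y: "(\<lambda>n. cov (r3 n) (Y n)) \<longlonglongrightarrow> b" by (rule rr3[OF G(2) YY sw[OF YD]])
  have r3e2: "(\<lambda>n. cov (r3 n) (e2 n)) \<longlonglongrightarrow> \<rho>" by (rule rr3[OF inG(3) sw[OF e2Y] sw[OF e2D]])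
  have q3D: "(\<lambda>n. cov (q3 n) (D n)) \<longlonglongrightarrow> 0" by (rule rq3[OF G(3) r3D e1D])
  have q3Y: "(\<lambda>n. cov (q3 n) (Y n)) \<longlonglongrightarrow> b" by (rule rq3[OF G(2) r3Y e1Y])
  have q3e1: "(\<lambda>n. cov (q3 n) (e1 n)) \<longlonglongrightarrow> 0" by (rule rq3[OF inG(1) r3e1 v1])
  have q3e2: "(\<lambda>n. cov (q3 n) (e2 n)) \<longlonglongrightarrow> \<rho>" by (rule rq3[OF inG(3) r3e2 sw[OF e2e1]])
  have r3q3: "(\<lambda>n. cov (r3 n) (q3 n)) \<longlonglongrightarrow> b" by (rule rr3[OF inG(5) sw[OF q3Y] sw[OF q3D]])
  have q3q3: "(\<lambda>n. cov (q3 n) (q3 n)) \<longlonglongrightarrow> b" by (rule rq3[OF inG(5) r3q3 sw[OF q3e1]])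
  (* Only regression of Y on the residual of X may keep a nonzero coefficient in the limit. *)
  have c32: "c32 \<longlonglongrightarrow> \<rho> / a" unfolding defs by (rule tendsto_divide[OF q3e2 v2 a0])
  have e3q3: "(\<lambda>n. cov (e3 n) (q3 n)) \<longlonglongrightarrow> b - \<rho> / a * \<rho>"
    unfolding e3_def by (rule tendsto_cov_regress[OF inG(5) inG(3) inG(5) c32[unfolded c32_def] q3q3 sw[OF q3e2]])
  have e3e2: "(\<lambda>n. cov (e3 n) (e2 n)) \<longlonglongrightarrow> \<rho> - \<rho> / a * a"
    unfolding e3_def by (rule tendsto_cov_regress[OF inG(5) inG(3) inG(3) c32[unfolded c32_def] q3e2 v2])
  have v3: "(\<lambda>n. cov (e3 n) (e3 n)) \<longlonglongrightarrow> b'"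
    using tendsto_cov_regress[OF inG(5) inG(3) inG(6) c32[unfolded c32_def] sw[OF e3q3] sw[OF e3e2]]
    unfolding e3_def[symmetric] b'_def using a0 by (simp add: power2_eq_square)
  let ?T = "\<lambda>n. triangular_density (cov (D n) (D n)) (cov (e1 n) (e1 n)) (cov (e2 n) (e2 n)) (cov (e3 n) (e3 n))
    (c10 n) (c20 n) (c21 n) (c30 n) (c31 n) (c32 n)"
  let ?n4 = "normal_density 0 (sqrt (4 * s))"
  let ?ns = "normal_density 0 (sqrt s)"
  let ?\<kappa> = "normal_density 0 (sqrt a) x * normal_density 0 (sqrt b') (x - \<rho> / a * x)"
  define g where "g n z w y y' = F (y, z) * F' (y', w) * ennreal (?T n z w (x + y / u n) (x + y' / u n))" for n z w y y'
  define B where "B = 8 / (sqrt (pi * a) * sqrt (pi * b'))"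
  have B: "B \<ge> 0" unfolding B_def using pos b' by simp
  (* From some index on all residual variances are within a factor two of their positive limits,
     which yields the orthogonal representation and a dominating function free of n. *)
  have ev: "\<forall>\<^sub>F n in sequentially. u n > 0 \<and> s / 2 < cov (D n) (D n) \<and> cov (D n) (D n) < 2 * s
     \<and> s / 2 < cov (e1 n) (e1 n) \<and> cov (e1 n) (e1 n) < 2 * s \<and> a / 2 < cov (e2 n) (e2 n) \<and> b' / 2 < cov (e3 n) (e3 n)
     \<and> (c10 n)\<^sup>2 < 1 / 2"
  proof (intro eventually_conj)
    show "\<forall>\<^sub>F n in sequentially. u n > 0" using u by (simp add: filterlim_at_top_dense)
    show "\<forall>\<^sub>F n in sequentially. (c10 n)\<^sup>2 < 1 / 2"
      using tendsto_power[OF c10, of 2] by (intro order_tendstoD(2)[of _ 0]) auto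
  qed (rule order_tendstoD(1)[OF DD] order_tendstoD(2)[OF DD] order_tendstoD(1)[OF v1] order_tendstoD(2)[OF v1]
      order_tendstoD(1)[OF v2] order_tendstoD(1)[OF v3]; use pos b' in simp)+
  then obtain N where N: "\<And>n. n \<ge> N \<Longrightarrow> u n > 0 \<and> s / 2 < cov (D n) (D n) \<and> cov (D n) (D n) < 2 * s
     \<and> s / 2 < cov (e1 n) (e1 n) \<and> cov (e1 n) (e1 n) < 2 * s \<and> a / 2 < cov (e2 n) (e2 n) \<and> b' / 2 < cov (e3 n) (e3 n)
     \<and> (c10 n)\<^sup>2 < 1 / 2"
    unfolding eventually_sequentially by blast
  let ?L4 = "lborel \<Otimes>\<^sub>M lborel \<Otimes>\<^sub>M lborel \<Otimes>\<^sub>M (lborel :: real measure)"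
  have T_meas[measurable]: "(\<lambda>p. ?T n (f1 p) (f2 p) (f3 p) (f4 p)) \<in> borel_measurable L"
    if [measurable]: "f1 \<in> borel_measurable L" "f2 \<in> borel_measurable L" "f3 \<in> borel_measurable L" "f4 \<in> borel_measurable L"
    for n f1 f2 f3 f4 and L :: "(real \<times> real \<times> real \<times> real) measure"
    unfolding triangular_density_def by measurable
  have g_meas: "(\<lambda>(z, w, y, y'). g n z w y y') \<in> borel_measurable ?L4" for n
    unfolding g_def case_prod_beta by measurable
  have E: "(\<integral>\<^sup>+\<omega>. ennreal ((u n)\<^sup>2) * (F (u n * (X n \<omega> - x), D n \<omega>) * F' (u n * (Y n \<omega> - x), D' n \<omega>)) \<partial>M)
    = (\<integral>\<^sup>+(z, w, y, y'). g n z w y y' \<partial>?L4)" if n: "n \<ge> N" for n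
  proof -
    note Nn = N[OF n]
    have vp: "cov (D n) (D n) > 0" "cov (e1 n) (e1 n) > 0" "cov (e2 n) (e2 n) > 0" "cov (e3 n) (e3 n) > 0" and un: "u n > 0"
      using Nn pos b' by linarith+
    have o1: "cov (e1 n) (D n) = 0" unfolding e1_def using G vp by (intro cov_regress_orth) auto
    have o2: "cov (r2 n) (D n) = 0" "cov (r3 n) (D n) = 0" unfolding r2_def r3_def using G vp by (auto intro!: cov_regress_orth)
    have o3: "cov (e2 n) (e1 n) = 0" "cov (q3 n) (e1 n) = 0" unfolding e2_def q3_def using inG vp by (auto intro!: cov_regress_orth)
    have o4: "cov (e2 n) (D n) = 0" "cov (q3 n) (D n) = 0" unfolding e2_def q3_def using inG G by (simp_all add: cov_regress o1 o2)
    have o5: "cov (e3 n) (e2 n) = 0" unfolding e3_def using inG vp by (intro cov_regress_orth) auto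
    have o6: "cov (e3 n) (e1 n) = 0" "cov (e3 n) (D n) = 0" unfolding e3_def using inG G by (simp_all add: cov_regress o3 o4)
    have orth: "cov (D n) (e1 n) = 0" "cov (D n) (e2 n) = 0" "cov (D n) (e3 n) = 0" "cov (e1 n) (e2 n) = 0"
      "cov (e1 n) (e3 n) = 0" "cov (e2 n) (e3 n) = 0"
      using o1 o3 o4 o5 o6 by (simp_all add: cov_sym[of "D n"] cov_sym[of "e1 n" "e2 n"] cov_sym[of "e1 n" "e3 n"] cov_sym[of "e2 n" "e3 n"])
    have rep: "D' n \<omega> = e1 n \<omega> + c10 n * D n \<omega>" "X n \<omega> = e2 n \<omega> + (c21 n * e1 n \<omega> + c20 n * D n \<omega>)"
      "Y n \<omega> = e3 n \<omega> + (c32 n * e2 n \<omega> + c31 n * e1 n \<omega> + c30 n * D n \<omega>)" for \<omega>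
      using regress_eq[of "D' n" \<omega> "D n"] regress_eq[of "X n" \<omega> "D n"] regress_eq[of "r2 n" \<omega> "e1 n"]
        regress_eq[of "Y n" \<omega> "D n"] regress_eq[of "r3 n" \<omega> "e1 n"] regress_eq[of "q3 n" \<omega> "e2 n"]
      unfolding e1_def r2_def e2_def r3_def q3_def e3_def defs by simp_all
    let ?\<Phi> = "\<lambda>z w x1 x2. ennreal ((u n)\<^sup>2) * (F (u n * (x1 - x), z) * F' (u n * (x2 - x), w))"
    have \<Phi>: "(\<lambda>(z, w, x1, x2). ?\<Phi> z w x1 x2) \<in> borel_measurable (borel \<Otimes>\<^sub>M borel \<Otimes>\<^sub>M borel \<Otimes>\<^sub>M borel)"
      unfolding case_prod_beta by measurable
    have "(\<integral>\<^sup>+\<omega>. ennreal ((u n)\<^sup>2) * (F (u n * (X n \<omega> - x), D n \<omega>) * F' (u n * (Y n \<omega> - x), D' n \<omega>)) \<partial>M)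
      = (\<integral>\<^sup>+\<omega>. ?\<Phi> (D n \<omega>) (e1 n \<omega> + c10 n * D n \<omega>) (e2 n \<omega> + (c21 n * e1 n \<omega> + c20 n * D n \<omega>))
          (e3 n \<omega> + (c32 n * e2 n \<omega> + c31 n * e1 n \<omega> + c30 n * D n \<omega>)) \<partial>M)"
      by (simp only: rep)
    also have "\<dots> = (\<integral>\<^sup>+z. \<integral>\<^sup>+w. \<integral>\<^sup>+x1. \<integral>\<^sup>+x2. ?\<Phi> z w x1 x2 * ennreal (?T n z w x1 x2) \<partial>lborel \<partial>lborel \<partial>lborel \<partial>lborel)"
      by (rule triangular_nn_integral[OF \<Phi> G(3) inG(1,3,6) orth vp])
    also have "\<dots> = (\<integral>\<^sup>+z. \<integral>\<^sup>+w. \<integral>\<^sup>+y. \<integral>\<^sup>+y'. g n z w y y' \<partial>lborel \<partial>lborel \<partial>lborel \<partial>lborel)"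
    proof (rule nn_integral_cong, rule nn_integral_cong)
      fix z w :: real
      let ?g = "\<lambda>x1 x2. F (u n * (x1 - x), z) * F' (u n * (x2 - x), w) * ennreal (?T n z w x1 x2)"
      have gm: "(\<lambda>(a, b). ?g a b) \<in> borel_measurable (borel \<Otimes>\<^sub>M borel)"
        unfolding case_prod_beta triangular_density_def by measurable
      have "(\<integral>\<^sup>+x1. \<integral>\<^sup>+x2. ?\<Phi> z w x1 x2 * ennreal (?T n z w x1 x2) \<partial>lborel \<partial>lborel)
        = (\<integral>\<^sup>+x1. \<integral>\<^sup>+x2. ennreal ((u n)\<^sup>2) * ?g x1 x2 \<partial>lborel \<partial>lborel)"
        by (simp only: mult.assoc)
      also have "\<dots> = (\<integral>\<^sup>+y. \<integral>\<^sup>+y'. ?g (x + y / u n) (x + y' / u n) \<partial>lborel \<partial>lborel)"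
        by (rule nn_integral_affine2[OF gm un])
      also have "\<dots> = (\<integral>\<^sup>+y. \<integral>\<^sup>+y'. g n z w y y' \<partial>lborel \<partial>lborel)"
      proof -
        have "u n * (x + y / u n - x) = y" for y using un by simp
        then show ?thesis unfolding g_def by (simp only:)
      qed
      finally show "(\<integral>\<^sup>+x1. \<integral>\<^sup>+x2. ?\<Phi> z w x1 x2 * ennreal (?T n z w x1 x2) \<partial>lborel \<partial>lborel)
        = (\<integral>\<^sup>+y. \<integral>\<^sup>+y'. g n z w y y' \<partial>lborel \<partial>lborel)" .
    qed
    also have "\<dots> = (\<integral>\<^sup>+(z, w, y, y'). g n z w y y' \<partial>?L4)"
      by (rule nn_integral_lborel4[OF g_meas])
    finally show ?thesis .
  qed
  define gl where "gl z w y y' = F (y, z) * F' (y', w) * ennreal (?ns z * ?ns w * ?\<kappa>)" for z w y y'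
  define W where "W z w y y' = (ennreal B * (ennreal (k z) * ennreal (?n4 z))) * ((ennreal (k w) * ennreal (?n4 w)) * (ennreal (h y) * ennreal (h y')))" for z w y y'
  have gl_meas: "(\<lambda>(z, w, y, y'). gl z w y y') \<in> borel_measurable ?L4"
    unfolding gl_def case_prod_beta by measurable
  have W_meas: "(\<lambda>(z, w, y, y'). W z w y y') \<in> borel_measurable ?L4"
    unfolding W_def case_prod_beta by measurable
  have Ffin: "F (y, z) < top" "F' (y, z) < top" for y z
    using le[of y z] by (auto intro: le_less_trans)
  have gW: "g n z w y y' \<le> W z w y y'" if n: "n \<ge> N" for n z w y y'
  proof -
    have T: "?T n z w x1 x2 \<le> B * (?n4 z * ?n4 w)" for x1 x2
      unfolding B_def using N[OF n] pos b' by (intro triangular_density_le) auto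
    have "g n z w y y' \<le> ennreal (h y * k z) * ennreal (h y' * k w) * ennreal (B * (?n4 z * ?n4 w))"
      unfolding g_def by (intro mult_mono le ennreal_leI T) auto
    also have "\<dots> = W z w y y'"
      unfolding W_def using B nonneg by (simp add: ennreal_mult mult_ac)
    finally show ?thesis .
  qed
  have W_fin: "(\<integral>\<^sup>+(z, w, y, y'). W z w y y' \<partial>?L4) < \<infinity>"
  proof -
    let ?K = "\<integral>\<^sup>+z. ennreal (k z) * ennreal (?n4 z) \<partial>lborel" and ?H = "\<integral>\<^sup>+y. ennreal (h y) \<partial>lborel"
    have K: "?K < \<infinity>" using pos by (intro nn_integral_normal_exp_growth[OF _ hk(2) k]) simp
    have "(\<integral>\<^sup>+(z, w, y, y'). W z w y y' \<partial>?L4) = (\<integral>\<^sup>+z. \<integral>\<^sup>+w. \<integral>\<^sup>+y. \<integral>\<^sup>+y'. W z w y y' \<partial>lborel \<partial>lborel \<partial>lborel \<partial>lborel)"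
      by (rule nn_integral_lborel4[OF W_meas, symmetric])
    also have "\<dots> = (ennreal B * ?K) * (?K * (?H * ?H))"
      unfolding W_def by (simp add: nn_integral_cmult nn_integral_multc)
    also have "\<dots> < \<infinity>" using K h by (simp add: ennreal_mult_less_top)
    finally show ?thesis .
  qed
  have uinv: "(\<lambda>n. x + y / u n) \<longlonglongrightarrow> x" for y
  proof -
    have "(\<lambda>n. y / u n) \<longlonglongrightarrow> 0"
      by (rule real_tendsto_divide_at_top[OF tendsto_const u])
    from tendsto_add[OF tendsto_const[of x] this] show ?thesis by simp
  qed
  have Tlim: "(\<lambda>n. ?T n z w (x + y / u n) (x + y' / u n)) \<longlonglongrightarrow> ?ns z * ?ns w * ?\<kappa>" for z w y y'
  proof -
    have l1: "(\<lambda>n. w - c10 n * z) \<longlonglongrightarrow> w - 0 * z"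
      by (intro tendsto_intros c10)
    have l2: "(\<lambda>n. (x + y / u n) - (c21 n * (w - c10 n * z) + c20 n * z)) \<longlonglongrightarrow> x - (0 * (w - 0 * z) + 0 * z)"
      by (intro tendsto_diff tendsto_add tendsto_mult uinv c21 c20 l1 tendsto_const)
    have l3: "(\<lambda>n. (x + y' / u n) - (c32 n * ((x + y / u n) - (c21 n * (w - c10 n * z) + c20 n * z)) + c31 n * (w - c10 n * z) + c30 n * z))
       \<longlonglongrightarrow> x - (\<rho> / a * (x - (0 * (w - 0 * z) + 0 * z)) + 0 * (w - 0 * z) + 0 * z)"
      by (intro tendsto_diff[of _ x] tendsto_add[of _ _ _ _ "0 * z"] tendsto_add tendsto_mult uinv c32 c31 c30 l2 l1 tendsto_const)
    have "(\<lambda>n. ?T n z w (x + y / u n) (x + y' / u n)) \<longlonglongrightarrow> ?ns z * ?ns (w - 0 * z)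
       * normal_density 0 (sqrt a) (x - (0 * (w - 0 * z) + 0 * z))
       * normal_density 0 (sqrt b') (x - (\<rho> / a * (x - (0 * (w - 0 * z) + 0 * z)) + 0 * (w - 0 * z) + 0 * z))"
      unfolding triangular_density_def
      by (intro tendsto_mult normal_density_tendsto DD v1 v2 v3 l1 l2 l3 tendsto_const pos b')
    then show ?thesis by (simp add: mult.assoc)
  qed
  have "(\<lambda>n. \<integral>\<^sup>+(z, w, y, y'). g (n + N) z w y y' \<partial>?L4) \<longlonglongrightarrow> (\<integral>\<^sup>+(z, w, y, y'). gl z w y y' \<partial>?L4)"
  proof (rule nn_integral_dominated_convergence[where w="\<lambda>(z, w, y, y'). W z w y y'"])
    show "AE p in ?L4. (\<lambda>n. case p of (z, w, y, y') \<Rightarrow> g (n + N) z w y y') \<longlonglongrightarrow> (case p of (z, w, y, y') \<Rightarrow> gl z w y y')"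
    proof (rule AE_I2)
      fix p :: "real \<times> real \<times> real \<times> real"
      obtain z w y y' where p: "p = (z, w, y, y')" by (cases p)
      have "(\<lambda>n. g n z w y y') \<longlonglongrightarrow> gl z w y y'"
        unfolding g_def gl_def
        by (rule ennreal_tendsto_cmult[OF _ tendsto_ennrealI[OF Tlim]]) (simp add: ennreal_mult_less_top Ffin)
      then show "(\<lambda>n. case p of (z, w, y, y') \<Rightarrow> g (n + N) z w y y') \<longlonglongrightarrow> (case p of (z, w, y, y') \<Rightarrow> gl z w y y')"
        unfolding p prod.case by (rule LIMSEQ_ignore_initial_segment)
    qed
    show "AE p in ?L4. (case p of (z, w, y, y') \<Rightarrow> g (j + N) z w y y') \<le> (case p of (z, w, y, y') \<Rightarrow> W z w y y')" for j
      by (rule AE_I2) (auto intro!: gW split: prod.split)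
  qed (use g_meas gl_meas W_meas W_fin in auto)
  then have "(\<lambda>n. \<integral>\<^sup>+\<omega>. ennreal ((u (n + N))\<^sup>2) * (F (u (n + N) * (X (n + N) \<omega> - x), D (n + N) \<omega>) * F' (u (n + N) * (Y (n + N) \<omega> - x), D' (n + N) \<omega>)) \<partial>M)
    \<longlonglongrightarrow> (\<integral>\<^sup>+(z, w, y, y'). gl z w y y' \<partial>?L4)"
    by (simp only: E le_add2)
  then have "(\<lambda>n. \<integral>\<^sup>+\<omega>. ennreal ((u n)\<^sup>2) * (F (u n * (X n \<omega> - x), D n \<omega>) * F' (u n * (Y n \<omega> - x), D' n \<omega>)) \<partial>M)
    \<longlonglongrightarrow> (\<integral>\<^sup>+(z, w, y, y'). gl z w y y' \<partial>?L4)"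
    by (rule LIMSEQ_offset)
  also have "(\<integral>\<^sup>+(z, w, y, y'). gl z w y y' \<partial>?L4) = (\<integral>\<^sup>+z. \<integral>\<^sup>+w. \<integral>\<^sup>+y. \<integral>\<^sup>+y'. gl z w y y' \<partial>lborel \<partial>lborel \<partial>lborel \<partial>lborel)"
    by (rule nn_integral_lborel4[OF gl_meas, symmetric])
  also have "\<dots> = (\<integral>\<^sup>+z. \<integral>\<^sup>+w. \<integral>\<^sup>+y. \<integral>\<^sup>+y'. (ennreal ?\<kappa> * (F (y, z) * ennreal (?ns z))) * (F' (y', w) * ennreal (?ns w)) \<partial>lborel \<partial>lborel \<partial>lborel \<partial>lborel)"
    unfolding gl_def by (simp add: ennreal_mult mult_ac)
  also have "\<dots> = ennreal ?\<kappa> * kernel_mass s F * kernel_mass s F'"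
    unfolding kernel_mass_def by (simp add: nn_integral_cmult nn_integral_multc)
  finally show ?thesis unfolding b'_def .
qed

end

section \<open>Powers\<close>

text \<open>
  For fixed \<open>x\<close> the increment \<open>(x + y) powr H - y powr H\<close> decreases in \<open>y\<close> by concavity, so the
  worst case is \<open>y = x\<close>.
\<close>

lemma powr_increment_le:
  fixes x y H :: real
  assumes "0 < x" "x \<le> y" "0 < H" "H < 1"
  shows "(x + y) powr H - y powr H \<le> (2 powr H - 1) * x powr H"
proof -
  have "(x + y) powr H - y powr H \<le> (x + x) powr H - x powr H"
  proof (rule DERIV_nonpos_imp_nonincreasing[OF assms(2)])
    fix z assume z: "x \<le> z" "z \<le> y"
    have "((\<lambda>z. (x + z) powr H - z powr H) has_real_derivative (H * (x + z) powr (H - 1) - H * z powr (H - 1))) (at z)"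
      using z assms by (auto intro!: derivative_eq_intros)
    moreover have "(x + z) powr (H - 1) \<le> z powr (H - 1)"
      using z assms by (intro powr_mono2') auto
    ultimately show "\<exists>y. ((\<lambda>z. (x + z) powr H - z powr H) has_real_derivative y) (at z) \<and> y \<le> 0"
      using assms by (intro exI[of _ "H * (x + z) powr (H - 1) - H * z powr (H - 1)"]) auto
  qed
  also have "x + x = 2 * x" by simp
  also have "(2 * x) powr H - x powr H = (2 powr H - 1) * x powr H"
    using assms by (simp add: powr_mult algebra_simps)
  finally show ?thesis .
qed

text \<open>
  Subadditivity with a gain proportional to the smaller of the two powers. The gain is what
  makes the determinant of the covariance matrix of fractional Brownian motion nondegenerate.
\<close>

lemma powr_subadditive_strict:
  fixes x y H :: real
  assumes "0 < x" "0 < y" "0 < H" "H < 1"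
  shows "(2 - 2 powr H) * min (x powr H) (y powr H) \<le> x powr H + y powr H - (x + y) powr H"
proof -
  have *: "(2 - 2 powr H) * min (x powr H) (y powr H) \<le> x powr H + y powr H - (x + y) powr H"
    if "0 < x" "x \<le> y" for x y :: real
  proof -
    have "min (x powr H) (y powr H) = x powr H"
      using that assms by (simp add: min_absorb1 powr_mono2)
    then show ?thesis using powr_increment_le[OF that assms(3,4)] by (simp add: algebra_simps)
  qed
  show ?thesis
  proof (cases "x \<le> y")
    case True then show ?thesis using * assms by simp
  next
    case False
    then show ?thesis using *[of y x] assms by (simp add: min.commute add.commute)
  qed
qed

lemma two_powr_less: "H < 1 \<Longrightarrow> 2 powr H < (2::real)"
  using powr_less_mono[of H 1 2] by simp

lemma powr_subadditive:
  fixes x y H :: real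
  assumes "0 \<le> x" "0 \<le> y" "0 < H" "H \<le> 1"
  shows "(x + y) powr H \<le> x powr H + y powr H"
proof (cases "x = 0 \<or> y = 0 \<or> H = 1")
  case True then show ?thesis using assms by auto
next
  case False
  then have p: "0 < x" "0 < y" "H < 1" using assms by auto
  have "0 \<le> (2 - 2 powr H) * min (x powr H) (y powr H)"
    using two_powr_less[OF p(3)] by (intro mult_nonneg_nonneg) auto
  then show ?thesis using powr_subadditive_strict[OF p(1,2) assms(3) p(3)] by linarith
qed

text \<open>
  For \<open>p \<le> 1\<close> the power is Hoelder continuous and the first summand suffices; for \<open>p > 1\<close> the
  mean value theorem gives the second. The sum spares later case distinctions in \<open>H\<close>.
\<close>

lemma powr_diff_bound:
  fixes a b p M \<delta> :: real
  assumes p: "0 < p" and ab: "0 \<le> a" "a \<le> M" "0 \<le> b" "b \<le> M" and d: "\<bar>a - b\<bar> \<le> \<delta>"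
  shows "\<bar>a powr p - b powr p\<bar> \<le> \<delta> powr p + p * M powr (p - 1) * \<delta>"
proof -
  have *: "b powr p - a powr p \<le> \<delta> powr p + p * M powr (p - 1) * \<delta>"
    if "0 \<le> a" "a \<le> b" "b \<le> M" "b - a \<le> \<delta>" for a b
  proof (cases "p \<le> 1")
    case True
    have "(a + (b - a)) powr p \<le> a powr p + (b - a) powr p"
      using that p True by (intro powr_subadditive) auto
    moreover have "(b - a) powr p \<le> \<delta> powr p" using that p by (intro powr_mono2) auto
    moreover have "0 \<le> p * M powr (p - 1) * \<delta>" using that p by (intro mult_nonneg_nonneg) auto
    ultimately show ?thesis by simp
  next
    case False
    show ?thesis
    proof (cases "a = b")
      case True then show ?thesis using that p by (auto intro!: add_nonneg_nonneg mult_nonneg_nonneg)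
    next
      case ne: False
      then have "a < b" using that by simp
      have der: "((\<lambda>x. x powr p) has_real_derivative p * x powr (p - 1)) (at x)" if "a < x" for x
        using that \<open>0 \<le> a\<close> by (auto intro!: derivative_eq_intros)
      have "continuous_on {a..b} (\<lambda>x. x powr p)"
        using \<open>0 \<le> a\<close> p by (intro continuous_on_powr' continuous_intros) auto
      from MVT[OF \<open>a < b\<close> this] obtain l z where lz: "a < z" "z < b"
          "((\<lambda>x. x powr p) has_real_derivative l) (at z)" "b powr p - a powr p = (b - a) * l"
        using der real_differentiable_def by blast
      have "l = p * z powr (p - 1)" by (rule DERIV_unique[OF lz(3) der[OF lz(1)]])
      with lz have z: "a < z" "z < b" "b powr p - a powr p = (b - a) * (p * z powr (p - 1))" by auto
      have "(b - a) * (p * z powr (p - 1)) \<le> \<delta> * (p * M powr (p - 1))"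
        using z that p False by (intro mult_mono mult_left_mono powr_mono2) auto
      then have "b powr p - a powr p \<le> p * M powr (p - 1) * \<delta>" using z(3) by (simp add: mult_ac)
      then show ?thesis using powr_ge_zero[of \<delta> p] by linarith
    qed
  qed
  show ?thesis
  proof (cases "a \<le> b")
    case True
    then have "a powr p \<le> b powr p" "b - a \<le> \<delta>" using ab d p by (auto intro: powr_mono2)
    then show ?thesis using *[of a b] True ab by linarith
  next
    case False
    then have "b powr p \<le> a powr p" "a - b \<le> \<delta>" using ab d p by (auto intro: powr_mono2)
    then show ?thesis using *[of b a] False ab by linarith
  qed
qed

lemma abs_shift_powr:
  fixes d \<delta> q :: real
  assumes "0 \<le> \<delta>" "\<delta> \<le> \<bar>d\<bar>"
  shows "\<bar>d + \<delta>\<bar> powr q + \<bar>d - \<delta>\<bar> powr q = (\<bar>d\<bar> + \<delta>) powr q + (\<bar>d\<bar> - \<delta>) powr q"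
proof (cases "0 \<le> d")
  case True
  then show ?thesis using assms by simp
next
  case False
  then have "\<bar>d + \<delta>\<bar> = \<bar>d\<bar> - \<delta>" "\<bar>d - \<delta>\<bar> = \<bar>d\<bar> + \<delta>" using assms by auto
  then show ?thesis by simp
qed

text \<open>
  A second difference is of second order in the step: apply the mean value theorem to
  \<open>powr p\<close> on both sides of \<open>d\<close> and then to its derivative. Distance \<open>m\<close> from the origin keeps the second
  derivative bounded.
\<close>

lemma powr_second_difference_bound:
  fixes d \<delta> m p :: real
  assumes "0 < \<delta>" "\<delta> \<le> m / 2" "m \<le> d" "0 < p" "p < 2"
  shows "\<bar>(d + \<delta>) powr p + (d - \<delta>) powr p - 2 * d powr p\<bar> \<le> 2 * p * (m / 2) powr (p - 2) * \<delta>\<^sup>2"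
proof -
  have m: "0 < m" using assms by simp
  have der: "((\<lambda>x. x powr q) has_real_derivative q * x powr (q - 1)) (at x)" if "x > 0" for x q :: real
    using that by (auto intro!: derivative_eq_intros)
  obtain z1 where z1: "d < z1" "z1 < d + \<delta>" "(d + \<delta>) powr p - d powr p = (d + \<delta> - d) * (p * z1 powr (p - 1))"
    using MVT2[of d "d + \<delta>" "\<lambda>x. x powr p" "\<lambda>z. p * z powr (p - 1)"] der assms m by auto
  obtain z2 where z2: "d - \<delta> < z2" "z2 < d" "d powr p - (d - \<delta>) powr p = (d - (d - \<delta>)) * (p * z2 powr (p - 1))"
    using MVT2[of "d - \<delta>" d "\<lambda>x. x powr p" "\<lambda>z. p * z powr (p - 1)"] der assms m by auto
  have z2pos: "m / 2 \<le> z2" using z2 assms by linarith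
  obtain z3 where z3: "z2 < z3" "z3 < z1" "z1 powr (p - 1) - z2 powr (p - 1) = (z1 - z2) * ((p - 1) * z3 powr (p - 1 - 1))"
    using MVT2[of z2 z1 "\<lambda>x. x powr (p - 1)" "\<lambda>z. (p - 1) * z powr (p - 1 - 1)"] der[of _ "p - 1"] z1 z2 z2pos m by auto
  have "z3 powr (p - 2) \<le> (m / 2) powr (p - 2)"
    using z3 z2pos m assms by (intro powr_mono2') auto
  moreover have "\<bar>p - 1\<bar> \<le> 1" using assms by linarith
  moreover have "\<bar>z1 - z2\<bar> \<le> 2 * \<delta>" using z1 z2 by linarith
  ultimately have "\<bar>z1 - z2\<bar> * (\<bar>p - 1\<bar> * z3 powr (p - 2)) \<le> (2 * \<delta>) * (1 * (m / 2) powr (p - 2))"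
    using assms by (intro mult_mono) auto
  then have b: "\<bar>z1 powr (p - 1) - z2 powr (p - 1)\<bar> \<le> 2 * \<delta> * (m / 2) powr (p - 2)"
    using z3(3) by (simp add: abs_mult)
  have "(d + \<delta>) powr p + (d - \<delta>) powr p - 2 * d powr p = \<delta> * p * (z1 powr (p - 1) - z2 powr (p - 1))"
    using z1(3) z2(3) by (simp add: algebra_simps)
  then have "\<bar>(d + \<delta>) powr p + (d - \<delta>) powr p - 2 * d powr p\<bar> = \<delta> * p * \<bar>z1 powr (p - 1) - z2 powr (p - 1)\<bar>"
    using assms by (simp add: abs_mult)
  also have "\<dots> \<le> \<delta> * p * (2 * \<delta> * (m / 2) powr (p - 2))"
    using b assms by (intro mult_left_mono) auto
  finally show ?thesis by (simp add: power2_eq_square mult_ac)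
qed

text \<open>
  Put \<open>a = s powr H\<close>, \<open>b = t powr H\<close>, \<open>c = (t - s) powr H\<close>. Four times the right-hand side is
  \<open>(c\<^sup>2 - (b - a)\<^sup>2) * ((a + b)\<^sup>2 - c\<^sup>2)\<close>, sixteen times the squared area of a triangle with sides
  \<open>a, b, c\<close> by Heron's formula. The first factor is at least \<open>(2 - 2 powr H) * min a c * c\<close> by strict
  subadditivity of \<open>powr H\<close>, the second at least \<open>2 * a * b\<close> since \<open>c \<le> b\<close>. This is the quantitative form of
  local nondeterminism that the domination argument rests on.
\<close>

lemma fbm_determinant_bound:
  fixes s t H :: real
  assumes "0 < s" "s < t" "0 < H" "H < 1"
  shows "(2 - 2 powr H) / 2 * (s powr (2 * H) * (t - s) powr (2 * H)) \<le>
    s powr (2 * H) * t powr (2 * H) - ((s powr (2 * H) + t powr (2 * H) - (t - s) powr (2 * H)) / 2)\<^sup>2"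
proof -
  define a where "a = s powr H"
  define b where "b = t powr H"
  define c where "c = (t - s) powr H"
  define \<kappa> where "\<kappa> = 2 - 2 powr H"
  have sq: "z powr (2 * H) = (z powr H)\<^sup>2" if "0 < z" for z :: real
    using that by (simp add: powr_numeral[symmetric] powr_powr mult.commute)
  have k: "\<kappa> > 0" unfolding \<kappa>_def using two_powr_less[OF assms(4)] by simp
  have a: "a > 0" and c: "c > 0" unfolding a_def c_def using assms by auto
  have ab: "a \<le> b" and cb: "c \<le> b" unfolding a_def b_def c_def using assms by (auto intro!: powr_mono2)
  have k1: "\<kappa> * min a c \<le> a + c - b"
    using powr_subadditive_strict[of s "t - s" H] assms unfolding a_def b_def c_def \<kappa>_def by simp
  have "0 \<le> a + c - b" by (rule order_trans[OF _ k1]) (use k a c in simp)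
  then have "\<kappa> * min a c * c \<le> (a + c - b) * (c + (b - a))"
    using k1 k a c ab by (intro mult_mono) auto
  also have "\<dots> = c\<^sup>2 - (b - a)\<^sup>2" by (simp add: power2_eq_square algebra_simps)
  finally have 1: "\<kappa> * min a c * c \<le> c\<^sup>2 - (b - a)\<^sup>2" .
  have "c\<^sup>2 \<le> b\<^sup>2" using cb c by (intro power_mono) auto
  then have 2: "2 * a * b \<le> (a + b)\<^sup>2 - c\<^sup>2"
    using zero_le_power2[of a] unfolding power2_sum by linarith
  (* The maximum of a and c is at most b, and a * c is their minimum times their maximum. *)
  have "a * c \<le> min a c * b"
    using a c ab cb by (auto simp: min_def intro: mult_left_mono mult_mono)
  then have "(a * c) * (a * c) \<le> (min a c * b) * (a * c)"
    using a c by (intro mult_right_mono) auto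
  then have "\<kappa> * 2 * ((a * c) * (a * c)) \<le> \<kappa> * 2 * ((min a c * b) * (a * c))"
    using k by (intro mult_left_mono) auto
  also have "\<dots> = (\<kappa> * min a c * c) * (2 * a * b)" by (simp add: mult_ac)
  also have "\<dots> \<le> (c\<^sup>2 - (b - a)\<^sup>2) * ((a + b)\<^sup>2 - c\<^sup>2)"
  proof (rule mult_mono[OF 1 2])
    show "0 \<le> c\<^sup>2 - (b - a)\<^sup>2" by (rule order_trans[OF _ 1]) (use k a c in simp)
    show "0 \<le> 2 * a * b" using a ab by simp
  qed
  also have "\<dots> = 4 * (a\<^sup>2 * b\<^sup>2 - ((a\<^sup>2 + b\<^sup>2 - c\<^sup>2) / 2)\<^sup>2)"
    by (simp add: power2_eq_square field_simps)
  finally have "\<kappa> / 2 * (a\<^sup>2 * c\<^sup>2) \<le> a\<^sup>2 * b\<^sup>2 - ((a\<^sup>2 + b\<^sup>2 - c\<^sup>2) / 2)\<^sup>2"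
    by (simp add: power2_eq_square mult_ac)
  moreover have "s powr (2 * H) = a\<^sup>2" "t powr (2 * H) = b\<^sup>2" "(t - s) powr (2 * H) = c\<^sup>2"
    unfolding a_def b_def c_def using assms by (auto intro!: sq)
  ultimately show ?thesis unfolding \<kappa>_def by simp
qed

section \<open>Covariances of fractional Brownian motion\<close>

definition fbm_cov :: "real \<Rightarrow> real \<Rightarrow> real \<Rightarrow> real \<Rightarrow> real" where
  "fbm_cov \<sigma> H t s = \<sigma>\<^sup>2 * (t powr (2 * H) + s powr (2 * H) - \<bar>t - s\<bar> powr (2 * H)) / 2"

lemma fbm_cov_det:
  assumes "0 < s" "0 < t" "s \<noteq> t" "0 < H" "H < 1"
  shows "\<sigma>^4 * ((2 - 2 powr H) / 2) * ((min s t) powr (2 * H) * \<bar>t - s\<bar> powr (2 * H))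
    \<le> fbm_cov \<sigma> H s s * fbm_cov \<sigma> H t t - (fbm_cov \<sigma> H s t)\<^sup>2"
proof -
  have *: "\<sigma>^4 * ((2 - 2 powr H) / 2) * (s powr (2 * H) * (t - s) powr (2 * H))
    \<le> fbm_cov \<sigma> H s s * fbm_cov \<sigma> H t t - (fbm_cov \<sigma> H s t)\<^sup>2" if "0 < s" "s < t" for s t
  proof -
    have "\<sigma>^4 * ((2 - 2 powr H) / 2 * (s powr (2 * H) * (t - s) powr (2 * H))) \<le>
      \<sigma>^4 * (s powr (2 * H) * t powr (2 * H) - ((s powr (2 * H) + t powr (2 * H) - (t - s) powr (2 * H)) / 2)\<^sup>2)"
      by (rule mult_left_mono[OF fbm_determinant_bound[OF that assms(4,5)]]) simp
    also have "\<dots> = fbm_cov \<sigma> H s s * fbm_cov \<sigma> H t t - (fbm_cov \<sigma> H s t)\<^sup>2"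
      using that by (simp add: fbm_cov_def power2_eq_square power4_eq_xxxx abs_minus_commute[of s t] field_simps)
    finally show ?thesis by (simp add: mult.assoc)
  qed
  have sym: "fbm_cov \<sigma> H s t = fbm_cov \<sigma> H t s" by (simp add: fbm_cov_def abs_minus_commute add.commute)
  show ?thesis
  proof (cases "s < t")
    case True then show ?thesis using *[of s t] assms by (simp add: min_absorb1)
  next
    case False
    then have "t < s" using assms by simp
    then show ?thesis using *[of t s] assms sym by (simp add: min_absorb2 mult.commute[of "fbm_cov \<sigma> H t t"])
  qed
qed

text \<open>
  The data on which the Gaussian computations rest; continuity of paths enters in a later
  locale.
\<close>

locale scaled_fbm = prob_space M for M :: "'a measure" +
  fixes H \<sigma> :: real and X :: "real \<Rightarrow> 'a \<Rightarrow> real"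
  assumes H: "0 < H" "H < 1" and sigma: "0 < \<sigma>"
    and gaussian_process: "gaussian_process M X"
    and mean: "\<And>t. t \<ge> 0 \<Longrightarrow> expectation (X t) = 0"
    and covariance: "\<And>t s. t \<ge> 0 \<Longrightarrow> s \<ge> 0 \<Longrightarrow> expectation (\<lambda>\<omega>. X t \<omega> * X s \<omega>) = fbm_cov \<sigma> H t s"
begin

definition lin_span :: "('a \<Rightarrow> real) set" where
  "lin_span = {Y. \<exists>I c. finite I \<and> I \<subseteq> {0..} \<and> Y = (\<lambda>\<omega>. \<Sum>t\<in>I. c t * X t \<omega>)}"

lemma gaussian_X: "t \<ge> 0 \<Longrightarrow> gaussian_rv M (X t)"
  using gaussian_process[unfolded gaussian_process_def, rule_format, of "{t}" "\<lambda>_. 1"] by simp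

lemma integrable_X:
  assumes "t \<ge> 0" shows "integrable M (X t)"
proof (rule square_integrable_imp_integrable)
  show "X t \<in> borel_measurable M" using gaussian_X[OF assms] by (simp add: gaussian_rv_def)
  show "integrable M (\<lambda>\<omega>. (X t \<omega>)\<^sup>2)" by (rule centred_gaussian_rv(1)[OF gaussian_X[OF assms] mean[OF assms]])
qed

sublocale gaussian_space M lin_span
proof
  fix Y assume "Y \<in> lin_span"
  then obtain I c where Y: "finite I" "I \<subseteq> {0..}" "Y = (\<lambda>\<omega>. \<Sum>t\<in>I. c t * X t \<omega>)"
    unfolding lin_span_def by auto
  show "gaussian_rv M Y"
    using gaussian_process Y unfolding gaussian_process_def by auto
  have "expectation Y = (\<Sum>t\<in>I. c t * expectation (X t))"
    unfolding Y(3) using Y integrable_X by (subst Bochner_Integration.integral_sum) auto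
  then show "expectation Y = 0" using Y mean by (auto intro!: sum.neutral)
next
  show "(\<lambda>_. 0) \<in> lin_span" unfolding lin_span_def by (auto intro!: exI[of _ "{}"])
next
  fix Y Z a b assume "Y \<in> lin_span" "Z \<in> lin_span"
  then obtain I c J d where Y: "finite I" "I \<subseteq> {0..}" "Y = (\<lambda>\<omega>. \<Sum>t\<in>I. c t * X t \<omega>)"
    and Z: "finite J" "J \<subseteq> {0..}" "Z = (\<lambda>\<omega>. \<Sum>t\<in>J. d t * X t \<omega>)"
    unfolding lin_span_def by auto
  let ?c = "\<lambda>t. a * (if t \<in> I then c t else 0) + b * (if t \<in> J then d t else 0)"
  have "(\<Sum>t\<in>I \<union> J. ?c t * X t \<omega>) = a * Y \<omega> + b * Z \<omega>" for \<omega>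
  proof -
    have "(\<Sum>t\<in>I. c t * X t \<omega>) = (\<Sum>t\<in>I \<union> J. (if t \<in> I then c t else 0) * X t \<omega>)"
      using Y Z by (intro sum.mono_neutral_cong_left) auto
    moreover have "(\<Sum>t\<in>J. d t * X t \<omega>) = (\<Sum>t\<in>I \<union> J. (if t \<in> J then d t else 0) * X t \<omega>)"
      using Y Z by (intro sum.mono_neutral_cong_left) auto
    ultimately show ?thesis
      unfolding Y(3) Z(3) by (simp only: sum_distrib_left sum.distrib[symmetric] distrib_right mult.assoc)
  qed
  then show "(\<lambda>\<omega>. a * Y \<omega> + b * Z \<omega>) \<in> lin_span"
    unfolding lin_span_def using Y Z by (auto intro!: exI[of _ "I \<union> J"] exI[of _ ?c])
qed

lemma X_in: "t \<ge> 0 \<Longrightarrow> X t \<in> lin_span"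
  unfolding lin_span_def by (auto intro!: exI[of _ "{t}"] exI[of _ "\<lambda>_. 1"])

lemma cov_X: "t \<ge> 0 \<Longrightarrow> s \<ge> 0 \<Longrightarrow> cov (X t) (X s) = fbm_cov \<sigma> H t s"
  unfolding cov_def by (rule covariance)

lemma cov_X_self: "t \<ge> 0 \<Longrightarrow> cov (X t) (X t) = \<sigma>\<^sup>2 * t powr (2 * H)"
  by (simp add: cov_X fbm_cov_def)

text \<open>
  The normalised increment: its variance is \<open>\<sigma>\<^sup>2\<close> for all \<open>n\<close> and \<open>i\<close>, by self-similarity and
  stationarity of increments.
\<close>

definition incr :: "nat \<Rightarrow> nat \<Rightarrow> 'a \<Rightarrow> real" where
  "incr n i \<omega> = real n powr H * (X (real (i + 1) / real n) \<omega> - X (real i / real n) \<omega>)"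

lemma incr_lincomb: "incr n i = (\<lambda>\<omega>. real n powr H * X (real (i + 1) / real n) \<omega> + (- (real n powr H)) * X (real i / real n) \<omega>)"
  by (auto simp: incr_def algebra_simps)

lemma incr_in: "incr n i \<in> lin_span"
  unfolding incr_lincomb by (intro lincomb X_in) auto

lemma cov_incr: "Z \<in> lin_span \<Longrightarrow> cov (incr n i) Z
    = real n powr H * (cov (X (real (i + 1) / real n)) Z - cov (X (real i / real n)) Z)"
  unfolding incr_lincomb by (subst cov_lincomb) (auto intro!: X_in simp: algebra_simps)

lemma cov_incr_X:
  assumes "r \<ge> 0"
  shows "cov (incr n i) (X r) = real n powr H * \<sigma>\<^sup>2 / 2 *
    (((real (i + 1) / real n) powr (2 * H) - (real i / real n) powr (2 * H))
     - (\<bar>real (i + 1) / real n - r\<bar> powr (2 * H) - \<bar>real i / real n - r\<bar> powr (2 * H)))"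
proof -
  have "cov (incr n i) (X r) = real n powr H * (fbm_cov \<sigma> H (real (i + 1) / real n) r - fbm_cov \<sigma> H (real i / real n) r)"
    using assms by (subst cov_incr) (auto intro!: X_in simp: cov_X)
  then show ?thesis unfolding fbm_cov_def by (simp add: algebra_simps diff_divide_distrib add_divide_distrib)
qed

lemma cov_incr_incr:
  assumes "n \<ge> 1"
  shows "cov (incr n i) (incr n j) = real n powr (2 * H) * \<sigma>\<^sup>2 / 2 *
    (\<bar>real i / real n - real j / real n + 1 / real n\<bar> powr (2 * H)
      + \<bar>real i / real n - real j / real n - 1 / real n\<bar> powr (2 * H)
      - 2 * \<bar>real i / real n - real j / real n\<bar> powr (2 * H))"
proof -
  have "cov (incr n i) (incr n j) = real n powr H * (cov (incr n j) (X (real (i + 1) / real n)) - cov (incr n j) (X (real i / real n)))"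
    by (subst cov_incr[OF incr_in]) (simp only: cov_sym[of "X _" "incr n j"])
  also have "\<dots> = (real n powr H * real n powr H) * \<sigma>\<^sup>2 / 2 *
      (\<bar>real (j + 1) / real n - real i / real n\<bar> powr (2 * H) - \<bar>real j / real n - real i / real n\<bar> powr (2 * H)
       - \<bar>real (j + 1) / real n - real (i + 1) / real n\<bar> powr (2 * H) + \<bar>real j / real n - real (i + 1) / real n\<bar> powr (2 * H))"
    by (subst cov_incr_X, simp, subst cov_incr_X, simp) (simp only: right_diff_distrib left_diff_distrib, simp add: field_simps)
  also have "real n powr H * real n powr H = real n powr (2 * H)"
    by (simp add: powr_add[symmetric])
  also have "real (j + 1) / real n - real (i + 1) / real n = real j / real n - real i / real n"
    by (simp add: diff_divide_distrib[symmetric])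
  also have "\<bar>real (j + 1) / real n - real i / real n\<bar> = \<bar>real i / real n - real j / real n - 1 / real n\<bar>"
    by (simp add: add_divide_distrib abs_minus_commute algebra_simps)
  also have "\<bar>real j / real n - real (i + 1) / real n\<bar> = \<bar>real i / real n - real j / real n + 1 / real n\<bar>"
    by (simp add: add_divide_distrib abs_minus_commute[of "real j / real n"] algebra_simps)
  also have "\<bar>real j / real n - real i / real n\<bar> = \<bar>real i / real n - real j / real n\<bar>"
    by (simp add: abs_minus_commute)
  finally show ?thesis by (simp add: algebra_simps)
qed

lemma cov_incr_self:
  assumes "n \<ge> 1" shows "cov (incr n i) (incr n i) = \<sigma>\<^sup>2"
proof -
  have "real n powr (2 * H) * (1 / real n) powr (2 * H) = 1"
    using assms by (simp add: powr_mult[symmetric])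
  moreover have "cov (incr n i) (incr n i) = \<sigma>\<^sup>2 * (real n powr (2 * H) * (1 / real n) powr (2 * H))"
    using assms H by (simp add: cov_incr_incr field_simps)
  ultimately show ?thesis by simp
qed

end

definition grid :: "nat \<Rightarrow> real \<Rightarrow> nat" where
  "grid n s = nat \<lfloor>real n * s\<rfloor>"

lemma grid_bounds:
  assumes "n \<ge> 1" "s \<ge> 0"
  shows "real (grid n s) / real n \<le> s" "s < real (grid n s) / real n + 1 / real n"
proof -
  have g: "real (grid n s) = of_int \<lfloor>real n * s\<rfloor>" using assms by (simp add: grid_def)
  have n: "real n > 0" using assms by simp
  have "of_int \<lfloor>real n * s\<rfloor> \<le> real n * s" by simp
  then show "real (grid n s) / real n \<le> s"
    using n by (simp add: g divide_le_eq mult.commute)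
  have "real n * s < of_int \<lfloor>real n * s\<rfloor> + 1" by linarith
  then show "s < real (grid n s) / real n + 1 / real n"
    using n by (simp add: g less_divide_eq mult.commute flip: add_divide_distrib)
qed

lemma grid_tendsto:
  assumes "s \<ge> 0" shows "(\<lambda>n. real (grid n s) / real n) \<longlonglongrightarrow> s"
proof (rule tendsto_sandwich)
  show "\<forall>\<^sub>F n in sequentially. s - 1 / real n \<le> real (grid n s) / real n"
    using grid_bounds(2)[OF _ assms] by (intro eventually_sequentiallyI[of 1]) (simp add: less_imp_le algebra_simps)
  show "\<forall>\<^sub>F n in sequentially. real (grid n s) / real n \<le> s"
    using grid_bounds(1)[OF _ assms] by (intro eventually_sequentiallyI[of 1]) auto
  have "(\<lambda>n. s - 1 / real n) \<longlonglongrightarrow> s - 0"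
    by (intro tendsto_diff tendsto_const lim_1_over_n)
  then show "(\<lambda>n. s - 1 / real n) \<longlonglongrightarrow> s" by simp
qed simp

context scaled_fbm
begin

text \<open>
  Up to constants the covariance is \<open>n powr H\<close> times a difference of values of
  \<open>powr (2 * H)\<close> at distance \<open>1 / n\<close>, hence of order \<open>n powr (-H) + n powr (H - 1)\<close>. No distance between
  \<open>s\<close> and \<open>r\<close> is assumed: even the increment that starts at the sampled value decorrelates from it.
\<close>

lemma tendsto_cov_incr_X:
  assumes s: "s \<ge> 0" and r: "r \<longlonglongrightarrow> r'" "\<And>n. r n \<ge> 0"
  shows "(\<lambda>n. cov (incr n (grid n s)) (X (r n))) \<longlonglongrightarrow> 0"
proof -
  obtain R where R: "\<And>n. \<bar>r n\<bar> \<le> R"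
    using convergent_imp_Bseq[OF convergentI[OF r(1)]] unfolding Bseq_def by auto
  define K where "K = 2 * H * (s + 1 + R) powr (2 * H - 1)"
  have R0: "R \<ge> 0" using R[of 0] by linarith
  have aux: "\<bar>\<bar>t + d - q\<bar> powr (2 * H) - \<bar>t - q\<bar> powr (2 * H)\<bar> \<le> d powr (2 * H) + 2 * H * (s + 1 + R) powr (2 * H - 1) * d"
    if "0 \<le> t" "t \<le> s" "0 \<le> d" "d \<le> 1" "0 \<le> q" "q \<le> R" for t d q
    using that H s R0 by (intro powr_diff_bound) (auto simp: abs_if)
  have bd: "\<bar>cov (incr n (grid n s)) (X (r n))\<bar> \<le> \<sigma>\<^sup>2 * (real n powr (- H) + K * real n powr (H - 1))" if n: "n \<ge> 1" for n
  proof -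
    let ?t = "real (grid n s) / real n" and ?t' = "real (grid n s + 1) / real n"
    have t': "?t' = ?t + 1 / real n" by (simp add: add_divide_distrib)
    have n1: "0 \<le> 1 / real n" "1 / real n \<le> 1" using n by auto
    have tb: "0 \<le> ?t" "?t \<le> s" using grid_bounds(1)[OF n s] by auto
    have rb: "0 \<le> r n" "r n \<le> R" using R[of n] r(2)[of n] by auto
    have 1: "\<bar>?t' powr (2 * H) - ?t powr (2 * H)\<bar> \<le> (1 / real n) powr (2 * H) + 2 * H * (s + 1 + R) powr (2 * H - 1) * (1 / real n)"
      unfolding t' using tb n1 R0 H by (intro powr_diff_bound) auto
    have 2: "\<bar>\<bar>?t' - r n\<bar> powr (2 * H) - \<bar>?t - r n\<bar> powr (2 * H)\<bar> \<le> (1 / real n) powr (2 * H) + 2 * H * (s + 1 + R) powr (2 * H - 1) * (1 / real n)"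
      unfolding t' using tb n1 rb by (intro aux)
    have "\<bar>cov (incr n (grid n s)) (X (r n))\<bar> = real n powr H * \<sigma>\<^sup>2 / 2 * \<bar>(?t' powr (2 * H) - ?t powr (2 * H))
        - (\<bar>?t' - r n\<bar> powr (2 * H) - \<bar>?t - r n\<bar> powr (2 * H))\<bar>"
      unfolding cov_incr_X[OF r(2)] by (simp add: abs_mult)
    also have "\<dots> \<le> real n powr H * \<sigma>\<^sup>2 / 2 * (2 * ((1 / real n) powr (2 * H) + K * (1 / real n)))"
      using 1 2 unfolding K_def by (intro mult_left_mono) auto
    also have "\<dots> = \<sigma>\<^sup>2 * (real n powr H * (1 / real n) powr (2 * H) + K * (real n powr H * (1 / real n)))"
      by (simp add: algebra_simps)
    also have "real n powr H * (1 / real n) powr (2 * H) = real n powr (- H)"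
      using n by (simp add: powr_divide powr_minus_divide field_simps flip: powr_add)
    also have "real n powr H * (1 / real n) = real n powr (H - 1)"
      using n by (simp add: powr_diff)
    finally show ?thesis .
  qed
  have lim: "(\<lambda>n. \<sigma>\<^sup>2 * (real n powr (- H) + K * real n powr (H - 1))) \<longlonglongrightarrow> \<sigma>\<^sup>2 * (0 + K * 0)"
    using H by (intro tendsto_intros tendsto_neg_powr filterlim_real_sequentially) auto
  show ?thesis
    by (rule tendsto_0_le[where K=1, OF lim[simplified]]) (use bd in \<open>auto intro!: eventually_sequentiallyI[of 1] order_trans[OF bd abs_ge_self]\<close>)
qed

text \<open>
  Here the covariance is \<open>n powr (2 * H)\<close> times a second difference of
  \<open>powr (2 * H)\<close> taken away from the origin, hence of order \<open>n powr (2 * H - 2)\<close>.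
\<close>

lemma tendsto_cov_incr_incr:
  assumes s: "s \<ge> 0" and r: "r \<ge> 0" and ne: "s \<noteq> r"
  shows "(\<lambda>n. cov (incr n (grid n s)) (incr n (grid n r))) \<longlonglongrightarrow> 0"
proof -
  define m where "m = \<bar>s - r\<bar> / 2"
  have m: "m > 0" using ne by (simp add: m_def)
  define K where "K = 2 * (2 * H) * (m / 2) powr (2 * H - 2)"
  have K0: "K \<ge> 0" unfolding K_def using H by simp
  have "(\<lambda>n. \<bar>real (grid n s) / real n - real (grid n r) / real n\<bar>) \<longlonglongrightarrow> \<bar>s - r\<bar>"
    by (intro tendsto_intros grid_tendsto s r)
  then have e1: "\<forall>\<^sub>F n in sequentially. m < \<bar>real (grid n s) / real n - real (grid n r) / real n\<bar>"
    by (rule order_tendstoD) (use m in \<open>simp add: m_def\<close>)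
  have e2: "\<forall>\<^sub>F n in sequentially. 1 / real n < m / 2"
    by (rule order_tendstoD(2)[OF lim_1_over_n]) (use m in simp)
  have bd: "\<forall>\<^sub>F n in sequentially. norm (cov (incr n (grid n s)) (incr n (grid n r))) \<le> norm (\<sigma>\<^sup>2 / 2 * K * real n powr (2 * H - 2)) * 1"
    using e1 e2 eventually_ge_at_top[of 1]
  proof eventually_elim
    case (elim n)
    let ?d = "real (grid n s) / real n - real (grid n r) / real n" and ?\<delta> = "1 / real n"
    have abs_eq: "\<bar>?d + ?\<delta>\<bar> powr (2 * H) + \<bar>?d - ?\<delta>\<bar> powr (2 * H) = (\<bar>?d\<bar> + ?\<delta>) powr (2 * H) + (\<bar>?d\<bar> - ?\<delta>) powr (2 * H)"
      using elim m by (intro abs_shift_powr) auto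
    have "\<bar>(\<bar>?d\<bar> + ?\<delta>) powr (2 * H) + (\<bar>?d\<bar> - ?\<delta>) powr (2 * H) - 2 * \<bar>?d\<bar> powr (2 * H)\<bar>
        \<le> 2 * (2 * H) * (m / 2) powr (2 * H - 2) * ?\<delta>\<^sup>2"
      using elim H by (intro powr_second_difference_bound) auto
    then have "\<bar>cov (incr n (grid n s)) (incr n (grid n r))\<bar> \<le> real n powr (2 * H) * \<sigma>\<^sup>2 / 2 * (K * ?\<delta>\<^sup>2)"
      unfolding cov_incr_incr[OF elim(3)] abs_eq K_def abs_mult by (intro mult_mono) auto
    also have "\<dots> = \<sigma>\<^sup>2 / 2 * K * (real n powr (2 * H) * ?\<delta>\<^sup>2)" by simp
    also have "real n powr (2 * H) * ?\<delta>\<^sup>2 = real n powr (2 * H - 2)"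
      using elim by (simp add: powr_diff power_divide powr_numeral)
    finally show ?case using K0 by (simp add: abs_mult)
  qed
  have "(\<lambda>n. \<sigma>\<^sup>2 / 2 * K * real n powr (2 * H - 2)) \<longlonglongrightarrow> \<sigma>\<^sup>2 / 2 * K * 0"
    using H by (intro tendsto_intros tendsto_neg_powr filterlim_real_sequentially) auto
  then have "(\<lambda>n. \<sigma>\<^sup>2 / 2 * K * real n powr (2 * H - 2)) \<longlonglongrightarrow> 0" by simp
  from tendsto_0_le[OF this bd] show ?thesis .
qed

lemma tendsto_cov_X:
  assumes "s \<longlonglongrightarrow> s'" "r \<longlonglongrightarrow> r'" "\<And>n. s n \<ge> 0" "\<And>n. r n \<ge> 0"
  shows "(\<lambda>n. cov (X (s n)) (X (r n))) \<longlonglongrightarrow> fbm_cov \<sigma> H s' r'"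
  unfolding cov_X[OF assms(3,4)] fbm_cov_def using assms H
  by (intro tendsto_intros tendsto_powr') auto

end

section \<open>Second moments\<close>

text \<open>
  The integrable singularity \<open>\<bar>v\<bar> powr (-H)\<close>, cut off at \<open>\<plusminus>T\<close>, from which the dominating function
  on the square is built.
\<close>

definition cut_power :: "real \<Rightarrow> real \<Rightarrow> real \<Rightarrow> ennreal" where
  "cut_power H T v = ennreal (\<bar>v\<bar> powr (- H)) * indicator {-T..T} v"

lemma cut_power_measurable[measurable]: "cut_power H T \<in> borel_measurable borel"
  unfolding cut_power_def by measurable

lemma nn_integral_reflect_shift:
  fixes f :: "real \<Rightarrow> ennreal"
  assumes "f \<in> borel_measurable borel"
  shows "(\<integral>\<^sup>+r. f (s - r) \<partial>lborel) = (\<integral>\<^sup>+r. f r \<partial>lborel)"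
  using nn_integral_real_affine[OF assms, of "-1" s] by simp

lemma ennreal_mult4:
  "0 \<le> a \<Longrightarrow> 0 \<le> b \<Longrightarrow> 0 \<le> c \<Longrightarrow> 0 \<le> d \<Longrightarrow> ennreal a * ennreal b * ennreal c * ennreal d = ennreal (a * b * c * d)"
  by (simp add: ennreal_mult)

lemma nn_integral_cut_power_finite:
  assumes "H < 1" "T \<ge> 0"
  shows "(\<integral>\<^sup>+v. cut_power H T v \<partial>lborel) < \<infinity>"
proof -
  let ?f = "\<lambda>v. if v \<in> {0..T} then v powr (- H) else 0"
  have f[measurable]: "?f \<in> borel_measurable borel" by measurable
  have "(?f has_integral (T powr (- H + 1) / (- H + 1))) UNIV"
    unfolding has_integral_restrict_UNIV using assms by (intro has_integral_powr_from_0) auto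
  then have I: "(\<integral>\<^sup>+v. ennreal (?f v) \<partial>lborel) = ennreal (T powr (- H + 1) / (- H + 1))"
    by (intro nn_integral_has_integral_lborel) auto
  have I': "(\<integral>\<^sup>+v. ennreal (?f (- v)) \<partial>lborel) = ennreal (T powr (- H + 1) / (- H + 1))"
    by (subst nn_integral_reflect_shift[of "\<lambda>v. ennreal (?f v)" 0, unfolded diff_0]) (measurable, rule I)
  have "(\<integral>\<^sup>+v. cut_power H T v \<partial>lborel) \<le> (\<integral>\<^sup>+v. ennreal (?f v) + ennreal (?f (- v)) \<partial>lborel)"
    by (intro nn_integral_mono) (auto simp: cut_power_def indicator_def)
  also have "\<dots> = (\<integral>\<^sup>+v. ennreal (?f v) \<partial>lborel) + (\<integral>\<^sup>+v. ennreal (?f (- v)) \<partial>lborel)"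
    by (rule nn_integral_add) measurable
  also have "\<dots> < \<infinity>" unfolding I I' by simp
  finally show ?thesis .
qed

lemma ennreal_mult_le_squares: "a * b \<le> a * a + b * (b :: ennreal)"
proof (cases "a \<le> b")
  case True then have "a * b \<le> b * b" by (intro mult_right_mono) auto
  then show ?thesis by (rule order_trans) simp
next
  case False then have "a * b \<le> a * a" by (intro mult_left_mono) auto
  then show ?thesis by (rule order_trans) simp
qed

text \<open>
  The product \<open>h y * k z\<close> majorises all kernels in question. The growth condition is put on
  \<open>k\<^sup>2\<close> because a product of two values of \<open>k\<close> is estimated by the sum of their squares, and then by
  exponentials of one increment at a time, to which the moment bounds above apply. Regularity of
  paths is demanded for every \<open>\<omega>\<close>; exceptional null sets are dealt with at the very end.
\<close>

locale kernel_setting = scaled_fbm M H \<sigma> X for M :: "'a measure" and H \<sigma> X +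
  fixes x :: real and u :: "nat \<Rightarrow> real" and h k :: "real \<Rightarrow> real" and S C :: real
  assumes paths: "\<And>\<omega>. \<omega> \<in> space M \<Longrightarrow> continuous_on {0..} (\<lambda>t. X t \<omega>)"
    and u_pos: "\<And>n. n \<ge> 1 \<Longrightarrow> u n > 0"
    and u_top: "filterlim u at_top sequentially"
    and u_small: "(\<lambda>n. u n / real n) \<longlonglongrightarrow> 0"
    and h_meas[measurable]: "h \<in> borel_measurable borel" and k_meas[measurable]: "k \<in> borel_measurable borel"
    and h_nonneg: "\<And>y. 0 \<le> h y" and k_nonneg: "\<And>z. 0 \<le> k z"
    and h_le: "\<And>y. h y \<le> S" and h_fin: "(\<integral>\<^sup>+y. ennreal (h y) \<partial>lborel) < \<infinity>"
    and k_le: "\<And>z. (k z)\<^sup>2 \<le> C * (exp z + exp (- z))"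
begin

definition dominated_kernel :: "(real \<times> real \<Rightarrow> ennreal) \<Rightarrow> bool" where
  "dominated_kernel F \<longleftrightarrow> F \<in> borel_measurable (borel \<Otimes>\<^sub>M borel) \<and> (\<forall>y z. F (y, z) \<le> ennreal (h y * k z))"

text \<open>
  The statistic samples the path at grid points (\<open>b = True\<close>), the occupation integral at all
  times (\<open>b = False\<close>). One parameter lets the mixed second moments be treated together with the pure ones.
  The maximum with \<open>0\<close> keeps sample times in the domain of the process for all real \<open>s\<close>, so that joint
  measurability holds on the whole line.
\<close>

definition sample_time :: "bool \<Rightarrow> nat \<Rightarrow> real \<Rightarrow> real" where
  "sample_time b n s = (if b then real (grid n s) / real n else max 0 s)"

definition kernel_value :: "bool \<Rightarrow> (real \<times> real \<Rightarrow> ennreal) \<Rightarrow> nat \<Rightarrow> real \<Rightarrow> 'a \<Rightarrow> ennreal" where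
  "kernel_value b F n s \<omega> = ennreal (u n) * F (u n * (X (sample_time b n s) \<omega> - x), incr n (grid n s) \<omega>)"

abbreviation "h_mass \<equiv> \<integral>\<^sup>+y. ennreal (h y) \<partial>lborel"

lemma sample_time_nonneg[simp]: "0 \<le> sample_time b n s"
  by (simp add: sample_time_def)

lemma sample_time_close:
  assumes "n \<ge> 1" "s \<ge> 0"
  shows "sample_time b n s \<le> s" "s < sample_time b n s + 1 / real n"
  using grid_bounds[OF assms] assms by (auto simp: sample_time_def)

lemma sample_time_tendsto: "s \<ge> 0 \<Longrightarrow> (\<lambda>n. sample_time b n s) \<longlonglongrightarrow> s"
  using grid_tendsto[of s] by (cases b) (auto simp: sample_time_def max_absorb2)

text \<open>
  Grid points may lie below \<open>s\<close>, but beyond the first grid step by no more than a factor two.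
  This is why the first step is excluded from the integrals below.
\<close>

lemma sample_time_ge_half:
  assumes "n \<ge> 1" "1 / real n \<le> s" shows "s / 2 \<le> sample_time b n s"
proof (cases b)
  case True
  have n: "real n > 0" using assms by simp
  have "1 \<le> real n * s" using assms n by (simp add: divide_le_eq mult.commute)
  then have "1 \<le> \<lfloor>real n * s\<rfloor>" by (simp add: le_floor_iff)
  moreover have s: "0 \<le> s" using assms n by (meson divide_nonneg_pos order_trans zero_le_one)
  ultimately have g1: "1 \<le> real (grid n s)" by (simp add: grid_def)
  then have "1 / real n \<le> real (grid n s) / real n" using n by (intro divide_right_mono) auto
  then have "s / 2 \<le> real (grid n s) / real n" using grid_bounds(2)[OF assms(1) s] by linarith
  then show ?thesis using True by (simp add: sample_time_def)
next
  case False
  then show ?thesis using assms by (simp add: sample_time_def max_def)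
qed

lemma X_meas: "t \<ge> 0 \<Longrightarrow> X t \<in> borel_measurable M"
  by (rule meas[OF X_in])

lemma grid_measurable[measurable]: "grid n \<in> measurable borel (count_space UNIV)"
  unfolding grid_def by measurable

lemma X_grid_measurable: "(\<lambda>(s, \<omega>). X (real (grid n s) / real n) \<omega>) \<in> borel_measurable (borel \<Otimes>\<^sub>M M)"
proof -
  have "(\<lambda>p. (\<lambda>i p. X (real i / real n) (snd p)) (grid n (fst p)) p) \<in> borel_measurable (borel \<Otimes>\<^sub>M M)"
    by (rule measurable_compose_countable) (auto intro!: measurable_compose[OF measurable_snd] X_meas)
  then show ?thesis by (simp add: case_prod_beta)
qed

text \<open>
  By continuity the path is the pointwise limit of its discretisations, and these take
  countably many random values.
\<close>

lemma X_max_measurable: "(\<lambda>(s, \<omega>). X (max 0 s) \<omega>) \<in> borel_measurable (borel \<Otimes>\<^sub>M M)"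
proof (rule borel_measurable_LIMSEQ_real)
  show "(\<lambda>(s, \<omega>). X (real (grid n (max 0 s)) / real n) \<omega>) \<in> borel_measurable (borel \<Otimes>\<^sub>M M)" for n
    using measurable_compose[OF _ X_grid_measurable[of n], of "\<lambda>(s, \<omega>). (max 0 s, \<omega>)" "borel \<Otimes>\<^sub>M M"]
    by (simp add: case_prod_beta)
  fix p :: "real \<times> 'a" assume "p \<in> space (borel \<Otimes>\<^sub>M M)"
  then have \<omega>: "snd p \<in> space M" by (auto simp: space_pair_measure)
  have "(\<lambda>n. X (real (grid n (max 0 (fst p))) / real n) (snd p)) \<longlonglongrightarrow> X (max 0 (fst p)) (snd p)"
    by (rule continuous_on_tendsto_compose[OF paths[OF \<omega>] grid_tendsto]) auto
  then show "(\<lambda>n. case p of (s, \<omega>) \<Rightarrow> X (real (grid n (max 0 s)) / real n) \<omega>) \<longlonglongrightarrow> (case p of (s, \<omega>) \<Rightarrow> X (max 0 s) \<omega>)"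
    by (simp add: case_prod_beta)
qed

lemma X_sample_measurable: "(\<lambda>(s, \<omega>). X (sample_time b n s) \<omega>) \<in> borel_measurable (borel \<Otimes>\<^sub>M M)"
  using X_grid_measurable[of n] X_max_measurable by (cases b) (auto simp: sample_time_def)

lemma incr_grid_measurable: "(\<lambda>(s, \<omega>). incr n (grid n s) \<omega>) \<in> borel_measurable (borel \<Otimes>\<^sub>M M)"
proof -
  have "(\<lambda>p. (\<lambda>i p. incr n i (snd p)) (grid n (fst p)) p) \<in> borel_measurable (borel \<Otimes>\<^sub>M M)"
    by (rule measurable_compose_countable) (auto intro!: measurable_compose[OF measurable_snd] meas[OF incr_in])
  then show ?thesis by (simp add: case_prod_beta)
qed

lemma kernel_value_measurable:
  assumes "dominated_kernel F"
  shows "(\<lambda>(s, \<omega>). kernel_value b F n s \<omega>) \<in> borel_measurable (borel \<Otimes>\<^sub>M M)"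
proof -
  have F: "F \<in> borel_measurable (borel \<Otimes>\<^sub>M borel)" using assms by (simp add: dominated_kernel_def)
  have m: "(\<lambda>p. (u n * ((case p of (s, \<omega>) \<Rightarrow> X (sample_time b n s) \<omega>) - x), case p of (s, \<omega>) \<Rightarrow> incr n (grid n s) \<omega>))
      \<in> measurable (borel \<Otimes>\<^sub>M M) (borel \<Otimes>\<^sub>M borel)"
    using X_sample_measurable[of b n] incr_grid_measurable[of n] by measurable
  show ?thesis
    using measurable_compose[OF m F] unfolding kernel_value_def by (simp add: case_prod_beta)
qed

lemma kernel_value_measurable2[measurable (raw)]:
  assumes "dominated_kernel F" "f \<in> borel_measurable N" "g \<in> measurable N M"
  shows "(\<lambda>p. kernel_value b F n (f p) (g p)) \<in> borel_measurable N"
  using measurable_compose[OF measurable_Pair[OF assms(2,3)] kernel_value_measurable[OF assms(1), of b n]] by simp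

lemma rescaled_mass:
  assumes "v > 0"
  shows "(\<integral>\<^sup>+y. ennreal (h (v * (y - x))) \<partial>lborel) = ennreal (1 / v) * h_mass"
  using assms by (subst nn_integral_real_affine[where c="1/v" and t=x]) (auto simp: field_simps)

lemma neg_in: "D \<in> lin_span \<Longrightarrow> (\<lambda>\<omega>. - D \<omega>) \<in> lin_span"
  using lincomb[OF _ zero, of D "-1" 0] by simp

lemma cov_neg: "cov (\<lambda>\<omega>. - D \<omega>) (\<lambda>\<omega>. - D \<omega>) = cov D D"
  by (simp add: cov_def)

text \<open>
  One of the two factors \<open>h\<close> is bounded by \<open>S\<close>, the other is integrated against the density of the
  sampled value, which is of order \<open>s powr (-H)\<close>. This leaves one factor \<open>u n\<close>: too much for integration
  over the square, but harmless on a strip of width \<open>1 / n\<close>.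
\<close>

lemma kernel_square_bound:
  assumes F: "dominated_kernel F" and n: "n \<ge> 1" and s: "1 / real n \<le> s"
  shows "(\<integral>\<^sup>+\<omega>. kernel_value b F n s \<omega> * kernel_value b F n s \<omega> \<partial>M)
    \<le> (ennreal (2 * \<bar>S\<bar> * \<bar>C\<bar> * exp (\<sigma>\<^sup>2 / 2) / (\<sigma> * (1/2) powr H)) * h_mass) * ennreal (u n) * ennreal (s powr (- H))"
proof -
  let ?\<tau> = "sample_time b n s"
  have un: "u n > 0" using u_pos n by simp
  have s0: "s > 0" using s n by (meson divide_pos_pos less_le_trans of_nat_0_less_iff zero_less_one le_trans not_one_le_zero gr0I)
  have \<tau>: "?\<tau> \<ge> s / 2" by (rule sample_time_ge_half[OF n s])
  then have \<tau>0: "?\<tau> > 0" using s0 by linarith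
  define Y where "Y = X ?\<tau>"
  define D where "D = incr n (grid n s)"
  have Y: "Y \<in> lin_span" unfolding Y_def by (rule X_in) simp
  have D: "D \<in> lin_span" unfolding D_def by (rule incr_in)
  have [measurable]: "Y \<in> borel_measurable M" "D \<in> borel_measurable M" using Y D by (auto intro: meas)
  have vY: "cov Y Y = \<sigma>\<^sup>2 * ?\<tau> powr (2 * H)" unfolding Y_def by (rule cov_X_self) simp
  have vYp: "cov Y Y > 0" unfolding vY using \<tau>0 sigma by simp
  have vD: "cov D D = \<sigma>\<^sup>2" unfolding D_def by (rule cov_incr_self[OF n])
  let ?h = "\<lambda>y. ennreal (h (u n * (y - x)))"
  let ?K = "ennreal (exp (\<sigma>\<^sup>2 / 2) / sqrt (2 * pi * cov Y Y)) * (ennreal (1 / u n) * h_mass)"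
  have b: "(\<integral>\<^sup>+\<omega>. ?h (Y \<omega>) * ennreal (exp (W \<omega>)) \<partial>M) \<le> ?K" if W: "W \<in> lin_span" "cov W W = \<sigma>\<^sup>2" for W
    using density_exp_bound1[OF Y W(1) vYp, of ?h] unfolding W(2) rescaled_mass[OF un] by simp
  (* The weights exp D and exp (- D) lead to the same bound, as D and - D have the same variance. *)
  have pt: "kernel_value b F n s \<omega> * kernel_value b F n s \<omega>
     \<le> ennreal ((u n)\<^sup>2 * \<bar>S\<bar> * \<bar>C\<bar>) * (?h (Y \<omega>) * ennreal (exp (D \<omega>)) + ?h (Y \<omega>) * ennreal (exp (- D \<omega>)))" for \<omega>
  proof -
    let ?a = "h (u n * (Y \<omega> - x))"
    have "kernel_value b F n s \<omega> \<le> ennreal (u n * (?a * k (D \<omega>)))"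
      using F un h_nonneg k_nonneg unfolding kernel_value_def dominated_kernel_def Y_def[symmetric] D_def[symmetric]
      by (subst ennreal_mult) (auto intro!: mult_left_mono)
    then have "kernel_value b F n s \<omega> * kernel_value b F n s \<omega> \<le> ennreal (u n * (?a * k (D \<omega>))) * ennreal (u n * (?a * k (D \<omega>)))"
      by (intro mult_mono) auto
    also have "\<dots> = ennreal ((u n)\<^sup>2 * (?a * ?a) * (k (D \<omega>))\<^sup>2)"
      using un h_nonneg k_nonneg by (subst ennreal_mult[symmetric]) (auto simp: power2_eq_square mult_ac)
    also have "\<dots> \<le> ennreal ((u n)\<^sup>2 * (\<bar>S\<bar> * ?a) * (\<bar>C\<bar> * (exp (D \<omega>) + exp (- D \<omega>))))"
    proof (intro ennreal_leI mult_mono)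
      show "?a \<le> \<bar>S\<bar>" using h_le[of "u n * (Y \<omega> - x)"] by simp
      have "0 \<le> exp (D \<omega>) + exp (- D \<omega>)" by (intro add_nonneg_nonneg) auto
      then have "C * (exp (D \<omega>) + exp (- D \<omega>)) \<le> \<bar>C\<bar> * (exp (D \<omega>) + exp (- D \<omega>))"
        by (intro mult_right_mono) auto
      then show "(k (D \<omega>))\<^sup>2 \<le> \<bar>C\<bar> * (exp (D \<omega>) + exp (- D \<omega>))"
        using k_le[of "D \<omega>"] by linarith
    qed (use h_nonneg in auto)
    also have "\<dots> = ennreal ((u n)\<^sup>2 * \<bar>S\<bar> * \<bar>C\<bar>) * (?h (Y \<omega>) * ennreal (exp (D \<omega>)) + ?h (Y \<omega>) * ennreal (exp (- D \<omega>)))"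
      using h_nonneg by (simp add: ennreal_mult[symmetric] distrib_left mult_ac flip: ennreal_plus)
    finally show ?thesis .
  qed
  have "(\<integral>\<^sup>+\<omega>. kernel_value b F n s \<omega> * kernel_value b F n s \<omega> \<partial>M)
     \<le> (\<integral>\<^sup>+\<omega>. ennreal ((u n)\<^sup>2 * \<bar>S\<bar> * \<bar>C\<bar>) * (?h (Y \<omega>) * ennreal (exp (D \<omega>)) + ?h (Y \<omega>) * ennreal (exp (- D \<omega>))) \<partial>M)"
    by (rule nn_integral_mono) (rule pt)
  also have "\<dots> = ennreal ((u n)\<^sup>2 * \<bar>S\<bar> * \<bar>C\<bar>) * ((\<integral>\<^sup>+\<omega>. ?h (Y \<omega>) * ennreal (exp (D \<omega>)) \<partial>M) + (\<integral>\<^sup>+\<omega>. ?h (Y \<omega>) * ennreal (exp (- D \<omega>)) \<partial>M))"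
    by (subst nn_integral_cmult) (simp_all add: nn_integral_add)
  also have "\<dots> \<le> ennreal ((u n)\<^sup>2 * \<bar>S\<bar> * \<bar>C\<bar>) * (?K + ?K)"
    using b[OF D vD] b[OF neg_in[OF D]] vD by (intro mult_left_mono add_mono) (auto simp: cov_neg)
  also have "\<dots> = (ennreal ((u n)\<^sup>2 * \<bar>S\<bar> * \<bar>C\<bar>) * ennreal 2 * ennreal (exp (\<sigma>\<^sup>2 / 2) / sqrt (2 * pi * cov Y Y)) * ennreal (1 / u n)) * h_mass"
    by (simp add: mult_2[symmetric] mult_ac)
  also have "ennreal ((u n)\<^sup>2 * \<bar>S\<bar> * \<bar>C\<bar>) * ennreal 2 * ennreal (exp (\<sigma>\<^sup>2 / 2) / sqrt (2 * pi * cov Y Y)) * ennreal (1 / u n)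
     = ennreal ((2 * \<bar>S\<bar> * \<bar>C\<bar> * exp (\<sigma>\<^sup>2 / 2)) * u n * (1 / sqrt (2 * pi * cov Y Y)))"
    using un vYp by (subst ennreal_mult4) (auto simp: power2_eq_square)
  also have "\<dots> * h_mass \<le> ennreal ((2 * \<bar>S\<bar> * \<bar>C\<bar> * exp (\<sigma>\<^sup>2 / 2)) * u n * (s powr (- H) / (\<sigma> * (1/2) powr H))) * h_mass"
  proof (intro mult_right_mono ennreal_leI mult_left_mono)
    have "(\<sigma> * (s / 2) powr H)\<^sup>2 = \<sigma>\<^sup>2 * (s / 2) powr (2 * H)"
      by (simp add: power_mult_distrib power2_eq_square[of "_ powr _"] powr_add[symmetric])
    also have "\<dots> \<le> \<sigma>\<^sup>2 * ?\<tau> powr (2 * H)"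
      using \<tau> s0 H by (intro mult_left_mono powr_mono2) auto
    also have "\<dots> = cov Y Y" by (simp add: vY)
    also have "\<dots> \<le> 2 * pi * cov Y Y" using vYp pi_gt3 mult_right_mono[of 1 "2 * pi" "cov Y Y"] by auto
    finally have "\<sigma> * (s / 2) powr H \<le> sqrt (2 * pi * cov Y Y)"
      by (intro real_le_rsqrt)
    then have "1 / sqrt (2 * pi * cov Y Y) \<le> 1 / (\<sigma> * (s / 2) powr H)"
      using sigma s0 vYp by (intro divide_left_mono) auto
    also have "(s / 2) powr H = s powr H * (1/2) powr H"
      using s0 by (subst powr_mult[symmetric]) auto
    also have "1 / (\<sigma> * (s powr H * (1/2) powr H)) = s powr (- H) / (\<sigma> * (1/2) powr H)"
      by (simp add: powr_minus_divide)
    finally show "1 / sqrt (2 * pi * cov Y Y) \<le> s powr (- H) / (\<sigma> * (1/2) powr H)" .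
  qed (use un in auto)
  also have "\<dots> = (ennreal (2 * \<bar>S\<bar> * \<bar>C\<bar> * exp (\<sigma>\<^sup>2 / 2) / (\<sigma> * (1/2) powr H)) * h_mass) * ennreal (u n) * ennreal (s powr (- H))"
  proof -
    have "ennreal ((2 * \<bar>S\<bar> * \<bar>C\<bar> * exp (\<sigma>\<^sup>2 / 2)) * u n * (s powr (- H) / (\<sigma> * (1/2) powr H)))
      = ennreal (2 * \<bar>S\<bar> * \<bar>C\<bar> * exp (\<sigma>\<^sup>2 / 2) / (\<sigma> * (1/2) powr H)) * ennreal (u n) * ennreal (s powr (- H))"
      using un sigma by (simp add: ennreal_mult[symmetric] mult_ac)
    then show ?thesis by (simp only: mult_ac)
  qed
  finally show ?thesis .
qed

text \<open>
  Collects the constants from the proof of the next bounds; only its finiteness matters.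
\<close>

definition pair_const :: ennreal where
  "pair_const = ennreal (4 * \<bar>C\<bar> * exp (\<sigma>\<^sup>2 / 2) / (2 * pi * (\<sigma>\<^sup>2 * sqrt ((2 - 2 powr H) / 2) * ((1/2) powr H * (1/2) powr H)))) * (h_mass * h_mass)"

lemma pair_const_finite: "pair_const < \<infinity>"
  unfolding pair_const_def using h_fin by (simp add: ennreal_mult_less_top)

text \<open>
  The determinant bound at the sample times \<open>\<tau>\<close> and \<open>\<tau>'\<close>, expressed through \<open>s\<close> and \<open>r\<close>, from
  which they differ by factors at most two in the relevant quantities.
\<close>

lemma det_lower_bound:
  assumes "0 < s" "0 < r" "0 < \<tau>" "0 < \<tau>'" "\<tau> \<noteq> \<tau>'" "min s r / 2 \<le> min \<tau> \<tau>'" "0 < d" "d / 2 \<le> \<bar>\<tau>' - \<tau>\<bar>"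
  shows "\<sigma>\<^sup>2 * sqrt ((2 - 2 powr H) / 2) * ((1/2) powr H * (1/2) powr H) * ((min s r) powr H * d powr H)
    \<le> sqrt (cov (X \<tau>) (X \<tau>) * cov (X \<tau>') (X \<tau>') - (cov (X \<tau>) (X \<tau>'))\<^sup>2)"
proof (rule real_le_rsqrt)
  let ?m = "min s r"
  have k: "0 \<le> (2 - 2 powr H) / 2" using two_powr_less[OF H(2)] by simp
  have m: "0 < ?m" using assms by simp
  have half: "(1/2) powr H * z powr H = (z / 2) powr H" if "0 < z" for z :: real
    using that by (subst powr_mult[symmetric]) auto
  have sq: "(z powr H)\<^sup>2 = z powr (2 * H)" for z :: real
    by (simp add: power2_eq_square powr_add[symmetric])
  have "(\<sigma>\<^sup>2 * sqrt ((2 - 2 powr H) / 2) * ((1/2) powr H * (1/2) powr H) * (?m powr H * d powr H))\<^sup>2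
    = (\<sigma>\<^sup>2 * sqrt ((2 - 2 powr H) / 2) * (((1/2) powr H * ?m powr H) * ((1/2) powr H * d powr H)))\<^sup>2"
    by (simp only: mult_ac)
  also have "\<dots> = \<sigma>^4 * ((2 - 2 powr H) / 2) * ((?m / 2) powr (2 * H) * (d / 2) powr (2 * H))"
    unfolding half[OF m] half[OF assms(7)] power_mult_distrib sq using k by simp
  also have "\<dots> \<le> \<sigma>^4 * ((2 - 2 powr H) / 2) * ((min \<tau> \<tau>') powr (2 * H) * \<bar>\<tau>' - \<tau>\<bar> powr (2 * H))"
  proof (intro mult_left_mono mult_mono)
    show "(?m / 2) powr (2 * H) \<le> (min \<tau> \<tau>') powr (2 * H)" using assms m H by (intro powr_mono2) auto
    show "(d / 2) powr (2 * H) \<le> \<bar>\<tau>' - \<tau>\<bar> powr (2 * H)" using assms H by (intro powr_mono2) auto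
    show "0 \<le> \<sigma>^4 * ((2 - 2 powr H) / 2)" using k by (intro mult_nonneg_nonneg) auto
  qed auto
  also have "\<dots> \<le> fbm_cov \<sigma> H \<tau> \<tau> * fbm_cov \<sigma> H \<tau>' \<tau>' - (fbm_cov \<sigma> H \<tau> \<tau>')\<^sup>2"
    using assms H by (intro fbm_cov_det) auto
  also have "\<dots> = cov (X \<tau>) (X \<tau>) * cov (X \<tau>') (X \<tau>') - (cov (X \<tau>) (X \<tau>'))\<^sup>2"
    using assms by (simp add: cov_X)
  finally show "(\<sigma>\<^sup>2 * sqrt ((2 - 2 powr H) / 2) * ((1/2) powr H * (1/2) powr H) * (?m powr H * d powr H))\<^sup>2
    \<le> cov (X \<tau>) (X \<tau>) * cov (X \<tau>') (X \<tau>') - (cov (X \<tau>) (X \<tau>'))\<^sup>2" .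
qed

text \<open>
  Each increment enters through an exponential, each value of the process through \<open>h\<close>; by
  \<open>density_exp_bound2\<close> the two factors \<open>u n\<close> are used up by the two integrals of the rescaled \<open>h\<close>, and what
  remains is the bound for the joint density. Two grid steps of distance ensure that the sample times stay at
  least half as far apart as \<open>s\<close> and \<open>r\<close>.
\<close>

lemma kernel_pair_bound:
  assumes F: "dominated_kernel F" "dominated_kernel F'" and n: "n \<ge> 1"
    and s: "1 / real n \<le> s" and r: "1 / real n \<le> r" and sr: "2 / real n \<le> \<bar>s - r\<bar>"
  shows "(\<integral>\<^sup>+\<omega>. kernel_value b F n s \<omega> * kernel_value b' F' n r \<omega> \<partial>M)
    \<le> pair_const * ennreal ((min s r) powr (- H) * \<bar>s - r\<bar> powr (- H))"
proof -
  let ?\<tau> = "sample_time b n s" and ?\<tau>' = "sample_time b' n r"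
  have un: "u n > 0" using u_pos n by simp
  have n0: "real n > 0" using n by simp
  have ni: "1 / real n > 0" using n0 by simp
  have s0: "s > 0" and r0: "r > 0" and d0: "\<bar>s - r\<bar> > 0" using s r sr ni by linarith+
  have \<tau>: "s / 2 \<le> ?\<tau>" "r / 2 \<le> ?\<tau>'" using sample_time_ge_half[OF n] s r by auto
  have \<tau>0: "0 < ?\<tau>" "0 < ?\<tau>'" using \<tau> s0 r0 by linarith+
  have dist: "\<bar>s - r\<bar> / 2 \<le> \<bar>?\<tau>' - ?\<tau>\<bar>"
  proof -
    have "2 * (1 / real n) \<le> \<bar>s - r\<bar>" using sr by simp
    then show ?thesis
      using sample_time_close[OF n less_imp_le[OF s0], of b] sample_time_close[OF n less_imp_le[OF r0], of b']
      by (auto simp: abs_if split: if_splits)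
  qed
  then have ne: "?\<tau> \<noteq> ?\<tau>'" using d0 by auto
  have mn: "min s r / 2 \<le> min ?\<tau> ?\<tau>'" using \<tau> by linarith
  define P where "P = X ?\<tau>"
  define Q where "Q = X ?\<tau>'"
  define D where "D = incr n (grid n s)"
  define E where "E = incr n (grid n r)"
  have inG: "P \<in> lin_span" "Q \<in> lin_span" "D \<in> lin_span" "E \<in> lin_span"
    unfolding P_def Q_def D_def E_def by (auto intro!: X_in incr_in)
  have [measurable]: "P \<in> borel_measurable M" "Q \<in> borel_measurable M" "D \<in> borel_measurable M" "E \<in> borel_measurable M"
    using inG by (auto intro: meas)
  have vP: "cov P P > 0" unfolding P_def using \<tau>0 sigma by (subst cov_X_self) auto
  let ?det = "cov P P * cov Q Q - (cov P Q)\<^sup>2"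
  let ?c = "\<sigma>\<^sup>2 * sqrt ((2 - 2 powr H) / 2) * ((1/2) powr H * (1/2) powr H)"
  let ?\<delta> = "(min s r) powr H * \<bar>s - r\<bar> powr H"
  have c0: "?c > 0" using sigma two_powr_less[OF H(2)] by simp
  have d: "?c * ?\<delta> \<le> sqrt ?det"
    unfolding P_def Q_def by (rule det_lower_bound[OF s0 r0 \<tau>0 ne mn d0 dist])
  have \<delta>0: "?\<delta> > 0" using s0 r0 d0 by simp
  have sd: "sqrt ?det > 0" using d mult_pos_pos[OF c0 \<delta>0] by linarith
  then have det: "?det > 0" by simp
  have vD: "cov D D = \<sigma>\<^sup>2" "cov E E = \<sigma>\<^sup>2" unfolding D_def E_def using cov_incr_self[OF n] by auto
  let ?h = "\<lambda>y. ennreal (h (u n * (y - x)))"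
  let ?K = "ennreal (exp (\<sigma>\<^sup>2 / 2) / (2 * pi * sqrt ?det)) * (ennreal (1 / u n) * h_mass) * (ennreal (1 / u n) * h_mass)"
  have b: "(\<integral>\<^sup>+\<omega>. ?h (P \<omega>) * ?h (Q \<omega>) * ennreal (exp (W \<omega>)) \<partial>M) \<le> ?K" if W: "W \<in> lin_span" "cov W W = \<sigma>\<^sup>2" for W
    using density_exp_bound2[OF inG(1,2) W(1) vP det, of ?h ?h] unfolding W(2) rescaled_mass[OF un] by simp
  let ?T = "\<lambda>W \<omega>. ?h (P \<omega>) * ?h (Q \<omega>) * ennreal (exp (W \<omega>))"
  let ?D = "\<lambda>\<omega>. - D \<omega>" and ?E = "\<lambda>\<omega>. - E \<omega>"
  have pt: "kernel_value b F n s \<omega> * kernel_value b' F' n r \<omega>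
     \<le> ennreal ((u n)\<^sup>2 * \<bar>C\<bar>) * (?T D \<omega> + ?T ?D \<omega> + (?T E \<omega> + ?T ?E \<omega>))" for \<omega>
  proof -
    let ?a = "h (u n * (P \<omega> - x))" and ?b = "h (u n * (Q \<omega> - x))"
    have "kernel_value b F n s \<omega> \<le> ennreal (u n * (?a * k (D \<omega>)))"
      using F un h_nonneg k_nonneg unfolding kernel_value_def dominated_kernel_def P_def[symmetric] D_def[symmetric]
      by (subst ennreal_mult) (auto intro!: mult_left_mono)
    moreover have "kernel_value b' F' n r \<omega> \<le> ennreal (u n * (?b * k (E \<omega>)))"
      using F un h_nonneg k_nonneg unfolding kernel_value_def dominated_kernel_def Q_def[symmetric] E_def[symmetric]
      by (subst ennreal_mult) (auto intro!: mult_left_mono)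
    ultimately have "kernel_value b F n s \<omega> * kernel_value b' F' n r \<omega> \<le> ennreal (u n * (?a * k (D \<omega>))) * ennreal (u n * (?b * k (E \<omega>)))"
      by (intro mult_mono) auto
    also have "\<dots> = ennreal ((u n)\<^sup>2 * (?a * ?b) * (k (D \<omega>) * k (E \<omega>)))"
      using un h_nonneg k_nonneg by (subst ennreal_mult[symmetric]) (auto simp: power2_eq_square mult_ac)
    also have "\<dots> \<le> ennreal ((u n)\<^sup>2 * (?a * ?b) * (\<bar>C\<bar> * (exp (D \<omega>) + exp (- D \<omega>) + (exp (E \<omega>) + exp (- E \<omega>)))))"
    proof (intro ennreal_leI mult_left_mono)
      have kk: "(k z)\<^sup>2 \<le> \<bar>C\<bar> * (exp z + exp (- z))" for z
      proof -
        have "0 \<le> exp z + exp (- z)" by (intro add_nonneg_nonneg) auto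
        then have "C * (exp z + exp (- z)) \<le> \<bar>C\<bar> * (exp z + exp (- z))"
          by (intro mult_right_mono) auto
        then show ?thesis using k_le[of z] by linarith
      qed
      have "2 * k (D \<omega>) * k (E \<omega>) \<le> (k (D \<omega>))\<^sup>2 + (k (E \<omega>))\<^sup>2" by (rule sum_squares_bound)
      moreover have "0 \<le> k (D \<omega>) * k (E \<omega>)" using k_nonneg by simp
      ultimately have "k (D \<omega>) * k (E \<omega>) \<le> (k (D \<omega>))\<^sup>2 + (k (E \<omega>))\<^sup>2" by linarith
      also have "\<dots> \<le> \<bar>C\<bar> * (exp (D \<omega>) + exp (- D \<omega>)) + \<bar>C\<bar> * (exp (E \<omega>) + exp (- E \<omega>))"
        by (intro add_mono kk)
      finally show "k (D \<omega>) * k (E \<omega>) \<le> \<bar>C\<bar> * (exp (D \<omega>) + exp (- D \<omega>) + (exp (E \<omega>) + exp (- E \<omega>)))"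
        by (simp add: distrib_left)
      show "0 \<le> (u n)\<^sup>2 * (?a * ?b)" using h_nonneg by simp
    qed
    also have "\<dots> = ennreal ((u n)\<^sup>2 * \<bar>C\<bar>) * (?T D \<omega> + ?T ?D \<omega> + (?T E \<omega> + ?T ?E \<omega>))"
    proof -
      have T: "?h (P \<omega>) * ?h (Q \<omega>) * ennreal e = ennreal (?a * ?b * e)" if "0 \<le> e" for e
        using that h_nonneg by (simp add: ennreal_mult)
      have "?T D \<omega> + ?T ?D \<omega> + (?T E \<omega> + ?T ?E \<omega>) = ennreal (?a * ?b * exp (D \<omega>) + ?a * ?b * exp (- D \<omega>) + (?a * ?b * exp (E \<omega>) + ?a * ?b * exp (- E \<omega>)))"
        using h_nonneg by (simp add: T ennreal_plus)
      then show ?thesis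
        using h_nonneg by (simp add: ennreal_mult'[symmetric] distrib_left mult_ac)
    qed
    finally show ?thesis .
  qed
  have "(\<integral>\<^sup>+\<omega>. kernel_value b F n s \<omega> * kernel_value b' F' n r \<omega> \<partial>M)
     \<le> (\<integral>\<^sup>+\<omega>. ennreal ((u n)\<^sup>2 * \<bar>C\<bar>) * (?T D \<omega> + ?T ?D \<omega> + (?T E \<omega> + ?T ?E \<omega>)) \<partial>M)"
    by (rule nn_integral_mono) (rule pt)
  also have "\<dots> = ennreal ((u n)\<^sup>2 * \<bar>C\<bar>) * ((\<integral>\<^sup>+\<omega>. ?T D \<omega> \<partial>M) + (\<integral>\<^sup>+\<omega>. ?T ?D \<omega> \<partial>M) + ((\<integral>\<^sup>+\<omega>. ?T E \<omega> \<partial>M) + (\<integral>\<^sup>+\<omega>. ?T ?E \<omega> \<partial>M)))"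
    by (subst nn_integral_cmult) (simp_all add: nn_integral_add)
  also have "\<dots> \<le> ennreal ((u n)\<^sup>2 * \<bar>C\<bar>) * (?K + ?K + (?K + ?K))"
    by (intro mult_left_mono add_mono b inG neg_in) (simp_all add: cov_neg vD)
  also have "\<dots> = (ennreal ((u n)\<^sup>2 * \<bar>C\<bar>) * ennreal 4 * ennreal (exp (\<sigma>\<^sup>2 / 2) / (2 * pi * sqrt ?det)) * ennreal (1 / u n * (1 / u n))) * (h_mass * h_mass)"
  proof -
    have 4: "z + z + (z + z) = ennreal 4 * z" for z :: ennreal
      by (simp add: mult_2[symmetric] mult.assoc[symmetric])
    show ?thesis unfolding 4 using un by (simp only: ennreal_mult zero_le_divide_1_iff less_imp_le mult_ac)
  qed
  also have "ennreal ((u n)\<^sup>2 * \<bar>C\<bar>) * ennreal 4 * ennreal (exp (\<sigma>\<^sup>2 / 2) / (2 * pi * sqrt ?det)) * ennreal (1 / u n * (1 / u n))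
     = ennreal ((4 * \<bar>C\<bar> * exp (\<sigma>\<^sup>2 / 2)) / (2 * pi * sqrt ?det))"
    using un sd by (subst ennreal_mult4) (auto simp: power2_eq_square)
  also have "\<dots> * (h_mass * h_mass) \<le> ennreal ((4 * \<bar>C\<bar> * exp (\<sigma>\<^sup>2 / 2)) / (2 * pi * (?c * ?\<delta>))) * (h_mass * h_mass)"
    using d sd mult_pos_pos[OF c0 \<delta>0] two_powr_less[OF H(2)] by (intro mult_right_mono ennreal_leI divide_left_mono mult_left_mono mult_pos_pos) auto
  also have "(4 * \<bar>C\<bar> * exp (\<sigma>\<^sup>2 / 2)) / (2 * pi * (?c * ?\<delta>)) = (4 * \<bar>C\<bar> * exp (\<sigma>\<^sup>2 / 2)) / (2 * pi * ?c) * ((min s r) powr (- H) * \<bar>s - r\<bar> powr (- H))"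
    by (simp only: powr_minus_divide times_divide_eq_right times_divide_eq_left divide_divide_eq_left mult_1_right mult_ac)
  also have "ennreal \<dots> * (h_mass * h_mass) = pair_const * ennreal ((min s r) powr (- H) * \<bar>s - r\<bar> powr (- H))"
    unfolding pair_const_def using c0 by (subst ennreal_mult) (auto simp: mult_ac)
  finally show ?thesis .
qed

lemma k_le_exp: "k z \<le> (1 + \<bar>C\<bar>) * (exp z + exp (- z))"
proof -
  have e: "1 \<le> exp z + exp (- z)"
    using exp_ge_zero[of z] exp_ge_zero[of "- z"] one_le_exp_iff[of z] one_le_exp_iff[of "- z"]
    by (cases "0 \<le> z") linarith+
  have "2 * k z * 1 \<le> (k z)\<^sup>2 + 1\<^sup>2" by (rule sum_squares_bound)
  then have "k z \<le> 1 + (k z)\<^sup>2" using k_nonneg[of z] by simp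
  also have "\<dots> \<le> (exp z + exp (- z)) + \<bar>C\<bar> * (exp z + exp (- z))"
  proof (rule add_mono[OF e])
    have "C * (exp z + exp (- z)) \<le> \<bar>C\<bar> * (exp z + exp (- z))"
      using e by (intro mult_right_mono) auto
    then show "(k z)\<^sup>2 \<le> \<bar>C\<bar> * (exp z + exp (- z))" using k_le[of z] by linarith
  qed
  finally show ?thesis by (simp add: distrib_right)
qed

text \<open>
  The joint density of \<open>(X\<^sub>s, X\<^sub>r)\<close> at \<open>(x, x)\<close>, as the density of \<open>X\<^sub>s\<close> times the conditional
  density of \<open>X\<^sub>r\<close>.
\<close>

definition pair_density :: "real \<Rightarrow> real \<Rightarrow> real" where
  "pair_density s r = normal_density 0 (sqrt (fbm_cov \<sigma> H s s)) x *
     normal_density 0 (sqrt (fbm_cov \<sigma> H r r - (fbm_cov \<sigma> H r s)\<^sup>2 / fbm_cov \<sigma> H s s))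
       (x - fbm_cov \<sigma> H r s / fbm_cov \<sigma> H s s * x)"

lemma pair_density_measurable[measurable]: "(\<lambda>p. pair_density (fst p) (snd p)) \<in> borel_measurable (borel \<Otimes>\<^sub>M borel)"
  unfolding pair_density_def normal_density_def fbm_cov_def by measurable

lemma kernel_pair_tendsto:
  assumes F: "dominated_kernel F" "dominated_kernel F'" and s: "0 < s" and r: "0 < r" and ne: "s \<noteq> r"
  shows "(\<lambda>n. \<integral>\<^sup>+\<omega>. kernel_value b F n s \<omega> * kernel_value b' F' n r \<omega> \<partial>M)
    \<longlonglongrightarrow> ennreal (pair_density s r) * kernel_mass (\<sigma>\<^sup>2) F * kernel_mass (\<sigma>\<^sup>2) F'"
proof -
  have s': "0 \<le> s" and r': "0 \<le> r" using s r by auto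
  have const: "(\<lambda>n. cov (incr n (grid n q)) (incr n (grid n q))) \<longlonglongrightarrow> \<sigma>\<^sup>2" for q
    by (rule tendsto_eventually) (auto intro!: eventually_sequentiallyI[of 1] cov_incr_self)
  note st = sample_time_tendsto[OF s', of b] and rt = sample_time_tendsto[OF r', of b']
  have k: "0 < (2 - 2 powr H) / 2" using two_powr_less[OF H(2)] by simp
  have "0 < \<sigma>^4 * ((2 - 2 powr H) / 2) * ((min s r) powr (2 * H) * \<bar>r - s\<bar> powr (2 * H))"
    using s r ne sigma k by (intro mult_pos_pos) auto
  also have "\<dots> \<le> fbm_cov \<sigma> H s s * fbm_cov \<sigma> H r r - (fbm_cov \<sigma> H s r)\<^sup>2"
    using s r ne H by (intro fbm_cov_det) auto
  finally have det: "0 < fbm_cov \<sigma> H s s * fbm_cov \<sigma> H r r - (fbm_cov \<sigma> H r s)\<^sup>2"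
    by (simp add: fbm_cov_def abs_minus_commute add.commute)
  have v: "0 < fbm_cov \<sigma> H s s" using s sigma by (simp add: fbm_cov_def)
  have sw: "(\<lambda>n. cov (P n) (Q n)) \<longlonglongrightarrow> l \<Longrightarrow> (\<lambda>n. cov (Q n) (P n)) \<longlonglongrightarrow> l" for P Q l
    by (simp add: cov_sym)
  have "(\<lambda>n. \<integral>\<^sup>+\<omega>. ennreal ((u n)\<^sup>2) * (F (u n * (X (sample_time b n s) \<omega> - x), incr n (grid n s) \<omega>) *
        F' (u n * (X (sample_time b' n r) \<omega> - x), incr n (grid n r) \<omega>)) \<partial>M)
    \<longlonglongrightarrow> ennreal (pair_density s r) * kernel_mass (\<sigma>\<^sup>2) F * kernel_mass (\<sigma>\<^sup>2) F'"
    unfolding pair_density_def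
  proof (rule kernel_pair_limit[where h=h and k=k and C="1 + \<bar>C\<bar>"])
    show "(\<lambda>n. cov (X (sample_time b n s)) (X (sample_time b n s))) \<longlonglongrightarrow> fbm_cov \<sigma> H s s"
      by (rule tendsto_cov_X[OF st st]) auto
    show "(\<lambda>n. cov (X (sample_time b' n r)) (X (sample_time b' n r))) \<longlonglongrightarrow> fbm_cov \<sigma> H r r"
      by (rule tendsto_cov_X[OF rt rt]) auto
    show "(\<lambda>n. cov (X (sample_time b' n r)) (X (sample_time b n s))) \<longlonglongrightarrow> fbm_cov \<sigma> H r s"
      by (rule tendsto_cov_X[OF rt st]) auto
    show "(\<lambda>n. cov (incr n (grid n r)) (incr n (grid n s))) \<longlonglongrightarrow> 0"
      by (rule tendsto_cov_incr_incr[OF r' s']) (use ne in auto)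
    show "(\<lambda>n. cov (X (sample_time b n s)) (incr n (grid n s))) \<longlonglongrightarrow> 0"
      by (rule sw, rule tendsto_cov_incr_X[OF s' st]) auto
    show "(\<lambda>n. cov (X (sample_time b n s)) (incr n (grid n r))) \<longlonglongrightarrow> 0"
      by (rule sw, rule tendsto_cov_incr_X[OF r' st]) auto
    show "(\<lambda>n. cov (X (sample_time b' n r)) (incr n (grid n s))) \<longlonglongrightarrow> 0"
      by (rule sw, rule tendsto_cov_incr_X[OF s' rt]) auto
    show "(\<lambda>n. cov (X (sample_time b' n r)) (incr n (grid n r))) \<longlonglongrightarrow> 0"
      by (rule sw, rule tendsto_cov_incr_X[OF r' rt]) auto
  qed (use F u_top h_fin k_le_exp h_nonneg k_nonneg det v sigma const in \<open>auto simp: dominated_kernel_def intro!: X_in incr_in\<close>)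
  then show ?thesis
  proof (rule Lim_transform_eventually)
    show "\<forall>\<^sub>F n in sequentially. (\<integral>\<^sup>+\<omega>. ennreal ((u n)\<^sup>2) * (F (u n * (X (sample_time b n s) \<omega> - x), incr n (grid n s) \<omega>) *
        F' (u n * (X (sample_time b' n r) \<omega> - x), incr n (grid n r) \<omega>)) \<partial>M)
      = (\<integral>\<^sup>+\<omega>. kernel_value b F n s \<omega> * kernel_value b' F' n r \<omega> \<partial>M)"
    proof (rule eventually_sequentiallyI[of 1])
      fix n :: nat assume "1 \<le> n"
      then have "ennreal ((u n)\<^sup>2) = ennreal (u n) * ennreal (u n)"
        using u_pos[of n] by (simp add: power2_eq_square ennreal_mult)
      then show "(\<integral>\<^sup>+\<omega>. ennreal ((u n)\<^sup>2) * (F (u n * (X (sample_time b n s) \<omega> - x), incr n (grid n s) \<omega>) *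
        F' (u n * (X (sample_time b' n r) \<omega> - x), incr n (grid n r) \<omega>)) \<partial>M)
      = (\<integral>\<^sup>+\<omega>. kernel_value b F n s \<omega> * kernel_value b' F' n r \<omega> \<partial>M)"
        unfolding kernel_value_def by (simp only: mult_ac)
    qed
  qed
qed

text \<open>
  The range of integration that corresponds to the summands \<open>1 \<le> i \<le> [n t]\<close>. The summand \<open>i = 0\<close> is
  kept apart, since \<open>X\<^sub>0 = 0\<close> has no density.
\<close>

definition window :: "nat \<Rightarrow> real \<Rightarrow> real set" where
  "window n t = {1 / real n..<(real (grid n t) + 1) / real n}"

lemma window_borel[measurable]: "window n t \<in> sets borel"
  unfolding window_def by simp

lemma window_subset:
  assumes "n \<ge> 1" "t \<ge> 0" "s \<in> window n t"
  shows "0 < s" "1 / real n \<le> s" "s < t + 1"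
proof -
  have n: "0 < 1 / real n" "1 / real n \<le> 1" using assms by auto
  show "1 / real n \<le> s" using assms by (simp add: window_def)
  then show "0 < s" using n by linarith
  have "s < real (grid n t) / real n + 1 / real n" using assms by (simp add: window_def add_divide_distrib)
  then show "s < t + 1" using grid_bounds(1)[OF assms(1,2)] n by linarith
qed

lemma indicator_window_tendsto:
  assumes t: "t \<ge> 0"
  shows "\<forall>\<^sub>F n in sequentially. indicator (window n t) s = (indicator {0<..t} s :: ennreal)"
proof -
  consider "s \<le> 0" | "0 < s" "s \<le> t" | "t < s" by linarith
  then show ?thesis
  proof cases
    case 1
    show ?thesis
    proof (rule eventually_sequentiallyI[of 1])
      fix n :: nat assume n: "1 \<le> n"
      then have "s \<notin> window n t" using window_subset(1)[OF n t, of s] 1 by auto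
      then show "indicator (window n t) s = (indicator {0<..t} s :: ennreal)" using 1 by simp
    qed
  next
    case 2
    have "\<forall>\<^sub>F n in sequentially. 1 / real n < s" by (rule order_tendstoD(2)[OF lim_1_over_n 2(1)])
    then show ?thesis using eventually_ge_at_top[of 1]
    proof eventually_elim
      case (elim n)
      have "s < (real (grid n t) + 1) / real n"
        using grid_bounds(2)[OF elim(2) t] 2 by (simp add: add_divide_distrib)
      then show ?case using elim 2 by (simp add: window_def)
    qed
  next
    case 3
    have "(\<lambda>n. real (grid n t) / real n + 1 / real n) \<longlonglongrightarrow> t + 0"
      by (intro tendsto_add grid_tendsto t lim_1_over_n)
    then have "\<forall>\<^sub>F n in sequentially. real (grid n t) / real n + 1 / real n < s"
      by (rule order_tendstoD(2)) (use 3 in simp)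
    then show ?thesis
      by eventually_elim (use 3 in \<open>simp add: window_def add_divide_distrib\<close>)
  qed
qed

definition kernel_integral :: "bool \<Rightarrow> (real \<times> real \<Rightarrow> ennreal) \<Rightarrow> nat \<Rightarrow> real \<Rightarrow> 'a \<Rightarrow> ennreal" where
  "kernel_integral b F n t \<omega> = (\<integral>\<^sup>+s. kernel_value b F n s \<omega> * indicator (window n t) s \<partial>lborel)"

definition pair_moment :: "bool \<Rightarrow> (real \<times> real \<Rightarrow> ennreal) \<Rightarrow> bool \<Rightarrow> (real \<times> real \<Rightarrow> ennreal) \<Rightarrow> nat \<Rightarrow> real \<Rightarrow> real \<Rightarrow> ennreal" where
  "pair_moment b F b' F' n s r = (\<integral>\<^sup>+\<omega>. kernel_value b F n s \<omega> * kernel_value b' F' n r \<omega> \<partial>M)"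

lemma kernel_integral_measurable[measurable]:
  assumes F: "dominated_kernel F"
  shows "kernel_integral b F n t \<in> borel_measurable M"
  unfolding kernel_integral_def
proof (rule lborel.borel_measurable_nn_integral)
  show "(\<lambda>(\<omega>, s). kernel_value b F n s \<omega> * indicator (window n t) s) \<in> borel_measurable (M \<Otimes>\<^sub>M lborel)"
    unfolding case_prod_beta
    by (intro borel_measurable_times_ennreal kernel_value_measurable2[OF F]) measurable
qed

lemma pair_moment_measurable:
  assumes F: "dominated_kernel F" "dominated_kernel F'"
  shows "(\<lambda>(s, r). pair_moment b F b' F' n s r) \<in> borel_measurable (borel \<Otimes>\<^sub>M borel)"
proof -
  have "(\<lambda>p. pair_moment b F b' F' n (fst p) (snd p)) \<in> borel_measurable (borel \<Otimes>\<^sub>M borel)"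
    unfolding pair_moment_def
  proof (rule borel_measurable_nn_integral)
    show "(\<lambda>(p, \<omega>). kernel_value b F n (fst p) \<omega> * kernel_value b' F' n (snd p) \<omega>) \<in> borel_measurable ((borel \<Otimes>\<^sub>M borel) \<Otimes>\<^sub>M M)"
      unfolding case_prod_beta
      by (intro borel_measurable_times_ennreal kernel_value_measurable2[OF F(1)] kernel_value_measurable2[OF F(2)]) measurable
  qed
  then show ?thesis by (simp add: case_prod_beta)
qed

lemma kernel_integral_product:
  assumes F: "dominated_kernel F" "dominated_kernel F'"
  shows "(\<integral>\<^sup>+\<omega>. kernel_integral b F n t \<omega> * kernel_integral b' F' n t \<omega> \<partial>M)
    = (\<integral>\<^sup>+p. pair_moment b F b' F' n (fst p) (snd p) * (indicator (window n t) (fst p) * indicator (window n t) (snd p)) \<partial>(lborel \<Otimes>\<^sub>M lborel))"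
proof -
  interpret LM: pair_sigma_finite lborel M ..
  let ?I = "\<lambda>s. indicator (window n t) s :: ennreal"
  let ?Z = "\<lambda>s \<omega>. kernel_value b F n s \<omega> * ?I s" and ?Z' = "\<lambda>s \<omega>. kernel_value b' F' n s \<omega> * ?I s"
  have Zs: "(\<lambda>s. ?Z s \<omega>) \<in> borel_measurable lborel" "(\<lambda>s. ?Z' s \<omega>) \<in> borel_measurable lborel" if "\<omega> \<in> space M" for \<omega>
    using that by (intro borel_measurable_times_ennreal kernel_value_measurable2[OF F(1)] kernel_value_measurable2[OF F(2)]; measurable)+
  have Z\<omega>: "(\<lambda>\<omega>. ?Z s \<omega>) \<in> borel_measurable M" "(\<lambda>\<omega>. ?Z' s \<omega>) \<in> borel_measurable M" for s
    by (intro borel_measurable_times_ennreal kernel_value_measurable2[OF F(1)] kernel_value_measurable2[OF F(2)]; measurable)+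
  have m1: "case_prod (\<lambda>s \<omega>. ?Z s \<omega> * kernel_integral b' F' n t \<omega>) \<in> borel_measurable (lborel \<Otimes>\<^sub>M M)"
    unfolding case_prod_beta
    by (intro borel_measurable_times_ennreal kernel_value_measurable2[OF F(1)] measurable_compose[OF measurable_snd kernel_integral_measurable[OF F(2)]]) measurable
  have m2: "case_prod (\<lambda>r \<omega>. ?Z s \<omega> * ?Z' r \<omega>) \<in> borel_measurable (lborel \<Otimes>\<^sub>M M)" for s
    unfolding case_prod_beta
    by (intro borel_measurable_times_ennreal kernel_value_measurable2[OF F(1)] kernel_value_measurable2[OF F(2)]) measurable
  have m3: "(\<lambda>p. pair_moment b F b' F' n (fst p) (snd p) * (?I (fst p) * ?I (snd p))) \<in> borel_measurable (lborel \<Otimes>\<^sub>M lborel)"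
    using pair_moment_measurable[OF F, of b b' n] by (simp add: case_prod_beta)
  have "(\<integral>\<^sup>+\<omega>. kernel_integral b F n t \<omega> * kernel_integral b' F' n t \<omega> \<partial>M)
      = (\<integral>\<^sup>+\<omega>. \<integral>\<^sup>+s. ?Z s \<omega> * kernel_integral b' F' n t \<omega> \<partial>lborel \<partial>M)"
    unfolding kernel_integral_def[of b F]
    by (rule nn_integral_cong) (rule nn_integral_multc[symmetric, OF Zs(1)])
  also have "\<dots> = (\<integral>\<^sup>+s. \<integral>\<^sup>+\<omega>. ?Z s \<omega> * kernel_integral b' F' n t \<omega> \<partial>M \<partial>lborel)"
    by (rule LM.Fubini'[OF m1])
  also have "\<dots> = (\<integral>\<^sup>+s. \<integral>\<^sup>+\<omega>. \<integral>\<^sup>+r. ?Z s \<omega> * ?Z' r \<omega> \<partial>lborel \<partial>M \<partial>lborel)"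
    unfolding kernel_integral_def
    by (rule nn_integral_cong, rule nn_integral_cong) (rule nn_integral_cmult[symmetric, OF Zs(2)])
  also have "\<dots> = (\<integral>\<^sup>+s. \<integral>\<^sup>+r. \<integral>\<^sup>+\<omega>. ?Z s \<omega> * ?Z' r \<omega> \<partial>M \<partial>lborel \<partial>lborel)"
    by (rule nn_integral_cong) (rule LM.Fubini'[OF m2])
  also have "\<dots> = (\<integral>\<^sup>+s. \<integral>\<^sup>+r. pair_moment b F b' F' n s r * (?I s * ?I r) \<partial>lborel \<partial>lborel)"
  proof (intro nn_integral_cong)
    fix s r
    have [measurable]: "kernel_value b F n s \<in> borel_measurable M" "kernel_value b' F' n r \<in> borel_measurable M"
      by (intro kernel_value_measurable2[OF F(1)] kernel_value_measurable2[OF F(2)]; measurable)+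
    have "(\<integral>\<^sup>+\<omega>. ?Z s \<omega> * ?Z' r \<omega> \<partial>M) = (\<integral>\<^sup>+\<omega>. (kernel_value b F n s \<omega> * kernel_value b' F' n r \<omega>) * (?I s * ?I r) \<partial>M)"
      by (simp only: mult_ac)
    also have "\<dots> = pair_moment b F b' F' n s r * (?I s * ?I r)"
      unfolding pair_moment_def by (rule nn_integral_multc) measurable
    finally show "(\<integral>\<^sup>+\<omega>. ?Z s \<omega> * ?Z' r \<omega> \<partial>M) = pair_moment b F b' F' n s r * (?I s * ?I r)" .
  qed
  also have "\<dots> = (\<integral>\<^sup>+p. pair_moment b F b' F' n (fst p) (snd p) * (?I (fst p) * ?I (snd p)) \<partial>(lborel \<Otimes>\<^sub>M lborel))"
    using lborel.nn_integral_fst[OF m3] by simp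
  finally show ?thesis .
qed

text \<open>
  This is the second moment of \<open>L\<^sub>t(x)\<close>. The diagonal, a null set where \<open>pair_density\<close> takes no
  meaningful value, is cut out.
\<close>

definition local_time_moment :: "real \<Rightarrow> ennreal" where
  "local_time_moment t = (\<integral>\<^sup>+p. ennreal (pair_density (fst p) (snd p)) *
     (indicator {0<..t} (fst p) * indicator {0<..t} (snd p) * indicator {p. fst p \<noteq> snd p} p) \<partial>(lborel \<Otimes>\<^sub>M lborel))"

text \<open>
  Since \<open>(min s r) powr (-H) \<le> s powr (-H) + r powr (-H)\<close>, the bound of \<open>kernel_pair_bound\<close> is replaced by
  products of functions of one variable, whose integrals separate after a shift.
\<close>

definition dominating :: "real \<Rightarrow> real \<times> real \<Rightarrow> ennreal" where
  "dominating t p = pair_const * ((cut_power H (t + 1) (fst p) + cut_power H (t + 1) (snd p)) * cut_power H (t + 1) (fst p - snd p))"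

lemma dominating_measurable[measurable]: "dominating t \<in> borel_measurable (borel \<Otimes>\<^sub>M borel)"
  unfolding dominating_def by measurable

lemma lborel2_Fubini:
  fixes f :: "real \<Rightarrow> real \<Rightarrow> ennreal"
  assumes "case_prod f \<in> borel_measurable (lborel \<Otimes>\<^sub>M lborel)"
  shows "(\<integral>\<^sup>+p. f (fst p) (snd p) \<partial>(lborel \<Otimes>\<^sub>M lborel)) = (\<integral>\<^sup>+s. \<integral>\<^sup>+r. f s r \<partial>lborel \<partial>lborel)"
    and "(\<integral>\<^sup>+p. f (fst p) (snd p) \<partial>(lborel \<Otimes>\<^sub>M lborel)) = (\<integral>\<^sup>+r. \<integral>\<^sup>+s. f s r \<partial>lborel \<partial>lborel)"
proof -
  show 1: "(\<integral>\<^sup>+p. f (fst p) (snd p) \<partial>(lborel \<Otimes>\<^sub>M lborel)) = (\<integral>\<^sup>+s. \<integral>\<^sup>+r. f s r \<partial>lborel \<partial>lborel)"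
    using lborel.nn_integral_fst[OF assms] by (simp add: case_prod_beta')
  show "(\<integral>\<^sup>+p. f (fst p) (snd p) \<partial>(lborel \<Otimes>\<^sub>M lborel)) = (\<integral>\<^sup>+r. \<integral>\<^sup>+s. f s r \<partial>lborel \<partial>lborel)"
    unfolding 1 by (rule lborel_pair.Fubini'[OF assms, symmetric])
qed

lemma dominating_finite:
  assumes "t \<ge> 0"
  shows "(\<integral>\<^sup>+p. dominating t p \<partial>(lborel \<Otimes>\<^sub>M lborel)) < \<infinity>"
proof -
  let ?w = "cut_power H (t + 1)"
  let ?Q = "\<integral>\<^sup>+v. ?w v \<partial>lborel"
  have Q: "?Q < \<infinity>" using nn_integral_cut_power_finite[OF H(2), of "t + 1"] assms by simp
  have 1: "(\<integral>\<^sup>+p. ?w (fst p) * ?w (fst p - snd p) \<partial>(lborel \<Otimes>\<^sub>M lborel)) = ?Q * ?Q"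
    by (subst lborel2_Fubini(1)[of "\<lambda>s r. ?w s * ?w (s - r)"])
      (simp_all add: nn_integral_cmult nn_integral_multc nn_integral_reflect_shift)
  have 2: "(\<integral>\<^sup>+p. ?w (snd p) * ?w (fst p - snd p) \<partial>(lborel \<Otimes>\<^sub>M lborel)) = ?Q * ?Q"
    by (subst lborel2_Fubini(2)[of "\<lambda>s r. ?w r * ?w (s - r)"])
      (simp_all add: nn_integral_cmult nn_integral_multc nn_integral_shift[symmetric])
  have "(\<integral>\<^sup>+p. dominating t p \<partial>(lborel \<Otimes>\<^sub>M lborel))
    = pair_const * ((\<integral>\<^sup>+p. ?w (fst p) * ?w (fst p - snd p) \<partial>(lborel \<Otimes>\<^sub>M lborel)) + (\<integral>\<^sup>+p. ?w (snd p) * ?w (fst p - snd p) \<partial>(lborel \<Otimes>\<^sub>M lborel)))"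
    unfolding dominating_def distrib_right by (simp add: nn_integral_cmult nn_integral_add)
  also have "\<dots> < \<infinity>" unfolding 1 2 using Q pair_const_finite by (simp add: ennreal_mult_less_top)
  finally show ?thesis .
qed

definition square_const :: ennreal where
  "square_const = ennreal (2 * \<bar>S\<bar> * \<bar>C\<bar> * exp (\<sigma>\<^sup>2 / 2) / (\<sigma> * (1/2) powr H)) * h_mass"

lemma cut_power_window:
  assumes "n \<ge> 1" "t \<ge> 0" "s \<in> window n t"
  shows "ennreal (s powr (- H)) = cut_power H (t + 1) s"
  using window_subset[OF assms] assms(2) by (simp add: cut_power_def)

lemma kernel_pair_dominated:
  assumes F: "dominated_kernel F" "dominated_kernel F'" and n: "n \<ge> 1" and t: "t \<ge> 0"
    and s: "s \<in> window n t" and r: "r \<in> window n t" and sr: "2 / real n \<le> \<bar>s - r\<bar>"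
  shows "pair_moment b F b' F' n s r \<le> dominating t (s, r)"
proof -
  note sb = window_subset[OF n t s] and rb = window_subset[OF n t r]
  have "pair_moment b F b' F' n s r \<le> pair_const * ennreal ((min s r) powr (- H) * \<bar>s - r\<bar> powr (- H))"
    unfolding pair_moment_def by (rule kernel_pair_bound[OF F n sb(2) rb(2) sr])
  also have "ennreal ((min s r) powr (- H) * \<bar>s - r\<bar> powr (- H)) = ennreal ((min s r) powr (- H)) * cut_power H (t + 1) (s - r)"
    using sb rb by (auto simp: ennreal_mult cut_power_def indicator_def)
  also have "ennreal ((min s r) powr (- H)) \<le> cut_power H (t + 1) s + cut_power H (t + 1) r"
    using cut_power_window[OF n t s] cut_power_window[OF n t r] by (simp add: min_def)
  finally show ?thesis
    unfolding dominating_def by (simp add: mult_left_mono mult_right_mono)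
qed

text \<open>
  \<open>a * b \<le> a\<^sup>2 + b\<^sup>2\<close> reduces the bound near the diagonal to the case of a single time.
\<close>

lemma kernel_pair_near:
  assumes F: "dominated_kernel F" "dominated_kernel F'" and n: "n \<ge> 1" and t: "t \<ge> 0"
    and s: "s \<in> window n t" and r: "r \<in> window n t"
  shows "pair_moment b F b' F' n s r \<le> square_const * ennreal (u n) * (cut_power H (t + 1) s + cut_power H (t + 1) r)"
proof -
  note sb = window_subset[OF n t s] and rb = window_subset[OF n t r]
  have [measurable]: "kernel_value b F n s \<in> borel_measurable M" "kernel_value b' F' n r \<in> borel_measurable M"
    by (intro kernel_value_measurable2[OF F(1)] kernel_value_measurable2[OF F(2)]; measurable)+
  have "pair_moment b F b' F' n s r \<le> (\<integral>\<^sup>+\<omega>. kernel_value b F n s \<omega> * kernel_value b F n s \<omega>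
      + kernel_value b' F' n r \<omega> * kernel_value b' F' n r \<omega> \<partial>M)"
    unfolding pair_moment_def by (intro nn_integral_mono ennreal_mult_le_squares)
  also have "\<dots> = (\<integral>\<^sup>+\<omega>. kernel_value b F n s \<omega> * kernel_value b F n s \<omega> \<partial>M)
      + (\<integral>\<^sup>+\<omega>. kernel_value b' F' n r \<omega> * kernel_value b' F' n r \<omega> \<partial>M)"
    by (rule nn_integral_add) measurable
  also have "\<dots> \<le> square_const * ennreal (u n) * ennreal (s powr (- H)) + square_const * ennreal (u n) * ennreal (r powr (- H))"
    unfolding square_const_def
    by (intro add_mono kernel_square_bound F n sb rb)
  also have "\<dots> = square_const * ennreal (u n) * (cut_power H (t + 1) s + cut_power H (t + 1) r)"
    unfolding cut_power_window[OF n t s] cut_power_window[OF n t r] by (simp add: distrib_left)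
  finally show ?thesis .
qed

text \<open>
  The square is split at distance \<open>2 / n\<close> from the diagonal. Away from the diagonal dominated
  convergence applies. Close to it the integrand is of order \<open>u n\<close> on a strip of width
  \<open>4 / n\<close>, and \<open>u n / n\<close> tends to zero by hypothesis.
\<close>

lemma kernel_integral_moment_tendsto:
  assumes F: "dominated_kernel F" "dominated_kernel F'" and t: "t \<ge> 0"
  shows "(\<lambda>n. \<integral>\<^sup>+\<omega>. kernel_integral b F n t \<omega> * kernel_integral b' F' n t \<omega> \<partial>M)
    \<longlonglongrightarrow> local_time_moment t * (kernel_mass (\<sigma>\<^sup>2) F * kernel_mass (\<sigma>\<^sup>2) F')"
proof -
  let ?E = "\<lambda>n p. pair_moment b F b' F' n (fst p) (snd p)"
  let ?I = "\<lambda>n p. indicator (window n t) (fst p) * indicator (window n t) (snd p) :: ennreal"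
  let ?far = "\<lambda>n. {p :: real \<times> real. 2 / real n \<le> \<bar>fst p - snd p\<bar>}"
  let ?near = "\<lambda>n. {p :: real \<times> real. \<bar>fst p - snd p\<bar> < 2 / real n}"
  let ?L2 = "lborel \<Otimes>\<^sub>M (lborel :: real measure)"
  have E[measurable]: "(\<lambda>p. ?E n p) \<in> borel_measurable ?L2" for n
    using pair_moment_measurable[OF F, of b b' n] by (simp add: case_prod_beta)
  have I[measurable]: "(\<lambda>p. ?I n p) \<in> borel_measurable ?L2" for n by measurable
  have far[measurable]: "?far n \<in> sets ?L2" and near[measurable]: "?near n \<in> sets ?L2" for n
  proof -
    have "?far n = {p \<in> space ?L2. 2 / real n \<le> \<bar>fst p - snd p\<bar>}" "?near n = {p \<in> space ?L2. \<bar>fst p - snd p\<bar> < 2 / real n}"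
      by (auto simp: space_pair_measure)
    moreover have "{p \<in> space ?L2. 2 / real n \<le> \<bar>fst p - snd p\<bar>} \<in> sets ?L2" "{p \<in> space ?L2. \<bar>fst p - snd p\<bar> < 2 / real n} \<in> sets ?L2"
      by measurable
    ultimately show "?far n \<in> sets ?L2" "?near n \<in> sets ?L2" by auto
  qed
  (* Far from and close to the diagonal, relative to the grid size. *)
  have split: "(\<integral>\<^sup>+\<omega>. kernel_integral b F n t \<omega> * kernel_integral b' F' n t \<omega> \<partial>M)
    = (\<integral>\<^sup>+p. ?E n p * ?I n p * indicator (?far n) p \<partial>?L2) + (\<integral>\<^sup>+p. ?E n p * ?I n p * indicator (?near n) p \<partial>?L2)" for n
    unfolding kernel_integral_product[OF F]
    by (subst nn_integral_add[symmetric]) (auto intro!: nn_integral_cong simp: indicator_def)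
  let ?l = "\<lambda>p. ennreal (pair_density (fst p) (snd p)) * kernel_mass (\<sigma>\<^sup>2) F * kernel_mass (\<sigma>\<^sup>2) F' *
     (indicator {0<..t} (fst p) * indicator {0<..t} (snd p) * indicator {p. fst p \<noteq> snd p} p)"
  have ne_meas[measurable]: "{p :: real \<times> real. fst p \<noteq> snd p} \<in> sets ?L2"
  proof -
    have "{p :: real \<times> real. fst p \<noteq> snd p} = {p \<in> space ?L2. fst p \<noteq> snd p}" by (auto simp: space_pair_measure)
    also have "\<dots> \<in> sets ?L2" by measurable
    finally show ?thesis .
  qed
  have pd[measurable]: "(\<lambda>p. pair_density (fst p) (snd p)) \<in> borel_measurable ?L2"
    using pair_density_measurable by simp
  have dom[measurable]: "dominating t \<in> borel_measurable ?L2" using dominating_measurable by simp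
  (* Indices are shifted by one because the domination holds for n >= 1. *)
  have "(\<lambda>n. \<integral>\<^sup>+p. ?E (Suc n) p * ?I (Suc n) p * indicator (?far (Suc n)) p \<partial>?L2) \<longlonglongrightarrow> (\<integral>\<^sup>+p. ?l p \<partial>?L2)"
  proof (rule nn_integral_dominated_convergence[where w="dominating t"])
    show "AE p in ?L2. ?E (Suc j) p * ?I (Suc j) p * indicator (?far (Suc j)) p \<le> dominating t p" for j
    proof (rule AE_I2)
      fix p :: "real \<times> real"
      have "pair_moment b F b' F' (Suc j) (fst p) (snd p) \<le> dominating t (fst p, snd p)"
        if "fst p \<in> window (Suc j) t" "snd p \<in> window (Suc j) t" "2 / real (Suc j) \<le> \<bar>fst p - snd p\<bar>"
        using that by (intro kernel_pair_dominated[OF F _ t]) auto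
      then show "?E (Suc j) p * ?I (Suc j) p * indicator (?far (Suc j)) p \<le> dominating t p"
        by (auto simp: indicator_def)
    qed
    show "(\<integral>\<^sup>+p. dominating t p \<partial>?L2) < \<infinity>" by (rule dominating_finite[OF t])
    show "AE p in ?L2. (\<lambda>n. ?E (Suc n) p * ?I (Suc n) p * indicator (?far (Suc n)) p) \<longlonglongrightarrow> ?l p"
    proof (rule AE_I2)
      fix p :: "real \<times> real"
      have "(\<lambda>n. ?E n p * ?I n p * indicator (?far n) p) \<longlonglongrightarrow> ?l p"
      proof (cases "0 < fst p \<and> fst p \<le> t \<and> 0 < snd p \<and> snd p \<le> t \<and> fst p \<noteq> snd p")
        case True
        have "(\<lambda>n. 2 / real n) \<longlonglongrightarrow> 0" by (rule lim_const_over_n)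
        then have "\<forall>\<^sub>F n in sequentially. 2 / real n < \<bar>fst p - snd p\<bar>"
          by (rule order_tendstoD(2)) (use True in simp)
        then have ev: "\<forall>\<^sub>F n in sequentially. ?E n p = ?E n p * ?I n p * indicator (?far n) p"
          using indicator_window_tendsto[OF t, of "fst p"] indicator_window_tendsto[OF t, of "snd p"]
          by eventually_elim (use True in simp)
        have "(\<lambda>n. ?E n p) \<longlonglongrightarrow> ?l p"
          using kernel_pair_tendsto[OF F, of "fst p" "snd p" b b'] True by (simp add: pair_moment_def)
        then show ?thesis using ev by (rule Lim_transform_eventually)
      next
        case False
        then have l0: "?l p = 0" by (auto simp: indicator_def)
        have "\<forall>\<^sub>F n in sequentially. ?E n p * ?I n p * indicator (?far n) p = 0"
          using indicator_window_tendsto[OF t, of "fst p"] indicator_window_tendsto[OF t, of "snd p"] eventually_ge_at_top[of 1]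
          by eventually_elim (use False in \<open>auto simp: indicator_def\<close>)
        then show ?thesis unfolding l0 by (rule tendsto_eventually)
      qed
      then show "(\<lambda>n. ?E (Suc n) p * ?I (Suc n) p * indicator (?far (Suc n)) p) \<longlonglongrightarrow> ?l p"
        by (rule LIMSEQ_Suc)
    qed
  qed measurable
  then have far_lim: "(\<lambda>n. \<integral>\<^sup>+p. ?E n p * ?I n p * indicator (?far n) p \<partial>?L2) \<longlonglongrightarrow> (\<integral>\<^sup>+p. ?l p \<partial>?L2)"
    by (rule LIMSEQ_imp_Suc)
  let ?w = "cut_power H (t + 1)"
  let ?Q = "\<integral>\<^sup>+v. ?w v \<partial>lborel"
  have Q: "?Q < \<infinity>" using nn_integral_cut_power_finite[OF H(2), of "t + 1"] t by simp
  have near_bound: "(\<integral>\<^sup>+p. ?E n p * ?I n p * indicator (?near n) p \<partial>?L2) \<le> (square_const * (2 * ?Q)) * ennreal (4 * (u n / real n))"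
    if n: "n \<ge> 1" for n
  proof -
    have strip: "(\<integral>\<^sup>+r. indicator (?near n) (s, r) \<partial>lborel) = ennreal (4 / real n)"
       "(\<integral>\<^sup>+r. indicator (?near n) (r, s) \<partial>lborel) = ennreal (4 / real n)" for s
    proof -
      have 1: "(\<lambda>r. indicator (?near n) (s, r) :: ennreal) = indicator {s - 2 / real n<..<s + 2 / real n}"
         "(\<lambda>r. indicator (?near n) (r, s) :: ennreal) = indicator {s - 2 / real n<..<s + 2 / real n}"
        by (auto simp: indicator_def fun_eq_iff abs_less_iff)
      show "(\<integral>\<^sup>+r. indicator (?near n) (s, r) \<partial>lborel) = ennreal (4 / real n)"
        "(\<integral>\<^sup>+r. indicator (?near n) (r, s) \<partial>lborel) = ennreal (4 / real n)"
        unfolding 1 by simp_all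
    qed
    have ms: "(\<lambda>r. indicator (?near n) (s, r) :: ennreal) \<in> borel_measurable lborel"
      "(\<lambda>r. indicator (?near n) (r, s) :: ennreal) \<in> borel_measurable lborel" for s
      unfolding indicator_def by measurable
    have mw: "case_prod (\<lambda>s r. ?w s * indicator (?near n) (s, r)) \<in> borel_measurable ?L2"
       "case_prod (\<lambda>s r. ?w r * indicator (?near n) (s, r)) \<in> borel_measurable ?L2"
    proof -
      have nm: "(\<lambda>p. indicator (?near n) (fst p, snd p) :: ennreal) \<in> borel_measurable ?L2"
        using borel_measurable_indicator[OF near[of n]] by simp
      show "case_prod (\<lambda>s r. ?w s * indicator (?near n) (s, r)) \<in> borel_measurable ?L2"
        "case_prod (\<lambda>s r. ?w r * indicator (?near n) (s, r)) \<in> borel_measurable ?L2"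
        unfolding case_prod_beta
        by (intro borel_measurable_times_ennreal nm measurable_compose[OF measurable_fst] measurable_compose[OF measurable_snd]; simp)+
    qed
    have 1: "(\<integral>\<^sup>+p. ?w (fst p) * indicator (?near n) p \<partial>?L2) = ?Q * ennreal (4 / real n)"
      using lborel2_Fubini(1)[OF mw(1)] by (simp add: nn_integral_cmult ms strip nn_integral_multc)
    have 2: "(\<integral>\<^sup>+p. ?w (snd p) * indicator (?near n) p \<partial>?L2) = ?Q * ennreal (4 / real n)"
      using lborel2_Fubini(2)[OF mw(2)] by (simp add: nn_integral_cmult ms strip nn_integral_multc)
    have "(\<integral>\<^sup>+p. ?E n p * ?I n p * indicator (?near n) p \<partial>?L2)
      \<le> (\<integral>\<^sup>+p. square_const * ennreal (u n) * (?w (fst p) * indicator (?near n) p + ?w (snd p) * indicator (?near n) p) \<partial>?L2)"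
    proof (rule nn_integral_mono)
      fix p :: "real \<times> real"
      have "pair_moment b F b' F' n (fst p) (snd p) \<le> square_const * ennreal (u n) * (?w (fst p) + ?w (snd p))"
        if "fst p \<in> window n t" "snd p \<in> window n t"
        using that by (intro kernel_pair_near[OF F n t])
      then show "?E n p * ?I n p * indicator (?near n) p \<le> square_const * ennreal (u n) * (?w (fst p) * indicator (?near n) p + ?w (snd p) * indicator (?near n) p)"
        by (auto simp: indicator_def)
    qed
    also have "\<dots> = square_const * ennreal (u n) * (?Q * ennreal (4 / real n) + ?Q * ennreal (4 / real n))"
      unfolding 1[symmetric] using near[of n] by (subst nn_integral_cmult, simp, subst nn_integral_add, simp_all add: 1 2)
    also have "\<dots> = (square_const * (2 * ?Q)) * (ennreal (u n) * ennreal (4 / real n))"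
      by (simp add: mult_2 distrib_left distrib_right mult_ac)
    also have "ennreal (u n) * ennreal (4 / real n) = ennreal (4 * (u n / real n))"
      using u_pos[OF n] by (subst ennreal_mult[symmetric]) auto
    finally show ?thesis .
  qed
  have "(\<lambda>n. (square_const * (2 * ?Q)) * ennreal (4 * (u n / real n))) \<longlonglongrightarrow> (square_const * (2 * ?Q)) * ennreal (4 * 0)"
  proof (rule ennreal_tendsto_cmult)
    show "square_const * (2 * ?Q) < top"
      unfolding square_const_def using Q h_fin by (simp add: ennreal_mult_less_top)
    show "(\<lambda>n. ennreal (4 * (u n / real n))) \<longlonglongrightarrow> ennreal (4 * 0)"
      by (intro tendsto_ennrealI tendsto_mult tendsto_const u_small)
  qed
  then have up: "(\<lambda>n. (square_const * (2 * ?Q)) * ennreal (4 * (u n / real n))) \<longlonglongrightarrow> 0" by simp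
  have near_lim: "(\<lambda>n. \<integral>\<^sup>+p. ?E n p * ?I n p * indicator (?near n) p \<partial>?L2) \<longlonglongrightarrow> 0"
  proof (rule tendsto_sandwich[OF _ _ tendsto_const up])
    show "\<forall>\<^sub>F n in sequentially. (\<integral>\<^sup>+p. ?E n p * ?I n p * indicator (?near n) p \<partial>?L2)
        \<le> (square_const * (2 * ?Q)) * ennreal (4 * (u n / real n))"
      by (rule eventually_sequentiallyI[of 1]) (rule near_bound)
  qed simp
  have "(\<integral>\<^sup>+p. ?l p \<partial>?L2) = local_time_moment t * (kernel_mass (\<sigma>\<^sup>2) F * kernel_mass (\<sigma>\<^sup>2) F')"
    unfolding local_time_moment_def by (subst nn_integral_multc[symmetric]) (auto intro!: nn_integral_cong simp: mult_ac)
  then show ?thesis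
    unfolding split using tendsto_add[OF far_lim near_lim] by simp
qed

end

section \<open>Convergence at a fixed time\<close>

text \<open>
  The lower bounds on \<open>h\<close> and \<open>k\<close> put the indicator of \<open>[0, 1]\<close> in \<open>y\<close> among the dominated kernels.
\<close>

locale local_time_setting = kernel_setting M H \<sigma> X x u h k S C
  for M :: "'a measure" and H \<sigma> X x u h k S C +
  fixes L :: "real \<Rightarrow> real \<Rightarrow> 'a \<Rightarrow> real"
  assumes L_cont: "\<And>\<omega>. \<omega> \<in> space M \<Longrightarrow> continuous_on ({0..} \<times> UNIV) (\<lambda>(t, y). L t y \<omega>)"
    and L_nonneg: "\<And>\<omega> t y. \<omega> \<in> space M \<Longrightarrow> t \<ge> 0 \<Longrightarrow> L t y \<omega> \<ge> 0"
    and L_occupation: "\<And>\<omega> t. \<omega> \<in> space M \<Longrightarrow> t \<ge> 0 \<Longrightarrow>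
      occupation_measure (\<lambda>s. X s \<omega>) t = density lborel (\<lambda>y. ennreal (L t y \<omega>))"
    and h_unit: "\<And>y. 0 \<le> y \<Longrightarrow> y \<le> 1 \<Longrightarrow> 1 \<le> h y" and k_unit: "\<And>z. 1 \<le> k z"
begin

text \<open>
  A kernel of mass one that ignores the increments. With continuous sampling it yields the
  occupation time of an interval of length \<open>1 / u n\<close> above \<open>x\<close>, divided by that length.
\<close>

definition unit_kernel :: "real \<times> real \<Rightarrow> ennreal" where
  "unit_kernel p = indicator {0..1} (fst p)"

lemma dominated_unit_kernel: "dominated_kernel unit_kernel"
  unfolding dominated_kernel_def
proof (intro conjI allI)
  show "unit_kernel \<in> borel_measurable (borel \<Otimes>\<^sub>M borel)"
    unfolding unit_kernel_def by measurable
  fix y z show "unit_kernel (y, z) \<le> ennreal (h y * k z)"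
  proof (cases "y \<in> {0..1}")
    case True
    then have "1 * 1 \<le> h y * k z" using h_unit[of y] k_unit[of z] by (intro mult_mono) auto
    then show ?thesis using True by (simp add: unit_kernel_def ennreal_le_iff flip: ennreal_1)
  qed (simp add: unit_kernel_def)
qed

lemma kernel_mass_unit: "kernel_mass (\<sigma>\<^sup>2) unit_kernel = 1"
proof -
  have "kernel_mass (\<sigma>\<^sup>2) unit_kernel = (\<integral>\<^sup>+z. (\<integral>\<^sup>+y. indicator {0..1::real} y \<partial>lborel) * ennreal (normal_density 0 \<sigma> z) \<partial>lborel)"
    unfolding kernel_mass_def unit_kernel_def using sigma by (simp add: nn_integral_multc)
  also have "\<dots> = (\<integral>\<^sup>+z. ennreal (normal_density 0 \<sigma> z) \<partial>lborel)" by simp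
  also have "\<dots> = 1" using sigma by (subst nn_integral_eq_integral) auto
  finally show ?thesis .
qed

lemma L_cont_y:
  assumes "\<omega> \<in> space M" "t \<ge> 0" shows "continuous_on UNIV (\<lambda>y. L t y \<omega>)"
proof -
  have "continuous_on UNIV (\<lambda>y. (t, y))" by (intro continuous_intros)
  from continuous_on_compose2[OF L_cont[OF assms(1)] this] assms(2) show ?thesis by auto
qed

lemma L_cont_t:
  assumes "\<omega> \<in> space M" shows "continuous_on {0..} (\<lambda>t. L t y \<omega>)"
proof -
  have "continuous_on {0..} (\<lambda>t. (t, y))" by (intro continuous_intros)
  from continuous_on_compose2[OF L_cont[OF assms(1)] this] show ?thesis by auto
qed

definition occupation_average :: "real \<Rightarrow> real \<Rightarrow> 'a \<Rightarrow> ennreal" where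
  "occupation_average v t \<omega> = (\<integral>\<^sup>+s. ennreal v * indicator {x..x + 1 / v} (X s \<omega>) * indicator {0..t} s \<partial>lborel)"

lemma path_indicator_measurable:
  assumes "\<omega> \<in> space M" "A \<in> sets borel" "t \<ge> 0"
  shows "(\<lambda>s. indicator A (X s \<omega>) * indicator {0..t} s :: ennreal) \<in> borel_measurable lborel"
proof -
  have "continuous_on {0..t} (\<lambda>s. X s \<omega>)"
    using paths[OF assms(1)] by (rule continuous_on_subset) auto
  then have "(\<lambda>s. indicator {0..t} s *\<^sub>R X s \<omega>) \<in> borel_measurable borel"
    by (subst borel_measurable_restrict_space_iff[symmetric]) (auto intro: borel_measurable_continuous_on_restrict)
  then have "(\<lambda>s. indicator A (indicator {0..t} s *\<^sub>R X s \<omega>) * indicator {0..t} s :: ennreal) \<in> borel_measurable borel"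
    using assms(2) by measurable
  also have "(\<lambda>s. indicator A (indicator {0..t} s *\<^sub>R X s \<omega>) * indicator {0..t} s :: ennreal) = (\<lambda>s. indicator A (X s \<omega>) * indicator {0..t} s)"
    by (auto simp: indicator_def fun_eq_iff)
  finally show ?thesis by simp
qed

lemma occupation_average_eq:
  assumes \<omega>: "\<omega> \<in> space M" and t: "t \<ge> 0" and v: "v > 0"
  shows "occupation_average v t \<omega> = ennreal v * (\<integral>\<^sup>+y. ennreal (L t y \<omega>) * indicator {x..x + 1 / v} y \<partial>lborel)"
proof -
  have m: "(\<lambda>y. L t y \<omega>) \<in> borel_measurable borel"
    using L_cont_y[OF \<omega> t] by (rule borel_measurable_continuous_onI)
  have "occupation_average v t \<omega> = ennreal v * (\<integral>\<^sup>+s. indicator {x..x + 1 / v} (X s \<omega>) * indicator {0..t} s \<partial>lborel)"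
    unfolding occupation_average_def mult.assoc
    by (rule nn_integral_cmult) (rule path_indicator_measurable[OF \<omega> _ t], simp)
  also have "(\<integral>\<^sup>+s. indicator {x..x + 1 / v} (X s \<omega>) * indicator {0..t} s \<partial>lborel)
     = emeasure (occupation_measure (\<lambda>s. X s \<omega>) t) {x..x + 1 / v}"
    by (rule emeasure_occupation_measure[OF paths[OF \<omega>], symmetric]) simp
  also have "\<dots> = (\<integral>\<^sup>+y. ennreal (L t y \<omega>) * indicator {x..x + 1 / v} y \<partial>lborel)"
    unfolding L_occupation[OF \<omega> t] using m by (subst emeasure_density) auto
  finally show ?thesis .
qed

lemma occupation_average_mono: "t \<le> t' \<Longrightarrow> occupation_average v t \<omega> \<le> occupation_average v t' \<omega>"
  unfolding occupation_average_def by (intro nn_integral_mono) (auto simp: indicator_def)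

text \<open>
  The occupation average is an average of the continuous function \<open>L t\<close> over
  \<open>[x, x + 1 / u n]\<close>; it is enclosed between the minimum and the maximum there.
\<close>

lemma occupation_average_tendsto:
  assumes \<omega>: "\<omega> \<in> space M" and t: "t \<ge> 0"
  shows "(\<lambda>n. occupation_average (u n) t \<omega>) \<longlonglongrightarrow> ennreal (L t x \<omega>)"
proof -
  let ?l = "\<lambda>y. L t y \<omega>"
  let ?J = "\<lambda>n. {x..x + 1 / u n}"
  have un: "u n > 0" if "n \<ge> 1" for n using u_pos that by simp
  have ex: "\<exists>a b. n \<ge> 1 \<longrightarrow> a \<in> ?J n \<and> b \<in> ?J n \<and> (\<forall>y\<in>?J n. ?l a \<le> ?l y \<and> ?l y \<le> ?l b)" for n
  proof (cases "n \<ge> 1")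
    case True
    have c: "continuous_on (?J n) ?l" using L_cont_y[OF \<omega> t] by (rule continuous_on_subset) auto
    have ne: "?J n \<noteq> {}" using un[OF True] by simp
    obtain a where "a \<in> ?J n" "\<forall>y\<in>?J n. ?l a \<le> ?l y"
      using continuous_attains_inf[OF compact_Icc ne c] by blast
    moreover obtain b where "b \<in> ?J n" "\<forall>y\<in>?J n. ?l y \<le> ?l b"
      using continuous_attains_sup[OF compact_Icc ne c] by blast
    ultimately show ?thesis by blast
  qed auto
  then obtain a b where ab: "\<And>n. n \<ge> 1 \<Longrightarrow> a n \<in> ?J n \<and> b n \<in> ?J n \<and> (\<forall>y\<in>?J n. ?l (a n) \<le> ?l y \<and> ?l y \<le> ?l (b n))"
    by metis
  have uinv: "(\<lambda>n. x + 1 / u n) \<longlonglongrightarrow> x"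
    using tendsto_add[OF tendsto_const[of x] real_tendsto_divide_at_top[OF tendsto_const[of 1] u_top]] by simp
  have lim: "c \<longlonglongrightarrow> x \<Longrightarrow> (\<lambda>n. ennreal (?l (c n))) \<longlonglongrightarrow> ennreal (?l x)" for c :: "nat \<Rightarrow> real"
    by (intro tendsto_ennrealI continuous_on_tendsto_compose[OF L_cont_y[OF \<omega> t]]) auto
  have alim: "a \<longlonglongrightarrow> x"
    by (rule tendsto_sandwich[OF _ _ tendsto_const uinv]) (auto intro!: eventually_sequentiallyI[of 1] dest: ab)
  have blim: "b \<longlonglongrightarrow> x"
    by (rule tendsto_sandwich[OF _ _ tendsto_const uinv]) (auto intro!: eventually_sequentiallyI[of 1] dest: ab)
  have const: "ennreal (u n) * (\<integral>\<^sup>+y. ennreal q * indicator (?J n) y \<partial>lborel) = ennreal q" if "n \<ge> 1" "0 \<le> q" for n q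
  proof -
    have "ennreal (u n) * (\<integral>\<^sup>+y. ennreal q * indicator (?J n) y \<partial>lborel) = ennreal (u n) * (ennreal q * ennreal (1 / u n))"
      using un[OF that(1)] by (subst nn_integral_cmult) auto
    also have "\<dots> = ennreal q" using un[OF that(1)] that(2) by (simp add: ennreal_mult[symmetric])
    finally show ?thesis .
  qed
  show ?thesis
  proof (rule tendsto_sandwich[OF _ _ lim[OF alim] lim[OF blim]])
    show "\<forall>\<^sub>F n in sequentially. ennreal (?l (a n)) \<le> occupation_average (u n) t \<omega>"
    proof (rule eventually_sequentiallyI[of 1])
      fix n :: nat assume n: "1 \<le> n"
      have "ennreal (?l (a n)) = ennreal (u n) * (\<integral>\<^sup>+y. ennreal (?l (a n)) * indicator (?J n) y \<partial>lborel)"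
        using const[OF n L_nonneg[OF \<omega> t]] by simp
      also have "\<dots> \<le> occupation_average (u n) t \<omega>"
        unfolding occupation_average_eq[OF \<omega> t un[OF n]]
        using ab[OF n] by (intro mult_left_mono nn_integral_mono) (auto simp: indicator_def intro!: ennreal_leI)
      finally show "ennreal (?l (a n)) \<le> occupation_average (u n) t \<omega>" .
    qed
    show "\<forall>\<^sub>F n in sequentially. occupation_average (u n) t \<omega> \<le> ennreal (?l (b n))"
    proof (rule eventually_sequentiallyI[of 1])
      fix n :: nat assume n: "1 \<le> n"
      have "occupation_average (u n) t \<omega> \<le> ennreal (u n) * (\<integral>\<^sup>+y. ennreal (?l (b n)) * indicator (?J n) y \<partial>lborel)"
        unfolding occupation_average_eq[OF \<omega> t un[OF n]]
        using ab[OF n] by (intro mult_left_mono nn_integral_mono) (auto simp: indicator_def intro!: ennreal_leI)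
      also have "\<dots> = ennreal (?l (b n))"
        using const[OF n L_nonneg[OF \<omega> t]] by simp
      finally show "occupation_average (u n) t \<omega> \<le> ennreal (?l (b n))" .
    qed
  qed
qed

text \<open>
  Occupation measures increase in time, which orders their densities at almost every level only; at
  the given level \<open>x\<close> monotonicity passes through the limit of occupation averages.
\<close>

lemma L_mono:
  assumes \<omega>: "\<omega> \<in> space M" and t: "0 \<le> t" "t \<le> t'"
  shows "L t x \<omega> \<le> L t' x \<omega>"
proof -
  have "ennreal (L t x \<omega>) \<le> ennreal (L t' x \<omega>)"
    by (rule LIMSEQ_le[OF occupation_average_tendsto occupation_average_tendsto])
      (use \<omega> t in \<open>auto intro: occupation_average_mono\<close>)
  then show ?thesis using L_nonneg[OF \<omega>, of t' x] t by (simp add: ennreal_le_iff)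
qed

text \<open>
  The window and \<open>[0, t]\<close> differ by at most one grid step at either end, which costs at most \<open>u n / n\<close>
  each.
\<close>

lemma unit_integral_tendsto:
  assumes \<omega>: "\<omega> \<in> space M" and t: "t \<ge> 0"
  shows "(\<lambda>n. kernel_integral False unit_kernel n t \<omega>) \<longlonglongrightarrow> ennreal (L t x \<omega>)"
proof -
  have kv: "kernel_value False unit_kernel n s \<omega> = ennreal (u n) * indicator {x..x + 1 / u n} (X s \<omega>)"
    if "n \<ge> 1" "s \<ge> 0" for n s
  proof -
    have un: "u n > 0" using u_pos that by simp
    have "(u n * (X s \<omega> - x) \<in> {0..1}) = (X s \<omega> \<in> {x..x + 1 / u n})"
      using un by (auto simp: zero_le_mult_iff field_simps)
    then show ?thesis
      using that unfolding kernel_value_def unit_kernel_def sample_time_def by (auto simp: indicator_def max_def)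
  qed
  have path_m: "(\<lambda>s. ennreal (u n) * indicator {x..x + 1 / u n} (X s \<omega>) * indicator {0..t} s) \<in> borel_measurable lborel" for n
    unfolding mult.assoc by (intro borel_measurable_times_ennreal path_indicator_measurable[OF \<omega> _ t]) auto
  have val_m: "(\<lambda>s. kernel_value False unit_kernel n s \<omega> * indicator (window n t) s) \<in> borel_measurable lborel" for n
    using \<omega> by (intro borel_measurable_times_ennreal kernel_value_measurable2[OF dominated_unit_kernel]; measurable)
  have up: "kernel_integral False unit_kernel n t \<omega> \<le> occupation_average (u n) t \<omega> + ennreal (u n / real n)" if n: "n \<ge> 1" for n
  proof -
    have un: "u n > 0" using u_pos n by simp
    have "kernel_integral False unit_kernel n t \<omega> \<le> (\<integral>\<^sup>+s. ennreal (u n) * indicator {x..x + 1 / u n} (X s \<omega>) * indicator {0..t} s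
        + ennreal (u n) * indicator {t..t + 1 / real n} s \<partial>lborel)"
      unfolding kernel_integral_def
    proof (rule nn_integral_mono)
      fix s
      show "kernel_value False unit_kernel n s \<omega> * indicator (window n t) s \<le> ennreal (u n) * indicator {x..x + 1 / u n} (X s \<omega>) * indicator {0..t} s
        + ennreal (u n) * indicator {t..t + 1 / real n} s"
      proof (cases "s \<in> window n t")
        case True
        then have "0 < s" using window_subset[OF n t] by auto
        moreover have "s < t + 1 / real n"
          using True grid_bounds(1)[OF n t] by (simp add: window_def add_divide_distrib)
        ultimately show ?thesis using kv[OF n, of s] by (auto simp: indicator_def)
      qed simp
    qed
    also have "\<dots> = occupation_average (u n) t \<omega> + (\<integral>\<^sup>+s. ennreal (u n) * indicator {t..t + 1 / real n} s \<partial>lborel)"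
      unfolding occupation_average_def by (rule nn_integral_add[OF path_m]) simp
    also have "(\<integral>\<^sup>+s. ennreal (u n) * indicator {t..t + 1 / real n} s \<partial>lborel) = ennreal (u n / real n)"
      using un n by (subst nn_integral_cmult) (auto simp: ennreal_mult[symmetric])
    finally show ?thesis .
  qed
  have lo: "occupation_average (u n) t \<omega> \<le> ennreal (u n / real n) + kernel_integral False unit_kernel n t \<omega>" if n: "n \<ge> 1" for n
  proof -
    have un: "u n > 0" using u_pos n by simp
    have "occupation_average (u n) t \<omega> \<le> (\<integral>\<^sup>+s. ennreal (u n) * indicator {0..1 / real n} s + kernel_value False unit_kernel n s \<omega> * indicator (window n t) s \<partial>lborel)"
      unfolding occupation_average_def
    proof (rule nn_integral_mono)
      fix s
      show "ennreal (u n) * indicator {x..x + 1 / u n} (X s \<omega>) * indicator {0..t} s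
         \<le> ennreal (u n) * indicator {0..1 / real n} s + kernel_value False unit_kernel n s \<omega> * indicator (window n t) s"
      proof (cases "s \<in> {0..t} \<and> 1 / real n < s")
        case True
        then have "s < (real (grid n t) + 1) / real n"
          using grid_bounds(2)[OF n t] by (simp add: add_divide_distrib)
        then have "s \<in> window n t" using True by (simp add: window_def)
        then show ?thesis using kv[OF n, of s] True by (auto simp: indicator_def)
      next
        case False
        then show ?thesis by (auto simp: indicator_def)
      qed
    qed
    also have "\<dots> = (\<integral>\<^sup>+s. ennreal (u n) * indicator {0..1 / real n} s \<partial>lborel) + kernel_integral False unit_kernel n t \<omega>"
      unfolding kernel_integral_def by (rule nn_integral_add[OF _ val_m]) simp
    also have "(\<integral>\<^sup>+s. ennreal (u n) * indicator {0..1 / real n} s \<partial>lborel) = ennreal (u n / real n)"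
      using un n by (subst nn_integral_cmult) (auto simp: ennreal_mult[symmetric])
    finally show ?thesis .
  qed
  have e0: "(\<lambda>n. ennreal (u n / real n)) \<longlonglongrightarrow> 0"
    using tendsto_ennrealI[OF u_small] by simp
  note O = occupation_average_tendsto[OF \<omega> t]
  have upl: "(\<lambda>n. occupation_average (u n) t \<omega> + ennreal (u n / real n)) \<longlonglongrightarrow> ennreal (L t x \<omega>)"
    using tendsto_add[OF O e0] by simp
  have lol: "(\<lambda>n. occupation_average (u n) t \<omega> - ennreal (u n / real n)) \<longlonglongrightarrow> ennreal (L t x \<omega>)"
    using tendsto_diff_ennreal_general[OF O e0] by simp
  show ?thesis
    by (rule tendsto_sandwich[OF _ _ lol upl])
      (auto intro!: eventually_sequentiallyI[of 1] up simp: ennreal_minus_le_iff dest: lo)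
qed

end

text \<open>
  For nonnegative variables this is convergence to zero in probability; negative values are
  ignored, so that upper bounds suffice.
\<close>

definition (in prob_space) null_in_prob :: "(nat \<Rightarrow> 'a \<Rightarrow> real) \<Rightarrow> bool" where
  "null_in_prob Z \<longleftrightarrow> (\<forall>n. Z n \<in> borel_measurable M) \<and> (\<forall>\<epsilon>>0. (\<lambda>n. prob {\<omega> \<in> space M. \<epsilon> < Z n \<omega>}) \<longlonglongrightarrow> 0)"

context prob_space
begin

lemma null_in_prob_meas: "null_in_prob Z \<Longrightarrow> Z n \<in> borel_measurable M"
  by (simp add: null_in_prob_def)

lemma null_in_prob_L1:
  assumes [measurable]: "\<And>n. Z n \<in> borel_measurable M"
    and lim: "(\<lambda>n. \<integral>\<^sup>+\<omega>. ennreal (Z n \<omega>) \<partial>M) \<longlonglongrightarrow> 0"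
  shows "null_in_prob Z"
  unfolding null_in_prob_def
proof (intro conjI allI impI)
  fix \<epsilon> :: real assume e: "\<epsilon> > 0"
  have "emeasure M {\<omega> \<in> space M. \<epsilon> < Z n \<omega>} \<le> ennreal (1 / \<epsilon>) * (\<integral>\<^sup>+\<omega>. ennreal (Z n \<omega>) \<partial>M)" for n
  proof -
    have "emeasure M {\<omega> \<in> space M. \<epsilon> < Z n \<omega>} \<le> emeasure M {\<omega> \<in> space M. 1 \<le> ennreal (1 / \<epsilon>) * ennreal (Z n \<omega>)}"
    proof (rule emeasure_mono)
      show "{\<omega> \<in> space M. \<epsilon> < Z n \<omega>} \<subseteq> {\<omega> \<in> space M. 1 \<le> ennreal (1 / \<epsilon>) * ennreal (Z n \<omega>)}"
        using e by (auto simp: ennreal_mult[symmetric] field_simps simp flip: ennreal_1)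
    qed measurable
    also have "\<dots> \<le> ennreal (1 / \<epsilon>) * (\<integral>\<^sup>+\<omega>. ennreal (Z n \<omega>) * indicator (space M) \<omega> \<partial>M)"
      by (rule nn_integral_Markov_inequality) auto
    also have "(\<integral>\<^sup>+\<omega>. ennreal (Z n \<omega>) * indicator (space M) \<omega> \<partial>M) = (\<integral>\<^sup>+\<omega>. ennreal (Z n \<omega>) \<partial>M)"
      by (rule nn_integral_cong) simp
    finally show ?thesis .
  qed
  note bd = this
  have "(\<lambda>n. ennreal (1 / \<epsilon>) * (\<integral>\<^sup>+\<omega>. ennreal (Z n \<omega>) \<partial>M)) \<longlonglongrightarrow> ennreal (1 / \<epsilon>) * 0"
    by (rule ennreal_tendsto_cmult[OF _ lim]) simp
  then have "(\<lambda>n. ennreal (1 / \<epsilon>) * (\<integral>\<^sup>+\<omega>. ennreal (Z n \<omega>) \<partial>M)) \<longlonglongrightarrow> 0" by simp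
  note up = this
  have "(\<lambda>n. emeasure M {\<omega> \<in> space M. \<epsilon> < Z n \<omega>}) \<longlonglongrightarrow> 0"
    by (rule tendsto_sandwich[OF _ _ tendsto_const up]) (auto intro!: always_eventually bd)
  then show "(\<lambda>n. prob {\<omega> \<in> space M. \<epsilon> < Z n \<omega>}) \<longlonglongrightarrow> 0"
    by (simp add: emeasure_eq_measure ennreal_tendsto_0_iff)
qed fact

lemma null_in_prob_L2:
  assumes [measurable]: "\<And>n. Z n \<in> borel_measurable M"
    and lim: "(\<lambda>n. \<integral>\<^sup>+\<omega>. ennreal ((Z n \<omega>)\<^sup>2) \<partial>M) \<longlonglongrightarrow> 0"
  shows "null_in_prob (\<lambda>n \<omega>. \<bar>Z n \<omega>\<bar>)"
  unfolding null_in_prob_def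
proof (intro conjI allI impI)
  fix \<epsilon> :: real assume e: "\<epsilon> > 0"
  have "null_in_prob (\<lambda>n \<omega>. (Z n \<omega>)\<^sup>2)" by (rule null_in_prob_L1[OF _ lim]) simp
  then have "(\<lambda>n. prob {\<omega> \<in> space M. \<epsilon>\<^sup>2 < (Z n \<omega>)\<^sup>2}) \<longlonglongrightarrow> 0"
    using e by (simp add: null_in_prob_def)
  moreover have "(\<epsilon>\<^sup>2 < z\<^sup>2) = (\<epsilon> < \<bar>z\<bar>)" for z
    using e abs_le_square_iff[of z \<epsilon>] by (metis abs_of_pos not_le)
  ultimately show "(\<lambda>n. prob {\<omega> \<in> space M. \<epsilon> < \<bar>Z n \<omega>\<bar>}) \<longlonglongrightarrow> 0" by simp
qed simp

lemma null_in_prob_pointwise: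
  assumes [measurable]: "\<And>n. Z n \<in> borel_measurable M"
    and lim: "\<And>\<omega>. \<omega> \<in> space M \<Longrightarrow> (\<lambda>n. Z n \<omega>) \<longlonglongrightarrow> 0"
  shows "null_in_prob Z"
  unfolding null_in_prob_def
proof (intro conjI allI impI)
  fix \<epsilon> :: real assume e: "\<epsilon> > 0"
  have "(\<lambda>n. \<integral>\<omega>. indicator {\<omega> \<in> space M. \<epsilon> < Z n \<omega>} \<omega> \<partial>M) \<longlonglongrightarrow> (\<integral>\<omega>. (0::real) \<partial>M)"
  proof (rule integral_dominated_convergence[where w="\<lambda>_. 1"])
    show "AE \<omega> in M. (\<lambda>n. indicator {\<omega> \<in> space M. \<epsilon> < Z n \<omega>} \<omega>) \<longlonglongrightarrow> (0::real)"
    proof (rule AE_I2)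
      fix \<omega> assume \<omega>: "\<omega> \<in> space M"
      have "\<forall>\<^sub>F n in sequentially. Z n \<omega> < \<epsilon>" by (rule order_tendstoD(2)[OF lim[OF \<omega>] e])
      then show "(\<lambda>n. indicator {\<omega> \<in> space M. \<epsilon> < Z n \<omega>} \<omega>) \<longlonglongrightarrow> (0::real)"
        by (intro tendsto_eventually) (auto elim!: eventually_mono simp: indicator_def)
    qed
  qed (auto simp: indicator_def)
  then show "(\<lambda>n. prob {\<omega> \<in> space M. \<epsilon> < Z n \<omega>}) \<longlonglongrightarrow> 0"
    by simp
qed fact

lemma null_in_prob_mono:
  assumes Z': "null_in_prob Z'" and [measurable]: "\<And>n. Z n \<in> borel_measurable M"
    and le: "\<And>n \<omega>. n \<ge> 1 \<Longrightarrow> \<omega> \<in> space M \<Longrightarrow> Z n \<omega> \<le> Z' n \<omega>"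
  shows "null_in_prob Z"
  unfolding null_in_prob_def
proof (intro conjI allI impI)
  fix \<epsilon> :: real assume e: "\<epsilon> > 0"
  note [measurable] = null_in_prob_meas[OF Z']
  have "(\<lambda>n. prob {\<omega> \<in> space M. \<epsilon> < Z' n \<omega>}) \<longlonglongrightarrow> 0"
    using Z' e by (simp add: null_in_prob_def)
  then show "(\<lambda>n. prob {\<omega> \<in> space M. \<epsilon> < Z n \<omega>}) \<longlonglongrightarrow> 0"
  proof (rule tendsto_sandwich[OF _ _ tendsto_const, rotated 2])
    show "\<forall>\<^sub>F n in sequentially. prob {\<omega> \<in> space M. \<epsilon> < Z n \<omega>} \<le> prob {\<omega> \<in> space M. \<epsilon> < Z' n \<omega>}"
      by (rule eventually_sequentiallyI[of 1], rule finite_measure_mono) (use le in \<open>force+\<close>)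
  qed simp
qed fact

lemma null_in_prob_add:
  assumes Z: "null_in_prob Z" "null_in_prob Z'"
  shows "null_in_prob (\<lambda>n \<omega>. Z n \<omega> + Z' n \<omega>)"
  unfolding null_in_prob_def
proof (intro conjI allI impI)
  note [measurable] = null_in_prob_meas[OF Z(1)] null_in_prob_meas[OF Z(2)]
  show "(\<lambda>\<omega>. Z n \<omega> + Z' n \<omega>) \<in> borel_measurable M" for n by measurable
  fix \<epsilon> :: real assume e: "\<epsilon> > 0"
  have "(\<lambda>n. prob {\<omega> \<in> space M. \<epsilon> / 2 < Z n \<omega>}) \<longlonglongrightarrow> 0" "(\<lambda>n. prob {\<omega> \<in> space M. \<epsilon> / 2 < Z' n \<omega>}) \<longlonglongrightarrow> 0"
    using Z half_gt_zero[OF e] unfolding null_in_prob_def by blast+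
  from tendsto_add[OF this]
  have "(\<lambda>n. prob {\<omega> \<in> space M. \<epsilon> / 2 < Z n \<omega>} + prob {\<omega> \<in> space M. \<epsilon> / 2 < Z' n \<omega>}) \<longlonglongrightarrow> 0" by simp
  then show "(\<lambda>n. prob {\<omega> \<in> space M. \<epsilon> < Z n \<omega> + Z' n \<omega>}) \<longlonglongrightarrow> 0"
  proof (rule tendsto_sandwich[OF _ _ tendsto_const, rotated 2])
    show "\<forall>\<^sub>F n in sequentially. prob {\<omega> \<in> space M. \<epsilon> < Z n \<omega> + Z' n \<omega>}
        \<le> prob {\<omega> \<in> space M. \<epsilon> / 2 < Z n \<omega>} + prob {\<omega> \<in> space M. \<epsilon> / 2 < Z' n \<omega>}"
    proof (intro always_eventually allI)
      fix n
      have "prob {\<omega> \<in> space M. \<epsilon> < Z n \<omega> + Z' n \<omega>} \<le> prob ({\<omega> \<in> space M. \<epsilon> / 2 < Z n \<omega>} \<union> {\<omega> \<in> space M. \<epsilon> / 2 < Z' n \<omega>})"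
        by (rule finite_measure_mono) auto
      also have "\<dots> \<le> prob {\<omega> \<in> space M. \<epsilon> / 2 < Z n \<omega>} + prob {\<omega> \<in> space M. \<epsilon> / 2 < Z' n \<omega>}"
        by (rule measure_Un_le) auto
      finally show "prob {\<omega> \<in> space M. \<epsilon> < Z n \<omega> + Z' n \<omega>} \<le> \<dots>" .
    qed
  qed simp
qed

text \<open>
  In \<open>E (v - c w)\<^sup>2 = E v\<^sup>2 - 2 c E (v w) + c\<^sup>2 E w\<^sup>2\<close> the three limits \<open>K c\<^sup>2\<close>, \<open>-2 K c\<^sup>2\<close> and
  \<open>K c\<^sup>2\<close> add up to zero. In the extended nonnegative reals the mixed term is first moved to the left-hand side;
  subtracting it again is legitimate because its limit is finite.
\<close>

lemma second_moment_cancellation: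
  fixes v w :: "nat \<Rightarrow> 'a \<Rightarrow> real" and K :: ennreal
  assumes [measurable]: "\<And>n. v n \<in> borel_measurable M" "\<And>n. w n \<in> borel_measurable M"
    and nonneg: "\<And>n \<omega>. 0 \<le> v n \<omega>" "\<And>n \<omega>. 0 \<le> w n \<omega>" "0 \<le> c" and K: "K < \<infinity>"
    and vv: "(\<lambda>n. \<integral>\<^sup>+\<omega>. ennreal (v n \<omega> * v n \<omega>) \<partial>M) \<longlonglongrightarrow> K * (ennreal c * ennreal c)"
    and vw: "(\<lambda>n. \<integral>\<^sup>+\<omega>. ennreal (v n \<omega> * w n \<omega>) \<partial>M) \<longlonglongrightarrow> K * ennreal c"
    and ww: "(\<lambda>n. \<integral>\<^sup>+\<omega>. ennreal (w n \<omega> * w n \<omega>) \<partial>M) \<longlonglongrightarrow> K"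
  shows "(\<lambda>n. \<integral>\<^sup>+\<omega>. ennreal ((v n \<omega> - c * w n \<omega>)\<^sup>2) \<partial>M) \<longlonglongrightarrow> 0"
proof -
  let ?A = "\<lambda>n. \<integral>\<^sup>+\<omega>. ennreal ((v n \<omega> - c * w n \<omega>)\<^sup>2) \<partial>M"
  let ?B = "\<lambda>n. ennreal (2 * c) * (\<integral>\<^sup>+\<omega>. ennreal (v n \<omega> * w n \<omega>) \<partial>M)"
  let ?C = "\<lambda>n. (\<integral>\<^sup>+\<omega>. ennreal (v n \<omega> * v n \<omega>) \<partial>M) + ennreal (c * c) * (\<integral>\<^sup>+\<omega>. ennreal (w n \<omega> * w n \<omega>) \<partial>M)"
  have id: "?A n + ?B n = ?C n" for n
  proof -
    have "?A n + ?B n = (\<integral>\<^sup>+\<omega>. ennreal ((v n \<omega> - c * w n \<omega>)\<^sup>2) + ennreal (2 * c) * ennreal (v n \<omega> * w n \<omega>) \<partial>M)"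
      by (subst nn_integral_add) (auto simp: nn_integral_cmult)
    also have "\<dots> = (\<integral>\<^sup>+\<omega>. ennreal (v n \<omega> * v n \<omega>) + ennreal (c * c) * ennreal (w n \<omega> * w n \<omega>) \<partial>M)"
    proof (rule nn_integral_cong)
      fix \<omega>
      let ?v = "v n \<omega>" and ?w = "w n \<omega>"
      have "ennreal ((?v - c * ?w)\<^sup>2) + ennreal (2 * c) * ennreal (?v * ?w) = ennreal ((?v - c * ?w)\<^sup>2 + 2 * c * (?v * ?w))"
        using nonneg by (subst ennreal_mult[symmetric]) (auto simp: ennreal_plus)
      also have "(?v - c * ?w)\<^sup>2 + 2 * c * (?v * ?w) = ?v * ?v + c * c * (?w * ?w)"
        by (simp add: power2_eq_square algebra_simps)
      also have "ennreal \<dots> = ennreal (?v * ?v) + ennreal (c * c) * ennreal (?w * ?w)"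
        using nonneg by (subst ennreal_mult[symmetric]) (auto simp: ennreal_plus)
      finally show "ennreal ((?v - c * ?w)\<^sup>2) + ennreal (2 * c) * ennreal (?v * ?w) = ennreal (?v * ?v) + ennreal (c * c) * ennreal (?w * ?w)" .
    qed
    also have "\<dots> = ?C n"
      by (subst nn_integral_add) (auto simp: nn_integral_cmult)
    finally show ?thesis .
  qed
  have cc: "ennreal (c * c) = ennreal c * ennreal c" using nonneg by (simp add: ennreal_mult)
  have Blim: "?B \<longlonglongrightarrow> ennreal (2 * c) * (K * ennreal c)" by (rule ennreal_tendsto_cmult[OF _ vw]) simp
  have Clim: "?C \<longlonglongrightarrow> K * (ennreal c * ennreal c) + ennreal (c * c) * K"
    by (intro tendsto_add vv ennreal_tendsto_cmult[OF _ ww]) simp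
  have fin: "ennreal (2 * c) * (K * ennreal c) < top" using K by (simp add: ennreal_mult_less_top)
  have eq: "K * (ennreal c * ennreal c) + ennreal (c * c) * K = ennreal (2 * c) * (K * ennreal c)"
    using nonneg by (simp add: cc ennreal_mult mult_2 distrib_right mult_ac flip: mult_2)
  have "(\<lambda>n. ?C n - ?B n) \<longlonglongrightarrow> ennreal (2 * c) * (K * ennreal c) - ennreal (2 * c) * (K * ennreal c)"
    using Clim unfolding eq by (rule tendsto_diff_ennreal_general[OF _ Blim]) (use fin in auto)
  then have lim: "(\<lambda>n. ?C n - ?B n) \<longlonglongrightarrow> 0" using fin by simp
  have "\<forall>\<^sub>F n in sequentially. ?B n < top" by (rule order_tendstoD(2)[OF Blim fin])
  then have "\<forall>\<^sub>F n in sequentially. ?C n - ?B n = ?A n"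
    by eventually_elim (simp add: id[symmetric])
  with lim show ?thesis by (rule Lim_transform_eventually)
qed

end

lemma grid_eq:
  assumes "n \<ge> 1" "real i / real n \<le> s" "s < (real i + 1) / real n"
  shows "grid n s = i"
proof -
  have n: "real n > 0" using assms by simp
  have "real i \<le> real n * s" "real n * s < real i + 1"
    using assms n by (simp_all add: divide_le_eq less_divide_eq mult.commute)
  then have "\<lfloor>real n * s\<rfloor> = int i" by (intro floor_unique) auto
  then show ?thesis by (simp add: grid_def)
qed

lemma nn_integral_grid_sum:
  fixes \<phi> :: "nat \<Rightarrow> ennreal"
  assumes n: "n \<ge> 1"
  shows "(\<integral>\<^sup>+s. \<phi> (grid n s) * indicator {1 / real n..<(real N + 1) / real n} s \<partial>lborel)
    = (\<Sum>i=1..N. \<phi> i * ennreal (1 / real n))"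
proof (induction N)
  case 0
  then show ?case by simp
next
  case (Suc N)
  have np: "real n > 0" using n by simp
  have g: "grid n \<in> measurable borel (count_space UNIV)" unfolding grid_def by measurable
  have \<phi>m[measurable]: "(\<lambda>s. \<phi> (grid n s)) \<in> borel_measurable borel"
    by (rule measurable_compose[OF g]) simp
  have "(\<integral>\<^sup>+s. \<phi> (grid n s) * indicator {1 / real n..<(real (Suc N) + 1) / real n} s \<partial>lborel)
    = (\<integral>\<^sup>+s. \<phi> (grid n s) * indicator {1 / real n..<(real N + 1) / real n} s
        + \<phi> (Suc N) * indicator {real (Suc N) / real n..<(real (Suc N) + 1) / real n} s \<partial>lborel)"
  proof (rule nn_integral_cong)
    fix s
    have o: "1 / real n \<le> real (Suc N) / real n" "real (Suc N) / real n \<le> (real (Suc N) + 1) / real n"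
      using np by (auto intro!: divide_right_mono)
    have e: "(real N + 1) / real n = real (Suc N) / real n" by (simp add: add.commute)
    show "\<phi> (grid n s) * indicator {1 / real n..<(real (Suc N) + 1) / real n} s
      = \<phi> (grid n s) * indicator {1 / real n..<(real N + 1) / real n} s
        + \<phi> (Suc N) * indicator {real (Suc N) / real n..<(real (Suc N) + 1) / real n} s"
    proof (cases "real (Suc N) / real n \<le> s \<and> s < (real (Suc N) + 1) / real n")
      case True
      then have "grid n s = Suc N" by (intro grid_eq[OF n]) auto
      then show ?thesis using True o unfolding e by (auto simp: indicator_def)
    next
      case False
      then show ?thesis using o unfolding e by (auto simp: indicator_def)
    qed
  qed
  also have "\<dots> = (\<Sum>i=1..N. \<phi> i * ennreal (1 / real n)) + \<phi> (Suc N) * ennreal (1 / real n)"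
  proof -
    have em: "emeasure lborel {real (Suc N) / real n..<(real (Suc N) + 1) / real n} = ennreal (1 / real n)"
      using np by (subst emeasure_lborel_Ico) (auto intro!: divide_right_mono simp: diff_divide_distrib[symmetric])
    show ?thesis
      by (subst nn_integral_add, measurable) (simp only: Suc nn_integral_cmult_indicator em sets_lborel atLeastLessThan_borel)
  qed
  finally show ?case by simp
qed

context local_time_setting
begin

lemma kernel_mass_finite:
  assumes "dominated_kernel F"
  shows "kernel_mass (\<sigma>\<^sup>2) F < \<infinity>"
proof -
  let ?n = "normal_density 0 (sqrt (\<sigma>\<^sup>2))"
  have "kernel_mass (\<sigma>\<^sup>2) F \<le> (\<integral>\<^sup>+z. \<integral>\<^sup>+y. ennreal (h y) * (ennreal (k z) * ennreal (?n z)) \<partial>lborel \<partial>lborel)"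
    unfolding kernel_mass_def
  proof (intro nn_integral_mono)
    fix z y
    have "F (y, z) \<le> ennreal (h y) * ennreal (k z)"
      using assms h_nonneg k_nonneg by (simp add: dominated_kernel_def ennreal_mult)
    then show "F (y, z) * ennreal (?n z) \<le> ennreal (h y) * (ennreal (k z) * ennreal (?n z))"
      unfolding mult.assoc[symmetric] by (rule mult_right_mono) simp
  qed
  also have "\<dots> = h_mass * (\<integral>\<^sup>+z. ennreal (k z) * ennreal (?n z) \<partial>lborel)"
    by (simp add: nn_integral_cmult nn_integral_multc)
  also have "\<dots> < \<infinity>"
    using nn_integral_normal_exp_growth[OF _ k_meas k_le_exp, of "\<sigma>\<^sup>2"] h_fin sigma by (simp add: ennreal_mult_less_top)
  finally show ?thesis .
qed

text \<open>
  The pair density is a limit of pair moments of the unit kernel and thus inherits the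
  dominating function.
\<close>

lemma local_time_moment_finite:
  assumes t: "t \<ge> 0"
  shows "local_time_moment t < \<infinity>"
proof -
  have "local_time_moment t \<le> (\<integral>\<^sup>+p. dominating t p \<partial>(lborel \<Otimes>\<^sub>M lborel))"
    unfolding local_time_moment_def
  proof (rule nn_integral_mono)
    fix p :: "real \<times> real"
    show "ennreal (pair_density (fst p) (snd p)) * (indicator {0<..t} (fst p) * indicator {0<..t} (snd p) * indicator {p. fst p \<noteq> snd p} p) \<le> dominating t p"
    proof (cases "0 < fst p \<and> fst p \<le> t \<and> 0 < snd p \<and> snd p \<le> t \<and> fst p \<noteq> snd p")
      case True
      note U = dominated_unit_kernel
      have "(\<lambda>n. pair_moment False unit_kernel False unit_kernel n (fst p) (snd p)) \<longlonglongrightarrow> ennreal (pair_density (fst p) (snd p))"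
        using kernel_pair_tendsto[OF U U, of "fst p" "snd p" False False] True by (simp add: pair_moment_def kernel_mass_unit)
      moreover have "\<forall>\<^sub>F n in sequentially. pair_moment False unit_kernel False unit_kernel n (fst p) (snd p) \<le> dominating t (fst p, snd p)"
      proof -
        have far: "\<forall>\<^sub>F n in sequentially. 2 / real n < \<bar>fst p - snd p\<bar>"
          by (rule order_tendstoD(2)[OF lim_const_over_n]) (use True in simp)
        have one: "(indicator {0<..t} (fst p) :: ennreal) = 1" "(indicator {0<..t} (snd p) :: ennreal) = 1" using True by auto
        have kpd: "pair_moment False unit_kernel False unit_kernel n (fst p) (snd p) \<le> dominating t p"
          if "n \<ge> 1" "fst p \<in> window n t" "snd p \<in> window n t" "2 / real n \<le> \<bar>fst p - snd p\<bar>" for n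
          using kernel_pair_dominated[OF U U that(1) t that(2-4)] by simp
        show ?thesis
          using far indicator_window_tendsto[OF t, of "fst p"] indicator_window_tendsto[OF t, of "snd p"] eventually_ge_at_top[of 1]
          by eventually_elim (auto intro!: kpd simp: one indicator_eq_1_iff)
      qed
      ultimately have "ennreal (pair_density (fst p) (snd p)) \<le> dominating t (fst p, snd p)"
        by (rule tendsto_upperbound) simp
      then show ?thesis using True by (simp add: indicator_def)
    qed (auto simp: indicator_def)
  qed
  then show ?thesis using dominating_finite[OF t] by (rule le_less_trans)
qed

text \<open>
  Measurability of the local time in \<open>\<omega>\<close> is not assumed but follows from its approximation by
  occupation integrals.
\<close>

lemma L_measurable:
  assumes t: "t \<ge> 0" shows "L t x \<in> borel_measurable M"
proof -
  have lim: "(\<lambda>n. enn2real (kernel_integral False unit_kernel n t \<omega>)) \<longlonglongrightarrow> L t x \<omega>" if "\<omega> \<in> space M" for \<omega>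
    by (rule tendsto_enn2real[OF unit_integral_tendsto[OF that t] L_nonneg[OF that t]])
  show ?thesis
    by (rule borel_measurable_LIMSEQ_real[OF lim])
      (use kernel_integral_measurable[OF dominated_unit_kernel] in \<open>auto intro: borel_measurable_enn2real\<close>)
qed

definition riemann_kernel :: "(real \<times> real \<Rightarrow> real) \<Rightarrow> nat \<Rightarrow> nat \<Rightarrow> 'a \<Rightarrow> real" where
  "riemann_kernel f n i \<omega> = f (u n * (X (real i / real n) \<omega> - x), incr n i \<omega>)"

lemma riemann_kernel_measurable:
  assumes "f \<in> borel_measurable borel"
  shows "riemann_kernel f n i \<in> borel_measurable M"
proof -
  have f: "f \<in> borel_measurable (borel \<Otimes>\<^sub>M borel)" using assms by (simp add: borel_prod)
  have [measurable]: "X (real i / real n) \<in> borel_measurable M" "incr n i \<in> borel_measurable M"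
    by (auto intro: X_meas meas[OF incr_in])
  have "(\<lambda>\<omega>. (u n * (X (real i / real n) \<omega> - x), incr n i \<omega>)) \<in> measurable M (borel \<Otimes>\<^sub>M borel)"
    by measurable
  from measurable_compose[OF this f] show ?thesis unfolding riemann_kernel_def .
qed

lemma V_stat_eq: "V_stat X H x u f n t \<omega> = u n / real n * (\<Sum>i=0..grid n t. riemann_kernel f n i \<omega>)"
  unfolding V_stat_def riemann_kernel_def incr_def grid_def by simp

lemma V_stat_measurable:
  assumes "f \<in> borel_measurable borel"
  shows "V_stat X H x u f n t \<in> borel_measurable M"
  unfolding V_stat_eq[abs_def] using riemann_kernel_measurable[OF assms] by measurable

text \<open>
  On a grid interval the integrand with sampling at the grid is constant, so the integral over the
  window is the Riemann sum without its first term.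
\<close>

lemma kernel_integral_riemann:
  assumes f: "\<And>p. 0 \<le> f p" and n: "n \<ge> 1"
  shows "kernel_integral True (\<lambda>p. ennreal (f p)) n t \<omega> = ennreal (u n / real n * (\<Sum>i=1..grid n t. riemann_kernel f n i \<omega>))"
proof -
  have un: "u n > 0" and np: "real n > 0" using u_pos n by auto
  have "kernel_integral True (\<lambda>p. ennreal (f p)) n t \<omega>
    = (\<integral>\<^sup>+s. (\<lambda>i. ennreal (u n) * ennreal (riemann_kernel f n i \<omega>)) (grid n s) * indicator {1 / real n..<(real (grid n t) + 1) / real n} s \<partial>lborel)"
    unfolding kernel_integral_def kernel_value_def window_def sample_time_def riemann_kernel_def by simp
  also have "\<dots> = (\<Sum>i=1..grid n t. ennreal (u n) * ennreal (riemann_kernel f n i \<omega>) * ennreal (1 / real n))"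
    by (rule nn_integral_grid_sum[OF n])
  also have "\<dots> = (\<Sum>i=1..grid n t. ennreal (u n / real n * riemann_kernel f n i \<omega>))"
    using un np f by (intro sum.cong refl) (simp add: ennreal_mult[symmetric] riemann_kernel_def)
  also have "\<dots> = ennreal (\<Sum>i=1..grid n t. u n / real n * riemann_kernel f n i \<omega>)"
    using un np f by (intro sum_ennreal) (simp add: riemann_kernel_def)
  finally show ?thesis by (simp only: sum_distrib_left)
qed

lemma kernel_integral_unit_finite: "kernel_integral False unit_kernel n t \<omega> < \<infinity>"
proof -
  have "kernel_integral False unit_kernel n t \<omega> \<le> (\<integral>\<^sup>+s. ennreal (u n) * indicator (window n t) s \<partial>lborel)"
    unfolding kernel_integral_def kernel_value_def unit_kernel_def
    by (intro nn_integral_mono) (auto simp: indicator_def)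
  also have "\<dots> = ennreal (u n) * emeasure lborel (window n t)"
    by (rule nn_integral_cmult_indicator) simp
  also have "\<dots> < \<infinity>"
    unfolding window_def by (cases "1 / real n \<le> (real (grid n t) + 1) / real n") (auto simp: ennreal_mult_less_top)
  finally show ?thesis .
qed

lemma window_zero: "window 0 t = {}"
  by (simp add: window_def)

text \<open>
  At \<open>i = 0\<close> the value of the process is degenerate, but \<open>h\<close> is bounded and the increment has
  exponential moments, whence the bound \<open>O(u n / n)\<close> in mean.
\<close>

lemma initial_term_null:
  assumes f: "f \<in> borel_measurable borel" "\<And>p. 0 \<le> f p" and le: "\<And>y z. f (y, z) \<le> h y * k z"
  shows "null_in_prob (\<lambda>n \<omega>. u n / real n * riemann_kernel f n 0 \<omega>)"
proof (rule null_in_prob_L1)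
  show "(\<lambda>\<omega>. u n / real n * riemann_kernel f n 0 \<omega>) \<in> borel_measurable M" for n
    using riemann_kernel_measurable[OF f(1)] by measurable
  let ?K = "\<bar>S\<bar> * (1 + \<bar>C\<bar>) * (2 * exp (\<sigma>\<^sup>2 / 2))"
  have bd: "(\<integral>\<^sup>+\<omega>. ennreal (u n / real n * riemann_kernel f n 0 \<omega>) \<partial>M) \<le> ennreal (u n / real n * ?K)" if n: "n \<ge> 1" for n
  proof -
    have un: "u n / real n > 0" using u_pos n by simp
    have q0: "0 \<le> u n / real n * (\<bar>S\<bar> * (1 + \<bar>C\<bar>))" using un by (intro mult_nonneg_nonneg) auto
    let ?D = "incr n 0"
    have D: "?D \<in> lin_span" by (rule incr_in)
    have [measurable]: "?D \<in> borel_measurable M" by (rule meas[OF D])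
    have "(\<integral>\<^sup>+\<omega>. ennreal (u n / real n * riemann_kernel f n 0 \<omega>) \<partial>M)
      \<le> (\<integral>\<^sup>+\<omega>. ennreal (u n / real n * (\<bar>S\<bar> * (1 + \<bar>C\<bar>))) * (ennreal (exp (?D \<omega>)) + ennreal (exp (- ?D \<omega>))) \<partial>M)"
    proof (rule nn_integral_mono)
      fix \<omega>
      let ?y = "u n * (X (real 0 / real n) \<omega> - x)"
      have "riemann_kernel f n 0 \<omega> \<le> h ?y * k (?D \<omega>)"
        unfolding riemann_kernel_def by (rule le)
      also have "\<dots> \<le> \<bar>S\<bar> * ((1 + \<bar>C\<bar>) * (exp (?D \<omega>) + exp (- ?D \<omega>)))"
        using h_le[of ?y] k_nonneg by (intro mult_mono k_le_exp) auto
      finally have "u n / real n * riemann_kernel f n 0 \<omega> \<le> u n / real n * (\<bar>S\<bar> * ((1 + \<bar>C\<bar>) * (exp (?D \<omega>) + exp (- ?D \<omega>))))"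
        using un by (intro mult_left_mono) auto
      then have "ennreal (u n / real n * riemann_kernel f n 0 \<omega>) \<le> ennreal (u n / real n * (\<bar>S\<bar> * (1 + \<bar>C\<bar>)) * (exp (?D \<omega>) + exp (- ?D \<omega>)))"
        by (intro ennreal_leI) (simp only: mult.assoc)
      also have "\<dots> = ennreal (u n / real n * (\<bar>S\<bar> * (1 + \<bar>C\<bar>))) * (ennreal (exp (?D \<omega>)) + ennreal (exp (- ?D \<omega>)))"
        by (subst ennreal_mult[OF q0]) (auto simp: ennreal_plus intro!: add_nonneg_nonneg)
      finally show "ennreal (u n / real n * riemann_kernel f n 0 \<omega>)
        \<le> ennreal (u n / real n * (\<bar>S\<bar> * (1 + \<bar>C\<bar>))) * (ennreal (exp (?D \<omega>)) + ennreal (exp (- ?D \<omega>)))" .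
    qed
    also have "\<dots> = ennreal (u n / real n * (\<bar>S\<bar> * (1 + \<bar>C\<bar>))) * ((\<integral>\<^sup>+\<omega>. ennreal (exp (?D \<omega>)) \<partial>M) + (\<integral>\<^sup>+\<omega>. ennreal (exp (- ?D \<omega>)) \<partial>M))"
      by (subst nn_integral_cmult) (simp_all add: nn_integral_add)
    also have "(\<integral>\<^sup>+\<omega>. ennreal (exp (?D \<omega>)) \<partial>M) = ennreal (exp (\<sigma>\<^sup>2 / 2))"
      using exp_moment[OF D] cov_incr_self[OF n] by simp
    also have "(\<integral>\<^sup>+\<omega>. ennreal (exp (- ?D \<omega>)) \<partial>M) = ennreal (exp (\<sigma>\<^sup>2 / 2))"
      using exp_moment[OF neg_in[OF D]] cov_incr_self[OF n] by (simp add: cov_neg)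
    also have "ennreal (u n / real n * (\<bar>S\<bar> * (1 + \<bar>C\<bar>))) * (ennreal (exp (\<sigma>\<^sup>2 / 2)) + ennreal (exp (\<sigma>\<^sup>2 / 2))) = ennreal (u n / real n * ?K)"
    proof -
      have "ennreal (exp (\<sigma>\<^sup>2 / 2)) + ennreal (exp (\<sigma>\<^sup>2 / 2)) = ennreal (2 * exp (\<sigma>\<^sup>2 / 2))"
        by (simp flip: ennreal_plus)
      then show ?thesis by (simp only:) (subst ennreal_mult[OF q0, symmetric], simp_all only: mult_ac, simp)
    qed
    finally show ?thesis .
  qed
  have "(\<lambda>n. ennreal (u n / real n * ?K)) \<longlonglongrightarrow> ennreal (0 * ?K)"
    by (intro tendsto_ennrealI tendsto_mult u_small tendsto_const)
  then have up: "(\<lambda>n. ennreal (u n / real n * ?K)) \<longlonglongrightarrow> 0" by simp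
  show "(\<lambda>n. \<integral>\<^sup>+\<omega>. ennreal (u n / real n * riemann_kernel f n 0 \<omega>) \<partial>M) \<longlonglongrightarrow> 0"
  proof (rule tendsto_sandwich[OF _ _ tendsto_const up])
    show "\<forall>\<^sub>F n in sequentially. (\<integral>\<^sup>+\<omega>. ennreal (u n / real n * riemann_kernel f n 0 \<omega>) \<partial>M) \<le> ennreal (u n / real n * ?K)"
      by (rule eventually_sequentiallyI[of 1]) (rule bd)
  qed simp
qed

text \<open>
  The statistic is written as the initial term plus \<open>v\<close>, and compared with \<open>c\<close> times the occupation
  integral \<open>w\<close>: the difference \<open>v - c w\<close> vanishes in mean square, and \<open>w\<close> tends to the local time path by
  path.
\<close>

lemma fixed_time_convergence:
  assumes f: "f \<in> borel_measurable borel" "\<And>p. 0 \<le> f p" and le: "\<And>y z. f (y, z) \<le> h y * k z" and t: "t \<ge> 0"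
  defines "c \<equiv> enn2real (kernel_mass (\<sigma>\<^sup>2) (\<lambda>p. ennreal (f p)))"
  shows "null_in_prob (\<lambda>n \<omega>. \<bar>V_stat X H x u f n t \<omega> - L t x \<omega> * c\<bar>)"
proof -
  let ?F = "\<lambda>p. ennreal (f p)"
  have F: "dominated_kernel ?F"
    unfolding dominated_kernel_def using f(1) le by (auto simp: borel_prod intro!: ennreal_leI)
  note U = dominated_unit_kernel
  have cF: "kernel_mass (\<sigma>\<^sup>2) ?F = ennreal c"
    unfolding c_def using kernel_mass_finite[OF F] by simp
  have c0: "0 \<le> c" unfolding c_def by simp
  define v where "v n \<omega> = enn2real (kernel_integral True ?F n t \<omega>)" for n \<omega>
  define w where "w n \<omega> = enn2real (kernel_integral False unit_kernel n t \<omega>)" for n \<omega>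
  have v_eq: "v n \<omega> = u n / real n * (\<Sum>i=1..grid n t. riemann_kernel f n i \<omega>)" if n: "n \<ge> 1" for n \<omega>
  proof -
    have "0 \<le> u n / real n * (\<Sum>i=1..grid n t. riemann_kernel f n i \<omega>)"
      using u_pos[OF n] f(2) by (intro mult_nonneg_nonneg sum_nonneg) (auto simp: riemann_kernel_def)
    then show ?thesis unfolding v_def kernel_integral_riemann[of f, OF f(2) n] by simp
  qed
  have vE: "ennreal (v n \<omega>) = kernel_integral True ?F n t \<omega>" for n \<omega>
  proof (cases "n \<ge> 1")
    case True
    then show ?thesis unfolding v_def kernel_integral_riemann[of f, OF f(2) True] by (simp add: ennreal_enn2real_if)
  next
    case False
    then have "n = 0" by simp
    then show ?thesis unfolding v_def by (simp add: kernel_integral_def window_zero)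
  qed
  have wE: "ennreal (w n \<omega>) = kernel_integral False unit_kernel n t \<omega>" for n \<omega>
    unfolding w_def using kernel_integral_unit_finite by simp
  have v0: "0 \<le> v n \<omega>" and w0: "0 \<le> w n \<omega>" for n \<omega> unfolding v_def w_def by auto
  have [measurable]: "v n \<in> borel_measurable M" "w n \<in> borel_measurable M" for n
    unfolding v_def w_def using kernel_integral_measurable[OF F] kernel_integral_measurable[OF U]
    by (auto intro: borel_measurable_enn2real)
  note [measurable] = L_measurable[OF t] V_stat_measurable[OF f(1)]
  note lim = kernel_integral_moment_tendsto[OF _ _ t]
  have "(\<lambda>n. \<integral>\<^sup>+\<omega>. ennreal ((v n \<omega> - c * w n \<omega>)\<^sup>2) \<partial>M) \<longlonglongrightarrow> 0"
  proof (rule second_moment_cancellation[where K="local_time_moment t"])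
    show "(\<lambda>n. \<integral>\<^sup>+\<omega>. ennreal (v n \<omega> * v n \<omega>) \<partial>M) \<longlonglongrightarrow> local_time_moment t * (ennreal c * ennreal c)"
      using lim[OF F F, of True True] by (simp add: ennreal_mult v0 vE cF)
    show "(\<lambda>n. \<integral>\<^sup>+\<omega>. ennreal (v n \<omega> * w n \<omega>) \<partial>M) \<longlonglongrightarrow> local_time_moment t * ennreal c"
      using lim[OF F U, of True False] by (simp add: ennreal_mult v0 w0 vE wE cF kernel_mass_unit)
    show "(\<lambda>n. \<integral>\<^sup>+\<omega>. ennreal (w n \<omega> * w n \<omega>) \<partial>M) \<longlonglongrightarrow> local_time_moment t"
      using lim[OF U U, of False False] by (simp add: ennreal_mult w0 wE kernel_mass_unit)
  qed (use v0 w0 c0 local_time_moment_finite[OF t] in auto)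
  then have N1: "null_in_prob (\<lambda>n \<omega>. \<bar>v n \<omega> - c * w n \<omega>\<bar>)"
    by (intro null_in_prob_L2) measurable
  have N2: "null_in_prob (\<lambda>n \<omega>. \<bar>c * (w n \<omega> - L t x \<omega>)\<bar>)"
  proof (rule null_in_prob_pointwise)
    fix \<omega> assume \<omega>: "\<omega> \<in> space M"
    have "(\<lambda>n. w n \<omega>) \<longlonglongrightarrow> L t x \<omega>"
      unfolding w_def by (rule tendsto_enn2real[OF unit_integral_tendsto[OF \<omega> t] L_nonneg[OF \<omega> t]])
    then have "(\<lambda>n. \<bar>c * (w n \<omega> - L t x \<omega>)\<bar>) \<longlonglongrightarrow> \<bar>c * (L t x \<omega> - L t x \<omega>)\<bar>"
      by (intro tendsto_intros)
    then show "(\<lambda>n. \<bar>c * (w n \<omega> - L t x \<omega>)\<bar>) \<longlonglongrightarrow> 0" by simp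
  qed measurable
  show ?thesis
  proof (rule null_in_prob_mono[OF null_in_prob_add[OF initial_term_null[OF f le] null_in_prob_add[OF N1 N2]]])
    fix n :: nat and \<omega> assume n: "n \<ge> 1"
    have "V_stat X H x u f n t \<omega> = u n / real n * riemann_kernel f n 0 \<omega> + v n \<omega>"
      unfolding V_stat_eq v_eq[OF n] by (simp add: sum.atLeast_Suc_atMost distrib_left)
    moreover have "0 \<le> u n / real n * riemann_kernel f n 0 \<omega>"
      using u_pos[OF n] f(2) by (auto simp: riemann_kernel_def)
    moreover have "c * (w n \<omega> - L t x \<omega>) = c * w n \<omega> - L t x \<omega> * c" by (simp add: algebra_simps)
    ultimately show "\<bar>V_stat X H x u f n t \<omega> - L t x \<omega> * c\<bar>
      \<le> u n / real n * riemann_kernel f n 0 \<omega> + (\<bar>v n \<omega> - c * w n \<omega>\<bar> + \<bar>c * (w n \<omega> - L t x \<omega>)\<bar>)"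
      by linarith
  qed measurable
qed

end

section \<open>Uniformity in time\<close>

context local_time_setting
begin

lemma grid_mono: "t \<le> t' \<Longrightarrow> grid n t \<le> grid n t'"
  unfolding grid_def by (intro nat_mono floor_mono mult_left_mono) auto

lemma V_stat_mono:
  assumes f: "\<And>p. 0 \<le> f p" and n: "n \<ge> 1" and t: "t \<le> t'"
  shows "V_stat X H x u f n t \<omega> \<le> V_stat X H x u f n t' \<omega>"
  unfolding V_stat_eq using f u_pos[OF n] grid_mono[OF t, of n]
  by (intro mult_left_mono sum_mono2) (auto simp: riemann_kernel_def)

lemma grid_right_constant:
  assumes t: "t \<ge> 0" and q: "q \<longlonglongrightarrow> t" "\<And>k. t \<le> q k"
  shows "\<forall>\<^sub>F k in sequentially. grid n (q k) = grid n t"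
proof (cases "n \<ge> 1")
  case True
  have "t < (real (grid n t) + 1) / real n"
    using grid_bounds(2)[OF True t] by (simp add: add_divide_distrib)
  then have "\<forall>\<^sub>F k in sequentially. q k < (real (grid n t) + 1) / real n" by (rule order_tendstoD(2)[OF q(1)])
  then show ?thesis
    by eventually_elim (rule grid_eq[OF True], use grid_bounds(1)[OF True t] q(2) order_trans in \<open>blast\<close>, simp)
next
  case False
  then have "n = 0" by simp
  then show ?thesis by (simp add: grid_def)
qed

text \<open>
  The deviation is right-continuous in \<open>t\<close>, as the statistic is locally constant to the right and the
  local time is continuous. The supremum may therefore be taken over the rationals in \<open>[0, T]\<close>
  together with the endpoint \<open>T\<close>, which has no rationals to its right there.
\<close>

lemma deviation_sup_measurable:
  assumes f: "f \<in> borel_measurable borel" and T: "T > 0"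
  shows "(\<lambda>\<omega>. SUP t\<in>{0..T}. ennreal \<bar>V_stat X H x u f n t \<omega> - L t x \<omega> * c\<bar>) \<in> borel_measurable M"
proof -
  let ?g = "\<lambda>t \<omega>. \<bar>V_stat X H x u f n t \<omega> - L t x \<omega> * c\<bar>"
  let ?D = "(\<rat> \<inter> {0..T}) \<union> {T}"
  have D: "countable ?D" by (auto intro: countable_rat countable_Int1)
  have "(\<lambda>\<omega>. SUP t\<in>?D. ennreal (?g t \<omega>)) \<in> borel_measurable M"
  proof (rule borel_measurable_SUP[OF D])
    fix t assume "t \<in> ?D"
    then have "t \<ge> 0" using T by auto
    note [measurable] = L_measurable[OF this] V_stat_measurable[OF f]
    show "(\<lambda>\<omega>. ennreal (?g t \<omega>)) \<in> borel_measurable M" by measurable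
  qed
  also have "?this \<longleftrightarrow> ?thesis"
  proof (rule measurable_cong)
    fix \<omega> assume \<omega>: "\<omega> \<in> space M"
    show "(SUP t\<in>?D. ennreal (?g t \<omega>)) = (SUP t\<in>{0..T}. ennreal (?g t \<omega>))"
    proof (rule antisym)
      show "(SUP t\<in>?D. ennreal (?g t \<omega>)) \<le> (SUP t\<in>{0..T}. ennreal (?g t \<omega>))"
        using T by (intro SUP_subset_mono) auto
      show "(SUP t\<in>{0..T}. ennreal (?g t \<omega>)) \<le> (SUP t\<in>?D. ennreal (?g t \<omega>))"
      proof (rule SUP_least)
        fix t assume t: "t \<in> {0..T}"
        show "ennreal (?g t \<omega>) \<le> (SUP t\<in>?D. ennreal (?g t \<omega>))"
        proof (cases "t = T")
          case True
          then show ?thesis by (intro SUP_upper) auto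
        next
          case False
          then have tT: "t < T" using t by auto
          have "\<exists>q\<in>\<rat>. t < q \<and> q < min T (t + 1 / real (Suc k))" for k
            using tT by (intro Rats_dense_in_real) auto
          then obtain q where q: "\<And>k. q k \<in> \<rat>" "\<And>k. t < q k" "\<And>k. q k < min T (t + 1 / real (Suc k))"
            by metis
          have "(\<lambda>k. t + 1 / real (Suc k)) \<longlonglongrightarrow> t + 0"
            by (intro tendsto_add tendsto_const LIMSEQ_Suc[OF lim_1_over_n])
          then have ql: "q \<longlonglongrightarrow> t"
            by (intro tendsto_sandwich[OF _ _ tendsto_const, of t q _ "\<lambda>k. t + 1 / real (Suc k)"])
              (use q in \<open>auto intro!: always_eventually less_imp_le\<close>)
          have qD: "q k \<in> ?D" for k using q(1)[of k] q(2)[of k] q(3)[of k] t by auto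
          have "\<forall>\<^sub>F k in sequentially. grid n (q k) = grid n t"
            by (rule grid_right_constant[OF _ ql]) (use t q(2) in \<open>auto simp: less_imp_le\<close>)
          then have "(\<lambda>k. V_stat X H x u f n (q k) \<omega>) \<longlonglongrightarrow> V_stat X H x u f n t \<omega>"
            unfolding V_stat_eq by (intro tendsto_eventually) (rule eventually_mono, assumption, simp only:)
          moreover have "(\<lambda>k. L (q k) x \<omega>) \<longlonglongrightarrow> L t x \<omega>"
            by (rule continuous_on_tendsto_compose[OF L_cont_t[OF \<omega>] ql])
              (use t q(2) in \<open>auto intro!: always_eventually intro: order_trans less_imp_le\<close>)
          ultimately have "(\<lambda>k. ennreal (?g (q k) \<omega>)) \<longlonglongrightarrow> ennreal (?g t \<omega>)"
            by (intro tendsto_intros)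
          then show ?thesis
            by (rule LIMSEQ_le_const2) (intro exI[of _ 0] allI impI SUP_upper qD)
        qed
      qed
    qed
  qed
  finally show ?thesis .
qed

text \<open>
  Between two neighbouring points of a partition of \<open>[0, T]\<close> both functions are enclosed by
  their values at these points. Hence a deviation beyond \<open>\<epsilon>\<close> somewhere requires a deviation beyond \<open>\<epsilon> / 2\<close> at a
  partition point, or an oscillation of the limit beyond \<open>\<epsilon> / 2\<close> on some cell (the event \<open>E m\<close>). The latter is
  improbable for fine partitions by uniform continuity, the former for large \<open>n\<close> once the partition is
  chosen.
\<close>

lemma uniform_deviation_null_nonneg:
  assumes f: "f \<in> borel_measurable borel" "\<And>p. 0 \<le> f p" and le: "\<And>y z. f (y, z) \<le> h y * k z" and T: "T > 0" and e: "\<epsilon> > 0"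
  defines "c \<equiv> enn2real (kernel_mass (\<sigma>\<^sup>2) (\<lambda>p. ennreal (f p)))"
  shows "(\<lambda>n. prob {\<omega> \<in> space M. (SUP t\<in>{0..T}. ennreal \<bar>V_stat X H x u f n t \<omega> - L t x \<omega> * c\<bar>) > ennreal \<epsilon>}) \<longlonglongrightarrow> 0"
proof -
  let ?V = "\<lambda>n t \<omega>. V_stat X H x u f n t \<omega>"
  define A where "A t \<omega> = L t x \<omega> * c" for t \<omega>
  have c0: "0 \<le> c" unfolding c_def by simp
  define \<tau> where "\<tau> m j = T * real j / real m" for m j :: nat
  have \<tau>0: "0 \<le> \<tau> m j" for m j unfolding \<tau>_def using T by simp
  have A_meas[measurable]: "A (\<tau> m j) \<in> borel_measurable M" for m j
    unfolding A_def using L_measurable[OF \<tau>0] by measurable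
  note [measurable] = V_stat_measurable[OF f(1)]
  have A_mono: "A t \<omega> \<le> A t' \<omega>" if "\<omega> \<in> space M" "0 \<le> t" "t \<le> t'" for t t' \<omega>
    unfolding A_def using L_mono[OF that] c0 by (intro mult_right_mono)
  define E where "E m = {\<omega> \<in> space M. \<exists>j<m. \<epsilon> / 2 < A (\<tau> m (Suc j)) \<omega> - A (\<tau> m j) \<omega>}" for m
  have E_meas[measurable]: "E m \<in> sets M" for m unfolding E_def by measurable
  have "null_in_prob (\<lambda>m. indicator (E m))"
  proof (rule null_in_prob_pointwise)
    fix \<omega> assume \<omega>: "\<omega> \<in> space M"
    have "continuous_on {0..T} (\<lambda>t. A t \<omega>)"
      unfolding A_def using continuous_on_subset[OF L_cont_t[OF \<omega>], of "{0..T}"] by (intro continuous_intros) auto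
    then have "uniformly_continuous_on {0..T} (\<lambda>t. A t \<omega>)"
      by (rule compact_uniformly_continuous) simp
    then obtain d where d: "d > 0" "\<And>s t. s \<in> {0..T} \<Longrightarrow> t \<in> {0..T} \<Longrightarrow> dist t s < d \<Longrightarrow> dist (A t \<omega>) (A s \<omega>) < \<epsilon> / 2"
      using e unfolding uniformly_continuous_on_def by (meson half_gt_zero)
    have "\<forall>\<^sub>F m in sequentially. T / real m < d" by (rule order_tendstoD(2)[OF lim_const_over_n d(1)])
    then have "\<forall>\<^sub>F m in sequentially. indicator (E m) \<omega> = (0::real)"
    proof eventually_elim
      case (elim m)
      have "\<not> \<epsilon> / 2 < A (\<tau> m (Suc j)) \<omega> - A (\<tau> m j) \<omega>" if j: "j < m" for j
      proof -
        have mp: "real m > 0" using j by simp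
        have le: "real (Suc j) / real m \<le> 1" "real j / real m \<le> 1" using j by auto
        have "\<tau> m (Suc j) \<in> {0..T}" "\<tau> m j \<in> {0..T}"
          using mult_left_mono[OF le(1), of T] mult_left_mono[OF le(2), of T] T \<tau>0 by (auto simp: \<tau>_def)
        moreover have "\<tau> m (Suc j) - \<tau> m j = T / real m"
          unfolding \<tau>_def by (simp add: diff_divide_distrib[symmetric] right_diff_distrib[symmetric])
        then have "dist (\<tau> m (Suc j)) (\<tau> m j) < d" using elim T by (simp add: dist_real_def)
        ultimately have "dist (A (\<tau> m (Suc j)) \<omega>) (A (\<tau> m j) \<omega>) < \<epsilon> / 2" by (intro d(2))
        then show ?thesis unfolding dist_real_def by linarith
      qed
      then show ?case by (auto simp: E_def indicator_def)
    qed
    then show "(\<lambda>m. indicator (E m) \<omega>) \<longlonglongrightarrow> (0::real)" by (rule tendsto_eventually)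
  qed measurable
  then have "(\<lambda>m. prob {\<omega> \<in> space M. 1 / 2 < (indicator (E m) \<omega> :: real)}) \<longlonglongrightarrow> 0"
    unfolding null_in_prob_def by (meson half_gt_zero zero_less_one)
  also have "(\<lambda>m. prob {\<omega> \<in> space M. 1 / 2 < (indicator (E m) \<omega> :: real)}) = (\<lambda>m. prob (E m))"
    by (intro ext arg_cong[where f=prob]) (auto simp: E_def indicator_def split: if_splits)
  finally have E_lim: "(\<lambda>m. prob (E m)) \<longlonglongrightarrow> 0" .
  let ?B = "\<lambda>n m j. {\<omega> \<in> space M. \<epsilon> / 2 < \<bar>?V n (\<tau> m j) \<omega> - A (\<tau> m j) \<omega>\<bar>}"
  have B_meas[measurable]: "?B n m j \<in> sets M" for n m j by measurable
  have B_lim: "(\<lambda>n. prob (?B n m j)) \<longlonglongrightarrow> 0" for m j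
    using fixed_time_convergence[OF f le \<tau>0[of m j]] half_gt_zero[OF e]
    unfolding null_in_prob_def A_def c_def by blast
  have key: "prob {\<omega> \<in> space M. (SUP t\<in>{0..T}. ennreal \<bar>?V n t \<omega> - L t x \<omega> * c\<bar>) > ennreal \<epsilon>}
      \<le> prob (E m) + (\<Sum>j\<le>m. prob (?B n m j))" if n: "n \<ge> 1" and m: "m \<ge> 1" for n m
  proof -
    have "{\<omega> \<in> space M. (SUP t\<in>{0..T}. ennreal \<bar>?V n t \<omega> - L t x \<omega> * c\<bar>) > ennreal \<epsilon>} \<subseteq> E m \<union> (\<Union>j\<le>m. ?B n m j)"
    proof (rule subsetI, rule ccontr)
      fix \<omega> assume \<omega>: "\<omega> \<in> {\<omega> \<in> space M. (SUP t\<in>{0..T}. ennreal \<bar>?V n t \<omega> - L t x \<omega> * c\<bar>) > ennreal \<epsilon>}"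
        and not: "\<omega> \<notin> E m \<union> (\<Union>j\<le>m. ?B n m j)"
      have sp: "\<omega> \<in> space M" using \<omega> by simp
      have osc: "A (\<tau> m (Suc j)) \<omega> - A (\<tau> m j) \<omega> \<le> \<epsilon> / 2" if "j < m" for j
      proof (rule leI, rule notI)
        assume "\<epsilon> / 2 < A (\<tau> m (Suc j)) \<omega> - A (\<tau> m j) \<omega>"
        then have "\<omega> \<in> E m" unfolding E_def using sp that by blast
        then show False using not by blast
      qed
      have dev: "\<bar>?V n (\<tau> m j) \<omega> - A (\<tau> m j) \<omega>\<bar> \<le> \<epsilon> / 2" if "j \<le> m" for j
        using not sp that by (auto simp: not_less)
      have "(SUP t\<in>{0..T}. ennreal \<bar>?V n t \<omega> - L t x \<omega> * c\<bar>) \<le> ennreal \<epsilon>"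
      proof (intro SUP_least ennreal_leI)
        fix t assume t: "t \<in> {0..T}"
        have mp: "real m > 0" using m by simp
        have "\<exists>j<m. \<tau> m j \<le> t \<and> t \<le> \<tau> m (Suc j)"
        proof (cases "t = T")
          case True
          have "\<tau> m (m - 1) \<le> T" "\<tau> m (Suc (m - 1)) = T"
            unfolding \<tau>_def using T m by (auto simp: divide_le_eq mult_left_mono)
          then show ?thesis using True m by (intro exI[of _ "m - 1"]) auto
        next
          case False
          then have tT: "t < T" using t by auto
          define j where "j = nat \<lfloor>t * real m / T\<rfloor>"
          have r0: "0 \<le> t * real m / T" using t T by simp
          have rj: "real j = of_int \<lfloor>t * real m / T\<rfloor>" unfolding j_def using r0 by simp
          have lo: "real j \<le> t * real m / T" and hi: "t * real m / T < real j + 1" unfolding rj by linarith+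
          have "t * real m / T < real m" using tT T mp by (simp add: divide_less_eq mult.commute)
          then have "j < m" using lo by linarith
          moreover have "\<tau> m j \<le> t" using lo T mp unfolding \<tau>_def by (simp add: field_simps)
          moreover have "t \<le> \<tau> m (Suc j)" using hi T mp unfolding \<tau>_def by (simp add: field_simps)
          ultimately show ?thesis by blast
        qed
        then obtain j where j: "j < m" "\<tau> m j \<le> t" "t \<le> \<tau> m (Suc j)" by blast
        have "?V n (\<tau> m j) \<omega> \<le> ?V n t \<omega>" "?V n t \<omega> \<le> ?V n (\<tau> m (Suc j)) \<omega>"
          by (auto intro!: V_stat_mono[OF f(2) n] j)
        moreover have "A (\<tau> m j) \<omega> \<le> A t \<omega>" "A t \<omega> \<le> A (\<tau> m (Suc j)) \<omega>"
          using j t by (auto intro!: A_mono[OF sp] \<tau>0)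
        ultimately show "\<bar>?V n t \<omega> - L t x \<omega> * c\<bar> \<le> \<epsilon>"
          using osc[OF j(1)] dev[OF less_imp_le[OF j(1)]] dev[OF Suc_leI[OF j(1)]] unfolding A_def by linarith
      qed
      then show False using \<omega> leD by blast
    qed
    then have "prob {\<omega> \<in> space M. (SUP t\<in>{0..T}. ennreal \<bar>?V n t \<omega> - L t x \<omega> * c\<bar>) > ennreal \<epsilon>} \<le> prob (E m \<union> (\<Union>j\<le>m. ?B n m j))"
      by (rule finite_measure_mono) measurable
    also have "\<dots> \<le> prob (E m) + prob (\<Union>j\<le>m. ?B n m j)"
      by (rule measure_Un_le) measurable
    also have "prob (\<Union>j\<le>m. ?B n m j) \<le> (\<Sum>j\<le>m. prob (?B n m j))"
      by (rule finite_measure_subadditive_finite) auto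
    finally show ?thesis by simp
  qed
  show ?thesis
  proof (rule order_tendstoI)
    fix \<eta> :: real assume \<eta>: "0 < \<eta>"
    have "\<forall>\<^sub>F m in sequentially. prob (E m) < \<eta> / 2" by (rule order_tendstoD(2)[OF E_lim]) (use \<eta> in simp)
    then obtain m where m: "m \<ge> 1" "prob (E m) < \<eta> / 2"
      by (metis eventually_at_top_linorder nat_le_linear)
    have "(\<lambda>n. \<Sum>j\<le>m. prob (?B n m j)) \<longlonglongrightarrow> (\<Sum>j\<le>m. 0)" by (intro tendsto_sum B_lim)
    then have "(\<lambda>n. \<Sum>j\<le>m. prob (?B n m j)) \<longlonglongrightarrow> 0" by simp
    then have "\<forall>\<^sub>F n in sequentially. (\<Sum>j\<le>m. prob (?B n m j)) < \<eta> / 2" by (rule order_tendstoD(2)) (use \<eta> in simp)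
    then show "\<forall>\<^sub>F n in sequentially. prob {\<omega> \<in> space M. (SUP t\<in>{0..T}. ennreal \<bar>?V n t \<omega> - L t x \<omega> * c\<bar>) > ennreal \<epsilon>} < \<eta>"
      using eventually_ge_at_top[of 1]
    proof eventually_elim
      case (elim n)
      then show ?case using key[OF elim(2) m(1)] m(2) by linarith
    qed
  next
    fix \<eta> :: real assume "\<eta> < 0"
    then show "\<forall>\<^sub>F n in sequentially. \<eta> < prob {\<omega> \<in> space M. (SUP t\<in>{0..T}. ennreal \<bar>?V n t \<omega> - L t x \<omega> * c\<bar>) > ennreal \<epsilon>}"
      by (intro always_eventually allI) (rule less_le_trans[OF _ measure_nonneg])
  qed
qed

lemma kernel_integral_eq_mass:
  assumes f: "f \<in> borel_measurable borel" "\<And>p. 0 \<le> f p" and le: "\<And>y z. f (y, z) \<le> h y * k z"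
  shows "integrable lborel (\<lambda>p. f p * normal_density 0 \<sigma> (snd p))"
    and "(\<integral>p. f p * normal_density 0 \<sigma> (snd p) \<partial>lborel) = enn2real (kernel_mass (\<sigma>\<^sup>2) (\<lambda>p. ennreal (f p)))"
proof -
  have fm: "f \<in> borel_measurable (lborel \<Otimes>\<^sub>M lborel)" using f(1) by (simp add: lborel_prod)
  have F: "dominated_kernel (\<lambda>p. ennreal (f p))"
    unfolding dominated_kernel_def using f(1) le by (auto simp: borel_prod intro!: ennreal_leI)
  have gm: "(\<lambda>p. f p * normal_density 0 \<sigma> (snd p)) \<in> borel_measurable (lborel \<Otimes>\<^sub>M lborel)"
    using fm by measurable
  have m: "case_prod (\<lambda>y z. ennreal (f (y, z)) * ennreal (normal_density 0 \<sigma> z)) \<in> borel_measurable (lborel \<Otimes>\<^sub>M lborel)"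
    unfolding case_prod_beta using fm by simp
  have "(\<integral>\<^sup>+p. ennreal (f p * normal_density 0 \<sigma> (snd p)) \<partial>lborel)
    = (\<integral>\<^sup>+p. ennreal (f (fst p, snd p)) * ennreal (normal_density 0 \<sigma> (snd p)) \<partial>(lborel \<Otimes>\<^sub>M lborel))"
    unfolding lborel_prod using f(2) by (simp add: ennreal_mult)
  also have "\<dots> = (\<integral>\<^sup>+z. \<integral>\<^sup>+y. ennreal (f (y, z)) * ennreal (normal_density 0 \<sigma> z) \<partial>lborel \<partial>lborel)"
    by (rule lborel2_Fubini(2)[OF m])
  also have "\<dots> = kernel_mass (\<sigma>\<^sup>2) (\<lambda>p. ennreal (f p))"
    unfolding kernel_mass_def using sigma by simp
  finally have I: "(\<integral>\<^sup>+p. ennreal (f p * normal_density 0 \<sigma> (snd p)) \<partial>lborel) = kernel_mass (\<sigma>\<^sup>2) (\<lambda>p. ennreal (f p))" .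
  have gm': "(\<lambda>p. f p * normal_density 0 \<sigma> (snd p)) \<in> borel_measurable lborel"
    using gm by (simp add: lborel_prod)
  show i: "integrable lborel (\<lambda>p. f p * normal_density 0 \<sigma> (snd p))"
    by (rule integrableI_nonneg[OF gm']) (use f(2) I kernel_mass_finite[OF F] in auto)
  show "(\<integral>p. f p * normal_density 0 \<sigma> (snd p) \<partial>lborel) = enn2real (kernel_mass (\<sigma>\<^sup>2) (\<lambda>p. ennreal (f p)))"
    unfolding I[symmetric] using f(2) by (intro integral_eq_nn_integral[OF gm']) auto
qed

text \<open>
  Positive and negative parts of \<open>f\<close> are treated separately, since monotonicity in time holds
  only for kernels of one sign.
\<close>

lemma uniform_deviation_null:
  assumes f: "f \<in> borel_measurable borel" and le: "\<And>y z. \<bar>f (y, z)\<bar> \<le> h y * k z" and T: "T > 0" and e: "\<epsilon> > 0"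
  defines "c \<equiv> (\<integral>(y, z). f (y, z) * normal_density 0 \<sigma> z \<partial>lborel)"
  shows "(\<lambda>n. prob {\<omega> \<in> space M. (SUP t\<in>{0..T}. ennreal \<bar>V_stat X H x u f n t \<omega> - L t x \<omega> * c\<bar>) > ennreal \<epsilon>}) \<longlonglongrightarrow> 0"
proof -
  define f1 where "f1 p = max (f p) 0" for p
  define f2 where "f2 p = max (- f p) 0" for p
  have m: "f1 \<in> borel_measurable borel" "f2 \<in> borel_measurable borel"
    unfolding f1_def f2_def using f by measurable
  have pos: "\<And>p. 0 \<le> f1 p" "\<And>p. 0 \<le> f2 p" unfolding f1_def f2_def by auto
  have hk: "0 \<le> h y * k z" for y z using h_nonneg k_nonneg by simp
  have le12: "f1 (y, z) \<le> h y * k z" "f2 (y, z) \<le> h y * k z" for y z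
    using le[of y z] hk[of y z] unfolding f1_def f2_def by auto
  have ff: "f p = f1 p - f2 p" for p unfolding f1_def f2_def by auto
  define c1 where "c1 = enn2real (kernel_mass (\<sigma>\<^sup>2) (\<lambda>p. ennreal (f1 p)))"
  define c2 where "c2 = enn2real (kernel_mass (\<sigma>\<^sup>2) (\<lambda>p. ennreal (f2 p)))"
  have c: "c = c1 - c2"
  proof -
    have "c = (\<integral>p. f1 p * normal_density 0 \<sigma> (snd p) - f2 p * normal_density 0 \<sigma> (snd p) \<partial>lborel)"
      unfolding c_def by (intro Bochner_Integration.integral_cong) (auto simp: ff left_diff_distrib)
    also have "\<dots> = c1 - c2"
      unfolding c1_def c2_def
      by (simp only: Bochner_Integration.integral_diff[OF kernel_integral_eq_mass(1)[OF m(1) pos(1) le12(1)] kernel_integral_eq_mass(1)[OF m(2) pos(2) le12(2)]]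
          kernel_integral_eq_mass(2)[OF m(1) pos(1) le12(1)] kernel_integral_eq_mass(2)[OF m(2) pos(2) le12(2)])
    finally show ?thesis .
  qed
  have V: "V_stat X H x u f n t \<omega> = V_stat X H x u f1 n t \<omega> - V_stat X H x u f2 n t \<omega>" for n t \<omega>
    unfolding V_stat_eq riemann_kernel_def ff by (simp add: sum_subtractf right_diff_distrib)
  let ?S = "\<lambda>f c n \<omega>. SUP t\<in>{0..T}. ennreal \<bar>V_stat X H x u f n t \<omega> - L t x \<omega> * c\<bar>"
  have S: "?S f c n \<omega> \<le> ?S f1 c1 n \<omega> + ?S f2 c2 n \<omega>" for n \<omega>
  proof (rule SUP_least)
    fix t assume t: "t \<in> {0..T}"
    have "\<bar>V_stat X H x u f n t \<omega> - L t x \<omega> * c\<bar> \<le> \<bar>V_stat X H x u f1 n t \<omega> - L t x \<omega> * c1\<bar> + \<bar>V_stat X H x u f2 n t \<omega> - L t x \<omega> * c2\<bar>"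
      unfolding V c right_diff_distrib by linarith
    then have "ennreal \<bar>V_stat X H x u f n t \<omega> - L t x \<omega> * c\<bar> \<le> ennreal \<bar>V_stat X H x u f1 n t \<omega> - L t x \<omega> * c1\<bar> + ennreal \<bar>V_stat X H x u f2 n t \<omega> - L t x \<omega> * c2\<bar>"
      by (simp only: ennreal_plus[symmetric] abs_ge_zero ennreal_leI)
    also have "\<dots> \<le> ?S f1 c1 n \<omega> + ?S f2 c2 n \<omega>"
      using t by (intro add_mono SUP_upper)
    finally show "ennreal \<bar>V_stat X H x u f n t \<omega> - L t x \<omega> * c\<bar> \<le> ?S f1 c1 n \<omega> + ?S f2 c2 n \<omega>" .
  qed
  have gt_sets: "{\<omega> \<in> space M. g \<omega> > ennreal d} \<in> sets M" if [measurable]: "g \<in> borel_measurable M" for g d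
    by measurable
  note ms = gt_sets[OF deviation_sup_measurable[OF m(1) T]] gt_sets[OF deviation_sup_measurable[OF m(2) T]]
  let ?E = "\<lambda>f c n \<epsilon>. {\<omega> \<in> space M. ?S f c n \<omega> > ennreal \<epsilon>}"
  have "(\<lambda>n. prob (?E f1 c1 n (\<epsilon> / 2)) + prob (?E f2 c2 n (\<epsilon> / 2))) \<longlonglongrightarrow> 0 + 0"
    unfolding c1_def c2_def
    by (intro tendsto_add uniform_deviation_null_nonneg m pos le12 T) (use e in auto)
  then have up: "(\<lambda>n. prob (?E f1 c1 n (\<epsilon> / 2)) + prob (?E f2 c2 n (\<epsilon> / 2))) \<longlonglongrightarrow> 0" by simp
  show ?thesis
  proof (rule tendsto_sandwich[OF _ _ tendsto_const up])
    show "\<forall>\<^sub>F n in sequentially. prob (?E f c n \<epsilon>) \<le> prob (?E f1 c1 n (\<epsilon> / 2)) + prob (?E f2 c2 n (\<epsilon> / 2))"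
    proof (intro always_eventually allI)
      fix n
      have "?E f c n \<epsilon> \<subseteq> ?E f1 c1 n (\<epsilon> / 2) \<union> ?E f2 c2 n (\<epsilon> / 2)"
      proof (rule subsetI, rule ccontr)
        fix \<omega> assume \<omega>: "\<omega> \<in> ?E f c n \<epsilon>" and not: "\<omega> \<notin> ?E f1 c1 n (\<epsilon> / 2) \<union> ?E f2 c2 n (\<epsilon> / 2)"
        have "?S f1 c1 n \<omega> + ?S f2 c2 n \<omega> \<le> ennreal (\<epsilon> / 2) + ennreal (\<epsilon> / 2)"
          using \<omega> not by (intro add_mono) (auto simp: not_less)
        also have "\<dots> = ennreal \<epsilon>" using e by (subst ennreal_plus[symmetric]) auto
        finally have "?S f c n \<omega> \<le> ennreal \<epsilon>" using S order_trans by blast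
        then show False using \<omega> leD by blast
      qed
      then have "prob (?E f c n \<epsilon>) \<le> prob (?E f1 c1 n (\<epsilon> / 2) \<union> ?E f2 c2 n (\<epsilon> / 2))"
        by (rule finite_measure_mono) (intro sets.Un ms)
      also have "\<dots> \<le> prob (?E f1 c1 n (\<epsilon> / 2)) + prob (?E f2 c2 n (\<epsilon> / 2))"
        by (rule measure_Un_le; rule ms)
      finally show "prob (?E f c n \<epsilon>) \<le> \<dots>" .
    qed
  qed simp
qed

end

section \<open>From almost sure regularity to the theorem\<close>

text \<open>
  Apply \<open>v \<le> exp v\<close> to \<open>v = \<bar>z\<bar> / (2 * p)\<close> and raise to the power \<open>p\<close>.
\<close>

lemma powr_le_exp_half:
  fixes z p :: real
  assumes "p > 0"
  shows "\<bar>z\<bar> powr p \<le> (2 * p) powr p * exp (\<bar>z\<bar> / 2)"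
proof -
  have "\<bar>z\<bar> / (2 * p) \<le> exp (\<bar>z\<bar> / (2 * p))"
    using exp_ge_add_one_self[of "\<bar>z\<bar> / (2 * p)"] by linarith
  then have "\<bar>z\<bar> \<le> 2 * p * exp (\<bar>z\<bar> / (2 * p))"
    using assms by (simp add: field_simps)
  then have "\<bar>z\<bar> powr p \<le> (2 * p * exp (\<bar>z\<bar> / (2 * p))) powr p"
    using assms by (intro powr_mono2) auto
  also have "\<dots> = (2 * p) powr p * exp (\<bar>z\<bar> / (2 * p)) powr p"
    using assms by (intro powr_mult)
  also have "exp (\<bar>z\<bar> / (2 * p)) powr p = exp (\<bar>z\<bar> / 2)"
    using assms by (simp add: powr_def)
  finally show ?thesis .
qed

lemma polynomial_growth_square_le_exp:
  assumes "polynomial_growth g" "\<And>z. 0 \<le> g z"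
  obtains C where "\<And>z. (g z + 1)\<^sup>2 \<le> C * (exp z + exp (- z))"
proof -
  obtain C p where C: "C > 0" "p > 0" "\<And>z. \<bar>g z\<bar> \<le> C * (1 + \<bar>z\<bar> powr p)"
    using assms(1) unfolding polynomial_growth_def by auto
  define K where "K = C * (1 + (2 * p) powr p) + 1"
  have "(g z + 1)\<^sup>2 \<le> K\<^sup>2 * (exp z + exp (- z))" for z
  proof -
    let ?e = "exp (\<bar>z\<bar> / 2)"
    have e1: "1 \<le> ?e" by simp
    have "g z \<le> C * (1 + \<bar>z\<bar> powr p)" using C(3)[of z] by linarith
    also have "\<dots> \<le> C * (?e + (2 * p) powr p * ?e)"
      using C e1 powr_le_exp_half[OF C(2), of z] by (intro mult_left_mono add_mono) auto
    also have "\<dots> = C * (1 + (2 * p) powr p) * ?e" by (simp add: algebra_simps)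
    finally have "g z + 1 \<le> K * ?e" using e1 unfolding K_def distrib_right by linarith
    then have "(g z + 1)\<^sup>2 \<le> (K * ?e)\<^sup>2" using assms(2)[of z] by (intro power_mono) auto
    also have "\<dots> = K\<^sup>2 * exp \<bar>z\<bar>"
      by (simp add: power_mult_distrib exp_double[symmetric])
    also have "exp \<bar>z\<bar> \<le> exp z + exp (- z)" by (auto simp: abs_if)
    finally show ?thesis by (simp add: mult_left_mono)
  qed
  then show ?thesis by (rule that)
qed

lemma bounded_of_continuous_vanishing:
  fixes h :: "real \<Rightarrow> real"
  assumes c: "continuous_on UNIV h" and lim: "(h \<longlongrightarrow> 0) at_infinity"
  obtains S where "\<And>y. h y \<le> S"
proof -
  have "\<forall>\<^sub>F y in at_infinity. h y < 1" by (rule order_tendstoD(2)[OF lim]) simp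
  then obtain R where R: "\<And>y. R \<le> norm y \<Longrightarrow> h y < 1" unfolding eventually_at_infinity by auto
  have "compact (h ` {-\<bar>R\<bar>..\<bar>R\<bar>})"
    using c by (intro compact_continuous_image continuous_on_subset[OF c]) auto
  then have "bdd_above (h ` {-\<bar>R\<bar>..\<bar>R\<bar>})" by (rule bounded_imp_bdd_above[OF compact_imp_bounded])
  then obtain S where "\<forall>v\<in>h ` {-\<bar>R\<bar>..\<bar>R\<bar>}. v \<le> S" unfolding bdd_above_def by blast
  then have S: "h y \<le> S" if "y \<in> {-\<bar>R\<bar>..\<bar>R\<bar>}" for y using that by blast
  have "h y \<le> max S 1" for y
  proof (cases "y \<in> {-\<bar>R\<bar>..\<bar>R\<bar>}")
    case True then show ?thesis using S[OF True] by simp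
  next
    case False
    then have "R \<le> norm y" by (auto simp: abs_if split: if_splits)
    then show ?thesis using R[of y] by simp
  qed
  then show ?thesis by (rule that)
qed

text \<open>
  On \<open>[-1, 1]\<close> use the bound, elsewhere \<open>1 \<le> \<bar>y\<bar>\<^sup>2\<close>.
\<close>

lemma integrable_of_bounded_square_integrable:
  fixes h :: "real \<Rightarrow> real"
  assumes [measurable]: "h \<in> borel_measurable borel" and h: "\<And>y. 0 \<le> h y" "\<And>y. h y \<le> S"
    and int: "integrable lborel (\<lambda>y. \<bar>y\<bar>\<^sup>2 * h y)"
  shows "(\<integral>\<^sup>+y. ennreal (h y) \<partial>lborel) < \<infinity>"
proof -
  have S0: "0 \<le> S" using h(1)[of 0] h(2)[of 0] by linarith
  have "(\<integral>\<^sup>+y. ennreal (h y) \<partial>lborel) \<le> (\<integral>\<^sup>+y. ennreal S * indicator {-1..1} y + ennreal (\<bar>y\<bar>\<^sup>2 * h y) \<partial>lborel)"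
  proof (rule nn_integral_mono)
    fix y
    show "ennreal (h y) \<le> ennreal S * indicator {-1..1} y + ennreal (\<bar>y\<bar>\<^sup>2 * h y)"
    proof (cases "y \<in> {-1..1}")
      case True
      have "ennreal (h y) \<le> ennreal S" by (rule ennreal_leI[OF h(2)])
      then show ?thesis using True by (simp add: add_increasing2)
    next
      case False
      then have "1 \<le> \<bar>y\<bar>" by auto
      then have "1 * h y \<le> \<bar>y\<bar>\<^sup>2 * h y" using h(1) by (intro mult_right_mono one_le_power)
      then show ?thesis using False by (simp add: ennreal_leI)
    qed
  qed
  also have "\<dots> = ennreal S * emeasure lborel {-1..1::real} + (\<integral>\<^sup>+y. ennreal (\<bar>y\<bar>\<^sup>2 * h y) \<partial>lborel)"
    by (subst nn_integral_add) (auto simp: nn_integral_cmult_indicator)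
  also have "\<dots> < \<infinity>"
    using int h(1) by (simp add: ennreal_mult_less_top nn_integral_eq_integral)
  finally show ?thesis .
qed

lemma gaussian_rv_cong_AE:
  assumes "gaussian_rv M Y" "Y' \<in> borel_measurable M" "AE \<omega> in M. Y \<omega> = Y' \<omega>"
  shows "gaussian_rv M Y'"
proof -
  have "distr M borel Y = distr M borel Y'"
    using assms by (intro distr_cong_AE) (auto simp: gaussian_rv_def)
  then show ?thesis using assms unfolding gaussian_rv_def by simp
qed

text \<open>
  Paths and local times are regular only off a null set \<open>N\<close>. Precomposition with this map replaces
  them on \<open>N\<close> by those of a single regular \<open>\<omega>\<^sub>0\<close>. Setting them to zero on \<open>N\<close> would not do: the occupation
  measure of a constant path is a point mass and has no density.
\<close>

lemma null_set_repair:
  assumes "prob_space M" "N \<in> null_sets M" "\<omega>\<^sub>0 \<in> space M"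
  defines "\<theta> \<equiv> \<lambda>\<omega>. if \<omega> \<in> N then \<omega>\<^sub>0 else \<omega>"
  shows "\<theta> \<in> measurable M M" "AE \<omega> in M. \<theta> \<omega> = \<omega>"
proof -
  have [measurable]: "N \<in> sets M" using assms by auto
  show "\<theta> \<in> measurable M M" unfolding \<theta>_def using assms by measurable
  show "AE \<omega> in M. \<theta> \<omega> = \<omega>" using AE_not_in[OF assms(2)] by eventually_elim (simp add: \<theta>_def)
qed

lemma scaled_fbm_repaired:
  assumes M: "prob_space M" and H: "0 < H" "H < 1" and \<sigma>: "\<sigma> > 0"
    and B: "fractional_brownian_motion M H B"
    and \<theta>: "\<theta> \<in> measurable M M" "AE \<omega> in M. \<theta> \<omega> = \<omega>"
  shows "scaled_fbm M H \<sigma> (\<lambda>t \<omega>. \<sigma> * B t (\<theta> \<omega>))"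
proof -
  interpret prob_space M by fact
  have gp: "gaussian_rv M (\<lambda>\<omega>. \<Sum>t\<in>I. c t * B t \<omega>)" if "finite I" "I \<subseteq> {0..}" for I c
    using B that unfolding fractional_brownian_motion_def gaussian_process_def by auto
  have Bm: "B t \<in> borel_measurable M" if "t \<ge> 0" for t
    using gp[of "{t}" "\<lambda>_. 1"] that by (simp add: gaussian_rv_def)
  have B\<theta>: "(\<lambda>\<omega>. B t (\<theta> \<omega>)) \<in> borel_measurable M" if "t \<ge> 0" for t
    by (rule measurable_compose[OF \<theta>(1) Bm[OF that]])
  show ?thesis
  proof (intro scaled_fbm.intro scaled_fbm_axioms.intro M H \<sigma>)
    show "gaussian_process M (\<lambda>t \<omega>. \<sigma> * B t (\<theta> \<omega>))"
      unfolding gaussian_process_def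
    proof (intro allI impI)
      fix I :: "real set" and c assume I: "finite I \<and> I \<subseteq> {0..}"
      have m: "(\<lambda>\<omega>. \<Sum>t\<in>I. (c t * \<sigma>) * B t (\<theta> \<omega>)) \<in> borel_measurable M"
        using I B\<theta> by (intro borel_measurable_sum borel_measurable_times) auto
      have "gaussian_rv M (\<lambda>\<omega>. \<Sum>t\<in>I. (c t * \<sigma>) * B t (\<theta> \<omega>))"
        by (rule gaussian_rv_cong_AE[OF gp m]) (use I \<theta>(2) in auto)
      then show "gaussian_rv M (\<lambda>\<omega>. \<Sum>t\<in>I. c t * (\<sigma> * B t (\<theta> \<omega>)))" by (simp add: mult.assoc)
    qed
    fix t :: real assume t: "0 \<le> t"
    have "expectation (\<lambda>\<omega>. B t (\<theta> \<omega>)) = expectation (B t)"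
      by (rule integral_cong_AE[OF B\<theta>[OF t] Bm[OF t]]) (use \<theta>(2) in auto)
    then show "expectation (\<lambda>\<omega>. \<sigma> * B t (\<theta> \<omega>)) = 0"
      using B t by (simp add: fractional_brownian_motion_def)
    fix s :: real assume s: "0 \<le> s"
    note [measurable] = B\<theta>[OF t] B\<theta>[OF s] Bm[OF t] Bm[OF s]
    have "expectation (\<lambda>\<omega>. \<sigma> * B t (\<theta> \<omega>) * (\<sigma> * B s (\<theta> \<omega>))) = expectation (\<lambda>\<omega>. \<sigma>\<^sup>2 * (B t \<omega> * B s \<omega>))"
    proof (rule integral_cong_AE)
      show "AE \<omega> in M. \<sigma> * B t (\<theta> \<omega>) * (\<sigma> * B s (\<theta> \<omega>)) = \<sigma>\<^sup>2 * (B t \<omega> * B s \<omega>)"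
        using \<theta>(2) by eventually_elim (simp add: power2_eq_square)
    qed measurable
    also have "\<dots> = \<sigma>\<^sup>2 * ((t powr (2 * H) + s powr (2 * H) - \<bar>t - s\<bar> powr (2 * H)) / 2)"
      using B t s by (simp add: fractional_brownian_motion_def)
    finally show "expectation (\<lambda>\<omega>. \<sigma> * B t (\<theta> \<omega>) * (\<sigma> * B s (\<theta> \<omega>))) = fbm_cov \<sigma> H t s"
      by (simp add: fbm_cov_def)
  qed
qed

text \<open>
  The original variables agree with measurable ones off a null set, which makes them measurable for
  the completion with the same probabilities.
\<close>

lemma tendsto_0_in_probability_cong_AE:
  assumes Z: "\<And>n. Z n \<in> borel_measurable M" and eq: "AE \<omega> in M. \<forall>n. Z' n \<omega> = Z n \<omega>"
    and lim: "\<And>\<epsilon>::real. \<epsilon> > 0 \<Longrightarrow> (\<lambda>n. measure M {\<omega> \<in> space M. Z n \<omega> > ennreal \<epsilon>}) \<longlonglongrightarrow> 0"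
  shows "tendsto_0_in_probability M Z'"
proof -
  have eq': "AE \<omega> in completion M. \<forall>n. Z' n \<omega> = Z n \<omega>" using eq by (rule AE_completion)
  have Zc: "Z n \<in> borel_measurable (completion M)" for n using Z by (rule measurable_completion)
  have Z'c: "Z' n \<in> borel_measurable (completion M)" for n
  proof (rule measurableI)
    fix A :: "ennreal set" assume A: "A \<in> sets borel"
    show "Z' n -` A \<inter> space (completion M) \<in> sets (completion M)"
    proof (rule completion.in_sets_AE)
      show "Z n -` A \<inter> space (completion M) \<in> sets (completion M)"
        by (rule measurable_sets[OF Zc A])
      show "AE \<omega> in completion M. (\<omega> \<in> Z n -` A \<inter> space (completion M)) = (\<omega> \<in> Z' n -` A \<inter> space (completion M))"
        using eq' by eventually_elim auto
    qed auto
  qed simp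
  have "measure (completion M) {\<omega> \<in> space M. Z' n \<omega> > ennreal \<epsilon>} = measure M {\<omega> \<in> space M. Z n \<omega> > ennreal \<epsilon>}" for n \<epsilon>
  proof -
    have s: "{\<omega> \<in> space M. Z n \<omega> > ennreal \<epsilon>} \<in> sets M" using Z[of n] by measurable
    have "{\<omega> \<in> space (completion M). Z' n \<omega> > ennreal \<epsilon>} \<in> sets (completion M)" using Z'c[of n] by measurable
    then have s': "{\<omega> \<in> space M. Z' n \<omega> > ennreal \<epsilon>} \<in> sets (completion M)" by simp
    have "measure (completion M) {\<omega> \<in> space M. Z' n \<omega> > ennreal \<epsilon>} = measure (completion M) {\<omega> \<in> space M. Z n \<omega> > ennreal \<epsilon>}"
      by (rule measure_eq_AE[OF _ s']) (use eq' s in \<open>auto elim: eventually_mono\<close>)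
    then show ?thesis using s by simp
  qed
  then show ?thesis
    unfolding tendsto_0_in_probability_def using Z'c lim by simp
qed

theorem theorem2p1:
  fixes M :: "'a measure"
    and H \<sigma> x :: real
    and B X :: "real \<Rightarrow> 'a \<Rightarrow> real"
    and L :: "real \<Rightarrow> real \<Rightarrow> 'a \<Rightarrow> real"
    and f :: "real \<times> real \<Rightarrow> real"
    and h1 h2 :: "real \<Rightarrow> real"
    and u :: "nat \<Rightarrow> real"
  assumes "prob_space M"
    and "0 < H" "H < 1" and "\<sigma> > 0"
    and "fractional_brownian_motion M H B"
    and "X = (\<lambda>t \<omega>. \<sigma> * B t \<omega>)"
    and "continuous_local_time M X L"
    and "f \<in> borel_measurable borel"
    and "\<And>y z. \<bar>f (y, z)\<bar> \<le> h1 y * h2 z"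
    and "\<And>y. h1 y \<ge> 0" and "\<And>z. h2 z \<ge> 0"
    and "continuous_on UNIV h1" and "continuous_on UNIV h2"
    and "(h1 \<longlongrightarrow> 0) at_infinity"
    and "integrable lborel (\<lambda>y. \<bar>y\<bar>\<^sup>2 * h1 y)"
    and "polynomial_growth h2"
    and "\<And>n. n \<ge> 1 \<Longrightarrow> u n > 0"
    and "filterlim u at_top sequentially"
    and "(\<lambda>n. u n / real n) \<longlonglongrightarrow> 0"
  shows "ucp M (V_stat X H x u f)
           (\<lambda>t \<omega>. L t x \<omega> * (\<integral>(y, z). f (y, z) * normal_density 0 \<sigma> z \<partial>lborel))"
proof -
  interpret prob_space M by fact
  have h1m[measurable]: "h1 \<in> borel_measurable borel" and h2m[measurable]: "h2 \<in> borel_measurable borel"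
    using assms(12,13) by (auto intro: borel_measurable_continuous_onI)
  obtain S where S: "\<And>y. h1 y \<le> S" using bounded_of_continuous_vanishing[OF assms(12,14)] by blast
  obtain C where C: "\<And>z. (h2 z + 1)\<^sup>2 \<le> C * (exp z + exp (- z))"
    using polynomial_growth_square_le_exp[OF assms(16,11)] by blast
  (* Enlarging the majorants makes room for the unit kernel of the occupation integral. *)
  define h where "h y = h1 y + indicator {0..1} y" for y :: real
  define k where "k z = h2 z + 1" for z
  have hm: "h \<in> borel_measurable borel" "k \<in> borel_measurable borel" unfolding h_def k_def by measurable
  have h_fin: "(\<integral>\<^sup>+y. ennreal (h y) \<partial>lborel) < \<infinity>"
  proof -
    have "(\<integral>\<^sup>+y. ennreal (h y) \<partial>lborel) = (\<integral>\<^sup>+y. ennreal (h1 y) + indicator {0..1} y \<partial>lborel)"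
      unfolding h_def using assms(10) by (intro nn_integral_cong) (simp add: ennreal_plus ennreal_indicator)
    also have "\<dots> = (\<integral>\<^sup>+y. ennreal (h1 y) \<partial>lborel) + 1"
      by (subst nn_integral_add) auto
    also have "\<dots> < \<infinity>"
      using integrable_of_bounded_square_integrable[OF h1m assms(10) S assms(15)] by simp
    finally show ?thesis .
  qed
  have "AE \<omega> in M. continuous_on {0..} (\<lambda>t. B t \<omega>)"
    using assms(5) by (simp add: fractional_brownian_motion_def)
  moreover have "AE \<omega> in M. continuous_on ({0..} \<times> UNIV) (\<lambda>(t, y). L t y \<omega>) \<and> (\<forall>t\<ge>0. \<forall>y. L t y \<omega> \<ge> 0) \<and>
      (\<forall>t\<ge>0. occupation_measure (\<lambda>s. X s \<omega>) t = density lborel (\<lambda>y. ennreal (L t y \<omega>)))"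
    using assms(7) by (simp add: continuous_local_time_def)
  ultimately have "AE \<omega> in M. continuous_on {0..} (\<lambda>t. B t \<omega>) \<and> continuous_on ({0..} \<times> UNIV) (\<lambda>(t, y). L t y \<omega>) \<and>
      (\<forall>t\<ge>0. \<forall>y. L t y \<omega> \<ge> 0) \<and>
      (\<forall>t\<ge>0. occupation_measure (\<lambda>s. X s \<omega>) t = density lborel (\<lambda>y. ennreal (L t y \<omega>)))"
    by eventually_elim blast
  then obtain N where N: "{\<omega> \<in> space M. \<not> (continuous_on {0..} (\<lambda>t. B t \<omega>) \<and> continuous_on ({0..} \<times> UNIV) (\<lambda>(t, y). L t y \<omega>) \<and>
      (\<forall>t\<ge>0. \<forall>y. L t y \<omega> \<ge> 0) \<and>
      (\<forall>t\<ge>0. occupation_measure (\<lambda>s. X s \<omega>) t = density lborel (\<lambda>y. ennreal (L t y \<omega>))))} \<subseteq> N" "emeasure M N = 0" "N \<in> sets M"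
    by (rule AE_E)
  have Nn: "N \<in> null_sets M" using N by auto
  have good: "continuous_on {0..} (\<lambda>t. B t \<omega>)" "continuous_on ({0..} \<times> UNIV) (\<lambda>(t, y). L t y \<omega>)"
      "\<And>t y. t \<ge> 0 \<Longrightarrow> L t y \<omega> \<ge> 0"
      "\<And>t. t \<ge> 0 \<Longrightarrow> occupation_measure (\<lambda>s. X s \<omega>) t = density lborel (\<lambda>y. ennreal (L t y \<omega>))"
    if "\<omega> \<in> space M" "\<omega> \<notin> N" for \<omega>
    using N(1) that by blast+
  have "space M - N \<noteq> {}"
  proof
    assume "space M - N = {}"
    then have "N = space M" using sets.sets_into_space[OF N(3)] by auto
    then show False using N(2) emeasure_space_1 by simp
  qed
  then obtain \<omega>\<^sub>0 where \<omega>\<^sub>0: "\<omega>\<^sub>0 \<in> space M" "\<omega>\<^sub>0 \<notin> N" by auto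
  define \<theta> where "\<theta> = (\<lambda>\<omega>. if \<omega> \<in> N then \<omega>\<^sub>0 else \<omega>)"
  have \<theta>: "\<theta> \<in> measurable M M" "AE \<omega> in M. \<theta> \<omega> = \<omega>"
    unfolding \<theta>_def by (rule null_set_repair[OF assms(1) Nn \<omega>\<^sub>0(1)])+
  have \<theta>_good: "\<theta> \<omega> \<in> space M" "\<theta> \<omega> \<notin> N" if "\<omega> \<in> space M" for \<omega>
    using that \<omega>\<^sub>0 by (auto simp: \<theta>_def)
  (* Versions of process and local time that are regular for every outcome. *)
  define X0 where "X0 t \<omega> = \<sigma> * B t (\<theta> \<omega>)" for t \<omega>
  define L0 where "L0 t y \<omega> = L t y (\<theta> \<omega>)" for t y \<omega>
  have X0: "X0 t \<omega> = X t (\<theta> \<omega>)" for t \<omega> unfolding X0_def assms(6) ..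
  have fbm: "scaled_fbm M H \<sigma> X0"
    unfolding X0_def[abs_def] by (rule scaled_fbm_repaired[OF assms(1-5) \<theta>])
  have "local_time_setting M H \<sigma> X0 u h k (S + 1) C L0"
  proof (intro local_time_setting.intro kernel_setting.intro fbm kernel_setting_axioms.intro local_time_setting_axioms.intro
      assms(17-19) hm h_fin)
    fix \<omega> assume \<omega>: "\<omega> \<in> space M"
    note g = good[OF \<theta>_good[OF \<omega>]]
    show "continuous_on {0..} (\<lambda>t. X0 t \<omega>)" unfolding X0_def by (intro continuous_intros g(1))
    show "continuous_on ({0..} \<times> UNIV) (\<lambda>(t, y). L0 t y \<omega>)" unfolding L0_def by (rule g(2))
    show "0 \<le> L0 t y \<omega>" if "0 \<le> t" for t y unfolding L0_def using that by (rule g(3))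
    show "occupation_measure (\<lambda>s. X0 s \<omega>) t = density lborel (\<lambda>y. ennreal (L0 t y \<omega>))" if "0 \<le> t" for t
      unfolding L0_def X0 using that by (rule g(4))
  next
    fix y :: real
    show "0 \<le> h y" unfolding h_def using assms(10) by simp
    show "h y \<le> S + 1" unfolding h_def using S[of y] by (simp add: indicator_def)
    show "1 \<le> h y" if "0 \<le> y" "y \<le> 1" unfolding h_def using assms(10) that by simp
  next
    fix z :: real
    show "0 \<le> k z" "1 \<le> k z" unfolding k_def using assms(11)[of z] by auto
    show "(k z)\<^sup>2 \<le> C * (exp z + exp (- z))" unfolding k_def by (rule C)
  qed
  then interpret lt: local_time_setting M H \<sigma> X0 x u h k "S + 1" C L0 .
  have le: "\<bar>f (y, z)\<bar> \<le> h y * k z" for y z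
  proof -
    have "h1 y * h2 z \<le> h y * k z"
      unfolding h_def k_def using assms(10)[of y] assms(11)[of z] by (intro mult_mono) auto
    then show ?thesis using assms(9)[of y z] by linarith
  qed
  let ?c = "\<integral>(y, z). f (y, z) * normal_density 0 \<sigma> z \<partial>lborel"
  show ?thesis
    unfolding ucp_def
  proof (intro allI impI)
    fix T :: real assume T: "0 < T"
    show "tendsto_0_in_probability M (\<lambda>n \<omega>. SUP t\<in>{0..T}. ennreal \<bar>V_stat X H x u f n t \<omega> - L t x \<omega> * ?c\<bar>)"
    proof (rule tendsto_0_in_probability_cong_AE)
      show "(\<lambda>\<omega>. SUP t\<in>{0..T}. ennreal \<bar>V_stat X0 H x u f n t \<omega> - L0 t x \<omega> * ?c\<bar>) \<in> borel_measurable M" for n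
        by (rule lt.deviation_sup_measurable[OF assms(8) T])
      show "(\<lambda>n. prob {\<omega> \<in> space M. ennreal \<epsilon> < (SUP t\<in>{0..T}. ennreal \<bar>V_stat X0 H x u f n t \<omega> - L0 t x \<omega> * ?c\<bar>)}) \<longlonglongrightarrow> 0"
        if "0 < \<epsilon>" for \<epsilon>
        by (rule lt.uniform_deviation_null[OF assms(8) le T that])
      show "AE \<omega> in M. \<forall>n. (SUP t\<in>{0..T}. ennreal \<bar>V_stat X H x u f n t \<omega> - L t x \<omega> * ?c\<bar>)
        = (SUP t\<in>{0..T}. ennreal \<bar>V_stat X0 H x u f n t \<omega> - L0 t x \<omega> * ?c\<bar>)"
        using \<theta>(2)
      proof eventually_elim
        case (elim \<omega>)
        have "X0 t \<omega> = X t \<omega>" "L0 t y \<omega> = L t y \<omega>" for t y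
          unfolding X0 L0_def elim by simp_all
        then show ?case unfolding V_stat_def by simp
      qed
    qed
  qed
qed

end
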